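(* Let $G$ be a finitely generated group. If the infinite order element $g\in G$ is contained in a virtually cyclic subgroup $E(g)$ of $G$ which is hyperbolically embedded in $G$ (i.e. $\{E(g)\}\hookrightarrow_h G$), then $g$ is Morse.
   Context: $G$ is endowed with the word metric $d_G$ of a fixed finite generating set. $N_C(A)$ denotes the closed $C$-neighbourhood of a subset $A$ with respect to $d_G$. Quasi-geodesics: a $(\mu,c)$-quasi-geodesic is a $(\mu,c)$-quasi-isometric embedding of an interval, i.e. a map $\gamma$ from an interval with $|s-t|/\mu-c\le d(\gamma(s),\gamma(t))\le \mu|s-t|+c$ for all $s,t$. Morse: an element $g\in G$ is Morse if the map $\mathbb Z\to G$, $n\mapsto g^n$, is a quasi-isometric embedding and for every $\mu,c$ there is a constant $C=C(\mu,c)$ such that any $(\mu,c)$-quasi-geodesic in $G$ whose endpoints are in $\langle g\rangle$ is contained in $N_C(\langle g\rangle)$. Hyperbolically embedded subgroups: for $G$ a finitely generated group and $H_1,\dots,H_n<G$ finitely generated subgroups, one says that $\{H_i\}$ is hyperbolically embedded in $(G,Y)$, where $Y\subseteq G$ is a (possibly infinite) generating set, written $\{H_i\}\hookrightarrow_h (G,Y)$, if the Cayley graph $\Gamma=Cay(G,Y)$ is hyperbolic relative to the collection $\{gH_i\}$ of left cosets of the $H_i$'s, and the restriction of $d_\Gamma$ to each $H_i$ is proper (each ball of finite radius contains only finitely many elements of $H_i$). One writes $\{H_i\}\hookrightarrow_h G$ if $\{H_i\}\hookrightarrow_h (G,Y)$ for some such $Y$. Relatively hyperbolic metric spaces: a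 geodesic metric space $X$ is hyperbolic relative to a family $\mathcal P$ of subsets (also: asymptotically tree-graded with respect to $\mathcal P$) if every asymptotic cone of $X$ is tree-graded with respect to the collection of non-empty ultralimits of sequences of elements of $\mathcal P$, where ultralimits of two sequences that differ almost surely (with respect to the ultrafilter) are regarded as different pieces. A complete geodesic metric space $F$ is tree-graded with respect to a collection of closed geodesic subsets (pieces) if any two different pieces intersect in at most one point and every simple geodesic triangle in $F$ is contained in one piece. *)

theory Defs
  imports "HOL-Algebra.Generated_Groups" "HOL-Algebra.Left_Coset" "HOL-Algebra.Multiplicative_Group"
    "HOL-Analysis.Abstract_Metric_Spaces"
begin

section \<open>Groups and word metrics\<close>

definition finitely_generated :: "('a, 'b) monoid_scheme \<Rightarrow> bool" where
  "finitely_generated K \<longleftrightarrow> (\<exists>S \<subseteq> carrier K. finite S \<and> generate K S = carrier K)"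

definition virtually_cyclic :: "('a, 'b) monoid_scheme \<Rightarrow> bool" where
  "virtually_cyclic K \<longleftrightarrow> (\<exists>a \<in> carrier K. finite (rcosets\<^bsub>K\<^esub> (generate K {a})))"

definition word_length :: "('a, 'b) monoid_scheme \<Rightarrow> 'a set \<Rightarrow> 'a \<Rightarrow> nat" where
  "word_length G S x =
     (LEAST n. \<exists>ws. length ws = n \<and> set ws \<subseteq> S \<union> m_inv G ` S \<and> foldr (\<otimes>\<^bsub>G\<^esub>) ws \<one>\<^bsub>G\<^esub> = x)"

definition word_dist :: "('a, 'b) monoid_scheme \<Rightarrow> 'a set \<Rightarrow> 'a \<Rightarrow> 'a \<Rightarrow> real" where
  "word_dist G S x y = real (word_length G S (inv\<^bsub>G\<^esub> x \<otimes>\<^bsub>G\<^esub> y))"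


section \<open>Morse elements\<close>

definition qi_embedding ::
  "real \<Rightarrow> real \<Rightarrow> 'x set \<Rightarrow> ('x \<Rightarrow> 'x \<Rightarrow> real) \<Rightarrow> 'y set \<Rightarrow> ('y \<Rightarrow> 'y \<Rightarrow> real) \<Rightarrow> ('x \<Rightarrow> 'y) \<Rightarrow> bool"
  where
  "qi_embedding \<mu> c A dA B dB f \<longleftrightarrow>
     f ` A \<subseteq> B \<and>
     (\<forall>s\<in>A. \<forall>t\<in>A. dA s t / \<mu> - c \<le> dB (f s) (f t) \<and> dB (f s) (f t) \<le> \<mu> * dA s t + c)"

text \<open>The curve need not be continuous; \<open>B\<close> may be a discrete space such as a group.\<close>

definition quasi_geodesic ::
  "real \<Rightarrow> real \<Rightarrow> 'y set \<Rightarrow> ('y \<Rightarrow> 'y \<Rightarrow> real) \<Rightarrow> real \<Rightarrow> real \<Rightarrow> (real \<Rightarrow> 'y) \<Rightarrow> bool" where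
  "quasi_geodesic \<mu> c B dB a b \<gamma> \<longleftrightarrow> a \<le> b \<and> qi_embedding \<mu> c {a..b} dist B dB \<gamma>"

text \<open>Word metrics take integer values, so distances to nonempty sets are attained and the
  closed neighbourhood of a nonempty set is described by an existential quantifier.\<close>

definition closed_nbhd :: "('a, 'b) monoid_scheme \<Rightarrow> 'a set \<Rightarrow> real \<Rightarrow> 'a set \<Rightarrow> 'a set" where
  "closed_nbhd G S C A = {x \<in> carrier G. \<exists>y\<in>A. word_dist G S x y \<le> C}"

definition morse :: "('a, 'b) monoid_scheme \<Rightarrow> 'a set \<Rightarrow> 'a \<Rightarrow> bool" where
  "morse G S g \<longleftrightarrow>
     g \<in> carrier G \<and>
     (\<exists>\<mu>\<ge>1. \<exists>c\<ge>0. qi_embedding \<mu> c (UNIV :: int set) dist (carrier G) (word_dist G S)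
                     (\<lambda>n. g [^]\<^bsub>G\<^esub> n)) \<and>
     (\<forall>\<mu>\<ge>1. \<forall>c\<ge>0. \<exists>C. \<forall>a b \<gamma>.
        quasi_geodesic \<mu> c (carrier G) (word_dist G S) a b \<gamma> \<and>
        \<gamma> a \<in> generate G {g} \<and> \<gamma> b \<in> generate G {g} \<longrightarrow>
        \<gamma> ` {a..b} \<subseteq> closed_nbhd G S C (generate G {g}))"


section \<open>Tree-graded spaces\<close>

definition geodesic_segment :: "'x set \<Rightarrow> ('x \<Rightarrow> 'x \<Rightarrow> real) \<Rightarrow> 'x \<Rightarrow> 'x \<Rightarrow> 'x set \<Rightarrow> bool" where
  "geodesic_segment X d x y s \<longleftrightarrow>
     (\<exists>\<gamma>. \<gamma> 0 = x \<and> \<gamma> (d x y) = y \<and> \<gamma> ` {0..d x y} = s \<and> s \<subseteq> X \<and>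
          (\<forall>u\<in>{0..d x y}. \<forall>v\<in>{0..d x y}. d (\<gamma> u) (\<gamma> v) = \<bar>u - v\<bar>))"

definition geodesic_space :: "'x set \<Rightarrow> ('x \<Rightarrow> 'x \<Rightarrow> real) \<Rightarrow> bool" where
  "geodesic_space X d \<longleftrightarrow>
     Metric_space X d \<and> (\<forall>x\<in>X. \<forall>y\<in>X. \<exists>s. geodesic_segment X d x y s)"

text \<open>Three geodesic segments joining three distinct points in cyclic order and whose union is
  a simple closed curve.\<close>

definition simple_geodesic_triangle ::
  "'x set \<Rightarrow> ('x \<Rightarrow> 'x \<Rightarrow> real) \<Rightarrow> 'x set \<Rightarrow> 'x set \<Rightarrow> 'x set \<Rightarrow> bool" where
  "simple_geodesic_triangle X d s1 s2 s3 \<longleftrightarrow>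
     (\<exists>x\<in>X. \<exists>y\<in>X. \<exists>z\<in>X. x \<noteq> y \<and> y \<noteq> z \<and> z \<noteq> x \<and>
        geodesic_segment X d x y s1 \<and> geodesic_segment X d y z s2 \<and> geodesic_segment X d z x s3 \<and>
        s1 \<inter> s2 = {y} \<and> s2 \<inter> s3 = {z} \<and> s3 \<inter> s1 = {x})"

text \<open>The pieces form an indexed family: pieces with different indices count as different even
  when they are equal as sets.\<close>

definition tree_graded ::
  "'x set \<Rightarrow> ('x \<Rightarrow> 'x \<Rightarrow> real) \<Rightarrow> 'i set \<Rightarrow> ('i \<Rightarrow> 'x set) \<Rightarrow> bool" where
  "tree_graded F d I P \<longleftrightarrow>
     geodesic_space F d \<and> Metric_space.mcomplete F d \<and>
     (\<forall>i\<in>I. closedin (Metric_space.mtopology F d) (P i) \<and> geodesic_space (P i) d) \<and>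
     (\<forall>i\<in>I. \<forall>j\<in>I. i \<noteq> j \<longrightarrow> (\<forall>x \<in> P i \<inter> P j. \<forall>y \<in> P i \<inter> P j. x = y)) \<and>
     (\<forall>s1 s2 s3. simple_geodesic_triangle F d s1 s2 s3 \<longrightarrow> (\<exists>i\<in>I. s1 \<union> s2 \<union> s3 \<subseteq> P i))"


section \<open>Asymptotic cones\<close>

definition nonprincipal_ultrafilter :: "nat filter \<Rightarrow> bool" where
  "nonprincipal_ultrafilter \<omega> \<longleftrightarrow>
     \<omega> \<noteq> bot \<and>
     (\<forall>Q. eventually Q \<omega> \<or> eventually (\<lambda>n. \<not> Q n) \<omega>) \<and>
     (\<forall>k. \<not> eventually (\<lambda>n. n = k) \<omega>)"

text \<open>In the following, \<open>e\<close> is the sequence of base points and \<open>r\<close> the sequence of scaling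
  factors, by which distances are divided.\<close>

definition cone_seqs ::
  "'x set \<Rightarrow> ('x \<Rightarrow> 'x \<Rightarrow> real) \<Rightarrow> nat filter \<Rightarrow> (nat \<Rightarrow> 'x) \<Rightarrow> (nat \<Rightarrow> real) \<Rightarrow> (nat \<Rightarrow> 'x) set" where
  "cone_seqs X d \<omega> e r =
     {x. (\<forall>n. x n \<in> X) \<and> (\<exists>B. eventually (\<lambda>n. d (e n) (x n) / r n \<le> B) \<omega>)}"

definition cone_rel ::
  "'x set \<Rightarrow> ('x \<Rightarrow> 'x \<Rightarrow> real) \<Rightarrow> nat filter \<Rightarrow> (nat \<Rightarrow> 'x) \<Rightarrow> (nat \<Rightarrow> real) \<Rightarrow> (nat \<Rightarrow> 'x) rel" where
  "cone_rel X d \<omega> e r =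
     {(x, y). x \<in> cone_seqs X d \<omega> e r \<and> y \<in> cone_seqs X d \<omega> e r \<and>
              ((\<lambda>n. d (x n) (y n) / r n) \<longlongrightarrow> 0) \<omega>}"

definition asymp_cone ::
  "'x set \<Rightarrow> ('x \<Rightarrow> 'x \<Rightarrow> real) \<Rightarrow> nat filter \<Rightarrow> (nat \<Rightarrow> 'x) \<Rightarrow> (nat \<Rightarrow> real) \<Rightarrow> (nat \<Rightarrow> 'x) set set"
  where
  "asymp_cone X d \<omega> e r = cone_seqs X d \<omega> e r // cone_rel X d \<omega> e r"

text \<open>The value outside the cone is irrelevant; it is set to 0 because \<open>Metric_space\<close> demands
  a globally nonnegative and symmetric distance function.\<close>

definition cone_dist ::
  "'x set \<Rightarrow> ('x \<Rightarrow> 'x \<Rightarrow> real) \<Rightarrow> nat filter \<Rightarrow> (nat \<Rightarrow> 'x) \<Rightarrow> (nat \<Rightarrow> real) \<Rightarrow>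
     (nat \<Rightarrow> 'x) set \<Rightarrow> (nat \<Rightarrow> 'x) set \<Rightarrow> real" where
  "cone_dist X d \<omega> e r p q =
     (if p \<in> asymp_cone X d \<omega> e r \<and> q \<in> asymp_cone X d \<omega> e r
      then THE l. \<exists>x\<in>p. \<exists>y\<in>q. ((\<lambda>n. d (x n) (y n) / r n) \<longlongrightarrow> l) \<omega>
      else 0)"

definition ultralimit ::
  "'x set \<Rightarrow> ('x \<Rightarrow> 'x \<Rightarrow> real) \<Rightarrow> nat filter \<Rightarrow> (nat \<Rightarrow> 'x) \<Rightarrow> (nat \<Rightarrow> real) \<Rightarrow>
     (nat \<Rightarrow> 'x set) \<Rightarrow> (nat \<Rightarrow> 'x) set set" where
  "ultralimit X d \<omega> e r A =
     {p \<in> asymp_cone X d \<omega> e r. \<exists>x\<in>p. eventually (\<lambda>n. x n \<in> A n) \<omega>}"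

text \<open>Pieces are indexed by sequences of elements of \<open>\<P>\<close> up to \<open>\<omega>\<close>-almost sure equality. The
  ultralimit of a sequence depends only on its class, so the union defining \<open>cone_piece\<close> is a
  union of equal sets.\<close>

definition as_equal :: "'s set \<Rightarrow> nat filter \<Rightarrow> (nat \<Rightarrow> 's) rel" where
  "as_equal \<P> \<omega> =
     {(A, B). (\<forall>n. A n \<in> \<P>) \<and> (\<forall>n. B n \<in> \<P>) \<and> eventually (\<lambda>n. A n = B n) \<omega>}"

definition cone_piece ::
  "'x set \<Rightarrow> ('x \<Rightarrow> 'x \<Rightarrow> real) \<Rightarrow> nat filter \<Rightarrow> (nat \<Rightarrow> 'x) \<Rightarrow> (nat \<Rightarrow> real) \<Rightarrow>
     (nat \<Rightarrow> 'x set) set \<Rightarrow> (nat \<Rightarrow> 'x) set set" where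
  "cone_piece X d \<omega> e r i = (\<Union>A\<in>i. ultralimit X d \<omega> e r A)"

definition cone_piece_indices ::
  "'x set \<Rightarrow> ('x \<Rightarrow> 'x \<Rightarrow> real) \<Rightarrow> 'x set set \<Rightarrow> nat filter \<Rightarrow> (nat \<Rightarrow> 'x) \<Rightarrow> (nat \<Rightarrow> real) \<Rightarrow>
     (nat \<Rightarrow> 'x set) set set" where
  "cone_piece_indices X d \<P> \<omega> e r =
     {i \<in> {A. \<forall>n. A n \<in> \<P>} // as_equal \<P> \<omega>. cone_piece X d \<omega> e r i \<noteq> {}}"

definition hyperbolic_relative :: "'x set \<Rightarrow> ('x \<Rightarrow> 'x \<Rightarrow> real) \<Rightarrow> 'x set set \<Rightarrow> bool" where
  "hyperbolic_relative X d \<P> \<longleftrightarrow>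
     geodesic_space X d \<and> (\<forall>A\<in>\<P>. A \<subseteq> X) \<and>
     (\<forall>\<omega> e r. nonprincipal_ultrafilter \<omega> \<and> (\<forall>n. e n \<in> X) \<and> (\<forall>n. 0 < r n) \<and>
        filterlim r at_top \<omega> \<longrightarrow>
        tree_graded (asymp_cone X d \<omega> e r) (cone_dist X d \<omega> e r)
          (cone_piece_indices X d \<P> \<omega> e r) (cone_piece X d \<omega> e r))"


section \<open>Cayley graphs\<close>

text \<open>The Cayley graph as a metric graph with edges of length 1. A point is given by its
  barycentric coordinates, that is, by a nonnegative function of total mass 1 supported on a
  vertex or on the two ends of an edge. Edges are unoriented, and loops and multiple edges
  are suppressed.\<close>

definition cayley_cells :: "('a, 'b) monoid_scheme \<Rightarrow> 'a set \<Rightarrow> 'a set set" where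
  "cayley_cells G Y =
     {{u} | u. u \<in> carrier G} \<union> {{u, u \<otimes>\<^bsub>G\<^esub> y} | u y. u \<in> carrier G \<and> y \<in> Y}"

definition supp :: "('a \<Rightarrow> real) \<Rightarrow> 'a set" where
  "supp p = {u. p u \<noteq> 0}"

definition cayley_graph :: "('a, 'b) monoid_scheme \<Rightarrow> 'a set \<Rightarrow> ('a \<Rightarrow> real) set" where
  "cayley_graph G Y = {p. (\<forall>u. 0 \<le> p u) \<and> supp p \<in> cayley_cells G Y \<and> (\<Sum>u\<in>supp p. p u) = 1}"

definition vertex :: "'a \<Rightarrow> 'a \<Rightarrow> real" where
  "vertex u = (\<lambda>v. if v = u then 1 else 0)"

text \<open>The length metric. Two points on a common edge are joined by the subsegment of that edge;
  otherwise a shortest path leaves the edge of \<open>p\<close> through an end \<open>u\<close>, at distance \<open>1 - p u\<close>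
  from \<open>p\<close>, and enters the edge of \<open>q\<close> through an end \<open>v\<close>.\<close>

definition cayley_dist :: "('a, 'b) monoid_scheme \<Rightarrow> 'a set \<Rightarrow> ('a \<Rightarrow> real) \<Rightarrow> ('a \<Rightarrow> real) \<Rightarrow> real"
  where
  "cayley_dist G Y p q =
     (if p \<notin> cayley_graph G Y \<or> q \<notin> cayley_graph G Y then 0
      else if \<exists>c\<in>cayley_cells G Y. supp p \<union> supp q \<subseteq> c
      then (\<Sum>u\<in>supp p \<union> supp q. \<bar>p u - q u\<bar>) / 2
      else Min {(1 - p u) + word_dist G Y u v + (1 - q v) | u v. u \<in> supp p \<and> v \<in> supp q})"


section \<open>Hyperbolically embedded subgroups\<close>

definition hyperbolically_embedded_wrt ::
  "('a, 'b) monoid_scheme \<Rightarrow> 'a set \<Rightarrow> 'a set set \<Rightarrow> bool" where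
  "hyperbolically_embedded_wrt G Y \<H> \<longleftrightarrow>
     group G \<and> finitely_generated G \<and>
     finite \<H> \<and> (\<forall>H\<in>\<H>. subgroup H G \<and> finitely_generated (G\<lparr>carrier := H\<rparr>)) \<and>
     Y \<subseteq> carrier G \<and> generate G Y = carrier G \<and>
     hyperbolic_relative (cayley_graph G Y) (cayley_dist G Y)
       {vertex ` (x <#\<^bsub>G\<^esub> H) | x H. x \<in> carrier G \<and> H \<in> \<H>} \<and>
     (\<forall>H\<in>\<H>. \<forall>x\<in>H. \<forall>R. finite {h \<in> H. cayley_dist G Y (vertex x) (vertex h) \<le> R})"

definition hyperbolically_embedded :: "('a, 'b) monoid_scheme \<Rightarrow> 'a set set \<Rightarrow> bool" where
  "hyperbolically_embedded G \<H> \<longleftrightarrow> (\<exists>Y. hyperbolically_embedded_wrt G Y \<H>)"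

end

theory Submission
  imports Defs
begin

text \<open>Let \<open>d\<close> be the word metric of the infinite generating set and \<open>\<pi>\<close> a nearest point projection to
  \<open>E\<close> for \<open>d\<close>. In a tree-graded space every geodesic between two points with different projections to
  a piece passes through both projections. By passing to asymptotic cones this yields three facts on
  \<open>d\<close>: geodesics between points of \<open>E\<close> stay close to \<open>E\<close>, so that \<open>\<langle>g\<rangle>\<close> is undistorted;
  steps of half the distance to \<open>E\<close> move \<open>\<pi>\<close> by a small fraction of that distance; and a pair of points
  at distance \<open>n\<close> has projections at distance \<open>\<epsilon> n\<close> to only finitely many nearby cosets of \<open>E\<close>.
  As balls of the finitely generated metric are finite up to translation, the last fact implies that
  steps of length \<open>n\<close> taken outside of a large neighbourhood of \<open>E\<close> in that metric move \<open>\<pi>\<close> by at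
  most \<open>\<epsilon> n\<close>. Hence an excursion of a quasi-geodesic outside of this neighbourhood is much longer
  than the distance between its ends, and so it is short.\<close>

section \<open>Geodesics in tree-graded spaces\<close>

text \<open>A quasi-geodesic for \<open>S\<close> need not be one for \<open>Y\<close>, so stability
  of quasi-geodesics cannot be quoted inside the Cayley graph of \<open>Y\<close>; balls there may
  also be infinite. Hence geometry is drawn from \<open>Y\<close>, finiteness from \<open>S\<close>,
  and only the projection to \<open>E\<close> links them: on \<open>E\<close> the two metrics are
  comparable, by quasi-convexity of \<open>E\<close> and properness of \<open>d\<close> on it, so a
  bound on projections in \<open>d\<close> becomes a bound for \<open>S\<close>. The finiteness
  statement works at one scale \<open>n\<close> and sees only cosets within \<open>2 * n\<close> of
  the pair. A point far from \<open>E\<close> for \<open>S\<close> may be farther than that for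
  \<open>d\<close>; there the admissible step has to grow with the distance, which is why
  \<open>max n (d x (\<pi> x) / 2)\<close> recurs. An excursion of \<open>l\<close> steps moves the
  projection by a constant plus a multiple of \<open>\<epsilon> * l\<close>. The number \<epsilon>
  is fixed so that, converted to \<open>S\<close>, the multiple is \<open>l / (2 * \<mu>)\<close>,
  half of the rate \<open>l / \<mu>\<close> forced by the quasi-geodesic inequality. No constant is
  computed in the cones: they only refute sequences of counterexamples at growing scales.\<close>

definition geodesic_path :: "'x set \<Rightarrow> ('x \<Rightarrow> 'x \<Rightarrow> real) \<Rightarrow> (real \<Rightarrow> 'x) \<Rightarrow> real \<Rightarrow> bool" where
  "geodesic_path X d \<gamma> L \<longleftrightarrow>
     0 \<le> L \<and> (\<forall>u\<in>{0..L}. \<gamma> u \<in> X) \<and> (\<forall>u\<in>{0..L}. \<forall>v\<in>{0..L}. d (\<gamma> u) (\<gamma> v) = \<bar>u - v\<bar>)"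

text \<open>A relation rather than a function: nearest points need not be unique and, in a general
  metric space, need not exist.\<close>

definition nearest_point :: "('x \<Rightarrow> 'x \<Rightarrow> real) \<Rightarrow> 'x set \<Rightarrow> 'x \<Rightarrow> 'x \<Rightarrow> bool" where
  "nearest_point d C x p \<longleftrightarrow> p \<in> C \<and> (\<forall>z\<in>C. d x p \<le> d x z)"

lemma geodesic_pathD:
  assumes "geodesic_path X d \<gamma> L"
  shows "0 \<le> L" "\<And>u. 0 \<le> u \<Longrightarrow> u \<le> L \<Longrightarrow> \<gamma> u \<in> X"
    "\<And>u v. 0 \<le> u \<Longrightarrow> u \<le> L \<Longrightarrow> 0 \<le> v \<Longrightarrow> v \<le> L \<Longrightarrow> d (\<gamma> u) (\<gamma> v) = \<bar>u - v\<bar>"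
  using assms unfolding geodesic_path_def by auto

lemma geodesic_path_shift:
  assumes "geodesic_path X d \<gamma> L" "0 \<le> u" "u \<le> v" "v \<le> L"
  shows "geodesic_path X d (\<lambda>t. \<gamma> (u + t)) (v - u)"
  using assms unfolding geodesic_path_def by auto

lemma geodesic_path_reverse:
  assumes "geodesic_path X d \<gamma> L" "0 \<le> u" "u \<le> v" "v \<le> L"
  shows "geodesic_path X d (\<lambda>t. \<gamma> (v - t)) (v - u)"
  using assms unfolding geodesic_path_def by auto

lemma geodesic_path_segment:
  assumes "geodesic_path X d \<gamma> L" "0 \<le> u" "u \<le> v" "v \<le> L"
  shows "geodesic_segment X d (\<gamma> u) (\<gamma> v) (\<gamma> ` {u..v})"
    and "geodesic_segment X d (\<gamma> v) (\<gamma> u) (\<gamma> ` {u..v})"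
proof -
  have dist: "d (\<gamma> u) (\<gamma> v) = v - u" "d (\<gamma> v) (\<gamma> u) = v - u"
    using geodesic_pathD[OF assms(1)] assms by auto
  have sub: "\<gamma> ` {u..v} \<subseteq> X"
    using geodesic_pathD(2)[OF assms(1)] assms by auto
  have im1: "(\<lambda>t. \<gamma> (u + t)) ` {0..v - u} = \<gamma> ` {u..v}"
  proof -
    have "(\<lambda>t. u + t) ` {0..v - u} = {u..v}" by (simp add: image_add_atLeastAtMost)
    then show ?thesis by (metis image_image)
  qed
  have im2: "(\<lambda>t. \<gamma> (v - t)) ` {0..v - u} = \<gamma> ` {u..v}"
  proof -
    have "(\<lambda>t. v - t) ` {0..v - u} = {u..v}" by (simp add: image_diff_atLeastAtMost)
    then show ?thesis by (metis image_image)
  qed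
  show "geodesic_segment X d (\<gamma> u) (\<gamma> v) (\<gamma> ` {u..v})"
    unfolding geodesic_segment_def dist
    using geodesic_pathD(3)[OF geodesic_path_shift[OF assms]] sub im1
    by (intro exI[of _ "\<lambda>t. \<gamma> (u + t)"]) auto
  show "geodesic_segment X d (\<gamma> v) (\<gamma> u) (\<gamma> ` {u..v})"
    unfolding geodesic_segment_def dist
    using geodesic_pathD(3)[OF geodesic_path_reverse[OF assms]] sub im2
    by (intro exI[of _ "\<lambda>t. \<gamma> (v - t)"]) auto
qed

section \<open>Geodesic paths in metric spaces\<close>

context Metric_space
begin

lemma geodesic_segment_path:
  assumes "geodesic_segment M d x y s"
  obtains \<gamma> where "geodesic_path M d \<gamma> (d x y)" "\<gamma> 0 = x" "\<gamma> (d x y) = y"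
proof -
  from assms obtain \<gamma> where "\<gamma> 0 = x" "\<gamma> (d x y) = y" "\<gamma> ` {0..d x y} \<subseteq> M"
    "\<forall>u\<in>{0..d x y}. \<forall>v\<in>{0..d x y}. d (\<gamma> u) (\<gamma> v) = \<bar>u - v\<bar>"
    unfolding geodesic_segment_def by auto
  then show thesis
    by (intro that[of \<gamma>]) (auto simp: geodesic_path_def)
qed

lemma geodesic_path_inj:
  assumes "geodesic_path M d \<gamma> L" "0 \<le> u" "u \<le> L" "0 \<le> v" "v \<le> L" "u \<noteq> v"
  shows "\<gamma> u \<noteq> \<gamma> v"
  using geodesic_pathD(3)[OF assms(1-5)] geodesic_pathD(2)[OF assms(1-3)] assms(6) by auto

text \<open>The triangle inequality bounds distances across the joint from above; if one of them
  were smaller, the ends would be closer than \<open>K + L\<close>.\<close>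

lemma geodesic_path_append:
  assumes \<gamma>: "geodesic_path M d \<gamma> K" and \<delta>: "geodesic_path M d \<delta> L"
    and join: "\<gamma> K = \<delta> 0" and len: "d (\<gamma> 0) (\<delta> L) = K + L"
  shows "geodesic_path M d (\<lambda>t. if t \<le> K then \<gamma> t else \<delta> (t - K)) (K + L)"
proof -
  note A = geodesic_pathD[OF \<gamma>] and B = geodesic_pathD[OF \<delta>]
  have eq: "d (\<gamma> u) (\<delta> v) = K - u + v" if "0 \<le> u" "u \<le> K" "0 \<le> v" "v \<le> L" for u v
  proof (rule antisym)
    have "d (\<gamma> u) (\<delta> v) \<le> d (\<gamma> u) (\<gamma> K) + d (\<delta> 0) (\<delta> v)"
      using triangle[of "\<gamma> u" "\<gamma> K" "\<delta> v"] A(2) B(2) that join by auto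
    then show "d (\<gamma> u) (\<delta> v) \<le> K - u + v"
      using A(1,3) B(1,3) that by auto
    have "K + L \<le> d (\<gamma> 0) (\<gamma> u) + d (\<gamma> u) (\<delta> v) + d (\<delta> v) (\<delta> L)"
      using triangle[of "\<gamma> 0" "\<gamma> u" "\<delta> L"] triangle[of "\<gamma> u" "\<delta> v" "\<delta> L"] A(1,2) B(1,2) that len
      by force
    also have "\<dots> = u + d (\<gamma> u) (\<delta> v) + (L - v)"
      using A(1,3) B(1,3) that by auto
    finally show "K - u + v \<le> d (\<gamma> u) (\<delta> v)" by simp
  qed
  have eq': "d (\<delta> v) (\<gamma> u) = K - u + v" if "0 \<le> u" "u \<le> K" "0 \<le> v" "v \<le> L" for u v
    using eq[OF that] commute by simp
  show ?thesis
    unfolding geodesic_path_def using A B eq eq' by (auto simp: abs_if)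
qed

text \<open>The distance from a point to a compact segment is attained, so segments are closed.\<close>

lemma geodesic_path_approachable:
  assumes \<gamma>: "geodesic_path M d \<gamma> L" and "w \<in> M"
    and appr: "\<And>\<epsilon>. \<epsilon> > 0 \<Longrightarrow> \<exists>z\<in>\<gamma> ` {0..L}. d w z < \<epsilon>"
  shows "w \<in> \<gamma> ` {0..L}"
proof -
  note G = geodesic_pathD[OF \<gamma>]
  have lip: "\<bar>d w (\<gamma> s) - d w (\<gamma> t)\<bar> \<le> \<bar>s - t\<bar>" if "s \<in> {0..L}" "t \<in> {0..L}" for s t
    using mdist_reverse_triangle[of "\<gamma> s" w "\<gamma> t"] G(2)[of s] G(2)[of t] G(3)[of s t] that \<open>w \<in> M\<close>
    by (auto simp: commute)
  have "continuous_on {0..L} (\<lambda>s. d w (\<gamma> s))"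
    unfolding continuous_on_iff
    by (metis lip dist_real_def order.strict_trans1)
  then obtain s where s: "s \<in> {0..L}" "\<And>t. t \<in> {0..L} \<Longrightarrow> d w (\<gamma> s) \<le> d w (\<gamma> t)"
    using continuous_attains_inf[OF compact_Icc _ \<open>continuous_on _ _\<close>] G(1)
    by (auto simp del: atLeastAtMost_iff)
  have "d w (\<gamma> s) = 0"
  proof (rule ccontr)
    assume "d w (\<gamma> s) \<noteq> 0"
    then have "d w (\<gamma> s) > 0" by (simp add: order_less_le)
    with appr s show False by force
  qed
  then have "w = \<gamma> s" using s(1) G(2) \<open>w \<in> M\<close> by auto
  then show ?thesis using s(1) by blast
qed

lemma closedin_approachable:
  assumes "closedin mtopology C" "w \<in> M" "\<And>\<epsilon>. \<epsilon> > 0 \<Longrightarrow> \<exists>z\<in>C. d w z < \<epsilon>"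
  shows "w \<in> C"
proof (rule ccontr)
  assume "w \<notin> C"
  then obtain r where "r > 0" "disjnt C (mball w r)"
    using assms(1,2) unfolding closedin_metric by blast
  moreover obtain z where "z \<in> C" "d w z < r" using assms(3) \<open>r > 0\<close> by blast
  ultimately show False
    using assms closedin_subset[OF assms(1)] by (auto simp: disjnt_iff)
qed

text \<open>The infimum of the hitting times is itself a hitting time. Closedness enters by
  approximation, so that the lemma serves pieces and images of geodesics alike.\<close>

lemma geodesic_path_first_hit:
  assumes \<gamma>: "geodesic_path M d \<gamma> L" and T: "0 \<le> T" "T \<le> L" "\<gamma> T \<in> C"
    and closed: "\<And>w. w \<in> M \<Longrightarrow> (\<And>\<epsilon>. \<epsilon> > 0 \<Longrightarrow> \<exists>z\<in>C. d w z < \<epsilon>) \<Longrightarrow> w \<in> C"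
  obtains t where "0 \<le> t" "t \<le> T" "\<gamma> t \<in> C" "\<And>u. 0 \<le> u \<Longrightarrow> u < t \<Longrightarrow> \<gamma> u \<notin> C"
proof -
  note G = geodesic_pathD[OF \<gamma>]
  define A where "A = {t. 0 \<le> t \<and> t \<le> T \<and> \<gamma> t \<in> C}"
  define t where "t = Inf A"
  have ne: "T \<in> A" and bdd: "bdd_below A" using T by (auto simp: A_def intro!: bdd_belowI[of _ 0])
  have t: "0 \<le> t" "t \<le> T"
    unfolding t_def using ne bdd by (auto intro!: cInf_greatest cInf_lower simp: A_def)
  have "\<gamma> t \<in> C"
  proof (rule closed)
    show "\<gamma> t \<in> M" using t T G by auto
    fix \<epsilon> :: real assume "\<epsilon> > 0"
    then obtain u where u: "u \<in> A" "u < t + \<epsilon>"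
      using cInf_lessD[of A "t + \<epsilon>"] ne unfolding t_def by force
    have "t \<le> u" unfolding t_def using u bdd by (intro cInf_lower)
    then have "d (\<gamma> t) (\<gamma> u) < \<epsilon>"
      using G(3)[of t u] u t T by (auto simp: A_def)
    then show "\<exists>z\<in>C. d (\<gamma> t) z < \<epsilon>" using u by (auto simp: A_def)
  qed
  moreover have "\<gamma> u \<notin> C" if "0 \<le> u" "u < t" for u
    using cInf_lower[of u A] bdd that t unfolding t_def A_def by fastforce
  ultimately show thesis using t that by blast
qed

end

lemma tree_gradedD:
  assumes "tree_graded F d I P"
  shows "geodesic_space F d" "\<And>i. i \<in> I \<Longrightarrow> closedin (Metric_space.mtopology F d) (P i)"
    "\<And>i. i \<in> I \<Longrightarrow> geodesic_space (P i) d"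
    "\<And>i j x y. i \<in> I \<Longrightarrow> j \<in> I \<Longrightarrow> i \<noteq> j \<Longrightarrow> x \<in> P i \<inter> P j \<Longrightarrow> y \<in> P i \<inter> P j \<Longrightarrow> x = y"
    "\<And>s1 s2 s3. simple_geodesic_triangle F d s1 s2 s3 \<Longrightarrow> \<exists>i\<in>I. s1 \<union> s2 \<union> s3 \<subseteq> P i"
proof -
  note A = assms[unfolded tree_graded_def]
  show "geodesic_space F d" using A by (elim conjE)
  show "closedin (Metric_space.mtopology F d) (P i)" "geodesic_space (P i) d" if "i \<in> I" for i
    using A that by (elim conjE, simp)+
  show "x = y" if "i \<in> I" "j \<in> I" "i \<noteq> j" "x \<in> P i \<inter> P j" "y \<in> P i \<inter> P j" for i j x y
    using A that by (elim conjE) blast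
  show "\<exists>i\<in>I. s1 \<union> s2 \<union> s3 \<subseteq> P i" if "simple_geodesic_triangle F d s1 s2 s3" for s1 s2 s3
    using A that by (elim conjE) simp
qed

section \<open>Convexity of pieces and projections to pieces\<close>

locale tree_graded_space =
  fixes F :: "'x set" and d :: "'x \<Rightarrow> 'x \<Rightarrow> real" and I :: "'i set" and P :: "'i \<Rightarrow> 'x set"
  assumes tree_graded: "tree_graded F d I P"

sublocale tree_graded_space \<subseteq> Metric_space F d
  using tree_gradedD(1)[OF tree_graded] unfolding geodesic_space_def by (rule conjunct1)

context tree_graded_space
begin

lemma geodesic_exists:
  assumes "x \<in> F" "y \<in> F"
  obtains \<gamma> where "geodesic_path F d \<gamma> (d x y)" "\<gamma> 0 = x" "\<gamma> (d x y) = y"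
proof -
  obtain s where "geodesic_segment F d x y s"
    using assms tree_gradedD(1)[OF tree_graded] unfolding geodesic_space_def by blast
  then show thesis using geodesic_segment_path that by blast
qed

lemma piece_subset: "i \<in> I \<Longrightarrow> P i \<subseteq> F"
  using tree_gradedD(2)[OF tree_graded] closedin_subset topspace_mtopology by metis

lemma piece_approachable:
  assumes "i \<in> I" "w \<in> F" "\<And>\<epsilon>. \<epsilon> > 0 \<Longrightarrow> \<exists>z\<in>P i. d w z < \<epsilon>"
  shows "w \<in> P i"
  by (rule closedin_approachable[OF tree_gradedD(2)[OF tree_graded assms(1)] assms(2,3)])

lemma piece_geodesic_exists:
  assumes "i \<in> I" "x \<in> P i" "y \<in> P i"
  obtains \<gamma> where "geodesic_path F d \<gamma> (d x y)" "\<gamma> 0 = x" "\<gamma> (d x y) = y"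
    "\<And>t. 0 \<le> t \<Longrightarrow> t \<le> d x y \<Longrightarrow> \<gamma> t \<in> P i"
proof -
  have "geodesic_space (P i) d" using tree_gradedD(3)[OF tree_graded assms(1)] .
  then obtain s where "Metric_space (P i) d" "geodesic_segment (P i) d x y s"
    using assms unfolding geodesic_space_def by blast
  then obtain \<gamma> where \<gamma>: "geodesic_path (P i) d \<gamma> (d x y)" "\<gamma> 0 = x" "\<gamma> (d x y) = y"
    by (metis Metric_space.geodesic_segment_path)
  moreover have "geodesic_path F d \<gamma> (d x y)"
    using \<gamma>(1) piece_subset[OF \<open>i \<in> I\<close>] unfolding geodesic_path_def by blast
  ultimately show thesis using that geodesic_pathD(2)[OF \<gamma>(1)] by blast
qed

lemma piece_eqI:
  assumes "i \<in> I" "j \<in> I" "x \<in> P i" "x \<in> P j" "y \<in> P i" "y \<in> P j" "x \<noteq> y"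
  shows "i = j"
  using assms tree_gradedD(4)[OF tree_graded] by blast

lemma simple_triangle_in_piece:
  assumes "x \<noteq> y" "y \<noteq> z" "z \<noteq> x"
    "geodesic_segment F d x y s1" "geodesic_segment F d y z s2" "geodesic_segment F d z x s3"
    "s1 \<inter> s2 = {y}" "s2 \<inter> s3 = {z}" "s3 \<inter> s1 = {x}"
  obtains j where "j \<in> I" "s1 \<subseteq> P j" "s2 \<subseteq> P j" "s3 \<subseteq> P j"
proof -
  have "s1 \<subseteq> F" "s2 \<subseteq> F" using assms(4,5) unfolding geodesic_segment_def by blast+
  moreover have "x \<in> s1" "y \<in> s1" "z \<in> s2" using assms(7-9) by auto
  ultimately have "x \<in> F" "y \<in> F" "z \<in> F" by auto
  then have "simple_geodesic_triangle F d s1 s2 s3"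
    unfolding simple_geodesic_triangle_def
    by (intro bexI[of _ x] bexI[of _ y] bexI[of _ z] conjI assms)
  then show thesis using tree_gradedD(5)[OF tree_graded] that by blast
qed

text \<open>An excursion from the piece, cut out between the last exit and the first return and
  closed up by a geodesic inside the piece, is a simple triangle. The piece containing this triangle
  shares two distinct points with \<open>P i\<close>, hence equals it.\<close>

lemma piece_convex:
  assumes i: "i \<in> I" and \<gamma>: "geodesic_path F d \<gamma> L" and ends: "\<gamma> 0 \<in> P i" "\<gamma> L \<in> P i"
    and t: "0 \<le> t" "t \<le> L"
  shows "\<gamma> t \<in> P i"
proof (rule ccontr)
  assume nt: "\<gamma> t \<notin> P i"
  note G = geodesic_pathD[OF \<gamma>]
  obtain b where b: "0 \<le> b" "b \<le> L - t" "\<gamma> (t + b) \<in> P i" "\<And>u. 0 \<le> u \<Longrightarrow> u < b \<Longrightarrow> \<gamma> (t + u) \<notin> P i"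
    using geodesic_path_first_hit[OF geodesic_path_shift[OF \<gamma>, of t L], of "L - t" "P i"]
      piece_approachable[OF i] ends t by auto
  \<comment> \<open>The last visit to the piece before \<open>t\<close> is the first hit of the
    reversed path.\<close>
  obtain a where a: "0 \<le> a" "a \<le> t" "\<gamma> (t - a) \<in> P i" "\<And>u. 0 \<le> u \<Longrightarrow> u < a \<Longrightarrow> \<gamma> (t - u) \<notin> P i"
    using geodesic_path_first_hit[OF geodesic_path_reverse[OF \<gamma>, of 0 t], of t "P i"]
      piece_approachable[OF i] ends t by auto
  define u where "u = t - a"
  define v where "v = t + b"
  have pos: "a > 0" "b > 0" using a(1,3) b(1,3) nt by (auto simp: order_less_le)
  have uv: "0 \<le> u" "u < t" "t < v" "v \<le> L" using a b pos by (auto simp: u_def v_def)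
  have uvP: "\<gamma> u \<in> P i" "\<gamma> v \<in> P i" using a b by (auto simp: u_def v_def)
  have out: "\<gamma> w \<notin> P i" if "u < w" "w < v" for w
    using a(4)[of "t - w"] b(4)[of "w - t"] that by (cases "w \<le> t") (auto simp: u_def v_def)
  have inj: "\<gamma> w \<noteq> \<gamma> w'" if "w \<noteq> w'" "0 \<le> w" "w \<le> L" "0 \<le> w'" "w' \<le> L" for w w'
    using geodesic_path_inj[OF \<gamma>] that by blast
  obtain \<beta> where \<beta>: "geodesic_path F d \<beta> (d (\<gamma> u) (\<gamma> v))" "\<beta> 0 = \<gamma> u" "\<beta> (d (\<gamma> u) (\<gamma> v)) = \<gamma> v"
    and \<beta>P: "\<And>s. 0 \<le> s \<Longrightarrow> s \<le> d (\<gamma> u) (\<gamma> v) \<Longrightarrow> \<beta> s \<in> P i"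
    using piece_geodesic_exists[OF i uvP] by blast
  let ?D = "d (\<gamma> u) (\<gamma> v)"
  have seg: "geodesic_segment F d (\<gamma> v) (\<gamma> u) (\<beta> ` {0..?D})"
    using geodesic_path_segment(2)[OF \<beta>(1), of 0 ?D] \<beta> by auto
  have D: "\<beta> ` {0..?D} \<subseteq> P i" "\<gamma> u \<in> \<beta> ` {0..?D}" "\<gamma> v \<in> \<beta> ` {0..?D}"
    using \<beta>P \<beta>(2,3) by (force, metis atLeastAtMost_iff imageI nonneg order_refl,
      metis atLeastAtMost_iff imageI nonneg order_refl)
  \<comment> \<open>The loop is a bigon; \<open>\<gamma> t\<close> is inserted as an artificial
    third corner.\<close>
  obtain j where j: "j \<in> I" "\<gamma> ` {u..t} \<subseteq> P j" "\<gamma> ` {t..v} \<subseteq> P j" "\<beta> ` {0..?D} \<subseteq> P j"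
  proof (rule simple_triangle_in_piece[OF _ _ _ geodesic_path_segment(1)[OF \<gamma>] geodesic_path_segment(1)[OF \<gamma>] seg])
    show "\<gamma> u \<noteq> \<gamma> t" "\<gamma> t \<noteq> \<gamma> v" "\<gamma> v \<noteq> \<gamma> u" using inj uv by auto
    show "0 \<le> u" "u \<le> t" "t \<le> L" "0 \<le> t" "t \<le> v" "v \<le> L" using uv by auto
    have "w = w'" if "\<gamma> w = \<gamma> w'" "w \<in> {u..v}" "w' \<in> {u..v}" for w w'
      using inj[of w w'] that uv by auto
    then show "\<gamma> ` {u..t} \<inter> \<gamma> ` {t..v} = {\<gamma> t}"
      using uv by (force simp: set_eq_iff image_iff)
    have *: "\<gamma> w = \<gamma> u \<or> \<gamma> w = \<gamma> v" if "\<gamma> w \<in> P i" "w \<in> {u..v}" for w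
      using out[of w] that by force
    show "\<gamma> ` {t..v} \<inter> \<beta> ` {0..?D} = {\<gamma> v}"
    proof
      have "w = v" if "\<gamma> w \<in> P i" "w \<in> {t..v}" for w
        using out[of w] that uv by force
      then have "\<gamma> ` {t..v} \<inter> P i \<subseteq> {\<gamma> v}" by blast
      then show "\<gamma> ` {t..v} \<inter> \<beta> ` {0..?D} \<subseteq> {\<gamma> v}" using D(1) by blast
    qed (use D uv in auto)
    show "\<beta> ` {0..?D} \<inter> \<gamma> ` {u..t} = {\<gamma> u}"
    proof
      have "w = u" if "\<gamma> w \<in> P i" "w \<in> {u..t}" for w
        using out[of w] that uv by force
      then have "\<gamma> ` {u..t} \<inter> P i \<subseteq> {\<gamma> u}" by blast
      then show "\<beta> ` {0..?D} \<inter> \<gamma> ` {u..t} \<subseteq> {\<gamma> u}" using D(1) by blast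
    qed (use D uv in auto)
  qed
  have "\<gamma> u \<in> P j" "\<gamma> v \<in> P j" "\<gamma> t \<in> P j" using j(2,3) uv by auto
  moreover have "\<gamma> u \<noteq> \<gamma> v" using inj uv by auto
  ultimately have "i = j" using piece_eqI i j(1) uvP by blast
  then show False using nt \<open>\<gamma> t \<in> P j\<close> by simp
qed

text \<open>Otherwise the first points of \<open>\<alpha>\<close> and of \<open>\<rho>\<close> on \<open>\<sigma>\<close> span together with \<open>\<alpha> 0\<close> a simple
  triangle; the piece containing it shares an initial segment of \<open>\<rho>\<close> with \<open>P i\<close>.\<close>

lemma geodesic_through_corner:
  assumes i: "i \<in> I"
    and \<alpha>: "geodesic_path F d \<alpha> A" and \<rho>: "geodesic_path F d \<rho> R" and \<sigma>: "geodesic_path F d \<sigma> S"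
    and ends: "\<alpha> 0 = \<rho> 0" "\<sigma> 0 = \<alpha> A" "\<sigma> S = \<rho> R"
    and p: "\<rho> 0 \<in> P i" and s0: "0 < s0" "s0 \<le> R" "\<rho> s0 \<in> P i"
    and out: "\<And>t. 0 < t \<Longrightarrow> t \<le> A \<Longrightarrow> \<alpha> t \<notin> P i"
    and meet: "\<And>s t. 0 < s \<Longrightarrow> s \<le> A \<Longrightarrow> 0 < t \<Longrightarrow> t \<le> R \<Longrightarrow> \<alpha> s \<noteq> \<rho> t"
  shows "\<rho> 0 \<in> \<sigma> ` {0..S}"
proof (rule ccontr)
  assume nin: "\<rho> 0 \<notin> \<sigma> ` {0..S}"
  note a = geodesic_pathD[OF \<alpha>] and r = geodesic_pathD[OF \<rho>] and s = geodesic_pathD[OF \<sigma>]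
  have inj\<alpha>: "\<alpha> w \<noteq> \<alpha> w'" if "w \<noteq> w'" "0 \<le> w" "w \<le> A" "0 \<le> w'" "w' \<le> A" for w w'
    using geodesic_path_inj[OF \<alpha>] that by blast
  have inj\<rho>: "\<rho> w \<noteq> \<rho> w'" if "w \<noteq> w'" "0 \<le> w" "w \<le> R" "0 \<le> w'" "w' \<le> R" for w w'
    using geodesic_path_inj[OF \<rho>] that by blast
  note cl = geodesic_path_approachable[OF \<sigma>]
  have hit: "\<alpha> A \<in> \<sigma> ` {0..S}" "\<rho> R \<in> \<sigma> ` {0..S}"
    using s(1) ends(2,3) by (metis atLeastAtMost_iff imageI order_refl)+
  obtain u where u: "0 \<le> u" "u \<le> A" "\<alpha> u \<in> \<sigma> ` {0..S}" "\<And>w. 0 \<le> w \<Longrightarrow> w < u \<Longrightarrow> \<alpha> w \<notin> \<sigma> ` {0..S}"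
    by (rule geodesic_path_first_hit[OF \<alpha> a(1) order_refl hit(1) cl]) (assumption | rule that)+
  obtain v where v: "0 \<le> v" "v \<le> R" "\<rho> v \<in> \<sigma> ` {0..S}" "\<And>w. 0 \<le> w \<Longrightarrow> w < v \<Longrightarrow> \<rho> w \<notin> \<sigma> ` {0..S}"
    by (rule geodesic_path_first_hit[OF \<rho> r(1) order_refl hit(2) cl]) (assumption | rule that)+
  have "u \<noteq> 0" "v \<noteq> 0" using u(3) v(3) nin ends(1) by metis+
  then have pos: "0 < u" "0 < v" using u(1) v(1) by simp_all
  obtain u' v' where u': "u' \<in> {0..S}" "\<alpha> u = \<sigma> u'" and v': "v' \<in> {0..S}" "\<rho> v = \<sigma> v'"
    using u v by auto
  \<comment> \<open>Third side of the triangle. The order in which \<open>\<sigma>\<close> meets the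
    two points is unknown, hence \<open>min\<close> and \<open>max\<close>.\<close>
  define T where "T = \<sigma> ` {min u' v'..max u' v'}"
  have T: "T \<subseteq> \<sigma> ` {0..S}" "\<alpha> u \<in> T" "\<rho> v \<in> T"
    using u' v' by (auto simp: T_def intro!: image_mono)
  have segT: "geodesic_segment F d (\<alpha> u) (\<rho> v) T"
    using geodesic_path_segment[OF \<sigma>, of "min u' v'" "max u' v'"] u' v'
    by (cases "u' \<le> v'") (auto simp: T_def)
  have corner: "\<rho> ` {0..v} \<inter> \<alpha> ` {0..u} = {\<rho> 0}"
  proof
    show "\<rho> ` {0..v} \<inter> \<alpha> ` {0..u} \<subseteq> {\<rho> 0}"
    proof
      fix z assume "z \<in> \<rho> ` {0..v} \<inter> \<alpha> ` {0..u}"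
      then obtain x y where xy: "x \<in> {0..v}" "y \<in> {0..u}" "z = \<rho> x" "z = \<alpha> y" by auto
      show "z \<in> {\<rho> 0}"
      proof (cases "x = 0 \<or> y = 0")
        case True
        then show ?thesis using xy ends by auto
      next
        case False
        then have "\<alpha> y \<noteq> \<rho> x" using xy u v by (intro meet) auto
        then show ?thesis using xy by simp
      qed
    qed
  qed (use ends u v in \<open>auto intro: rev_image_eqI\<close>)
  obtain j where j: "j \<in> I" "\<alpha> ` {0..u} \<subseteq> P j" "\<rho> ` {0..v} \<subseteq> P j"
  proof (rule simple_triangle_in_piece)
    show "\<rho> 0 \<noteq> \<alpha> u" "\<alpha> u \<noteq> \<rho> v" "\<rho> v \<noteq> \<rho> 0"
      using inj\<alpha>[of 0 u] inj\<rho>[of v 0] meet pos u v ends by auto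
    show "geodesic_segment F d (\<rho> 0) (\<alpha> u) (\<alpha> ` {0..u})"
      using geodesic_path_segment(1)[OF \<alpha>, of 0 u] u ends by auto
    show "geodesic_segment F d (\<alpha> u) (\<rho> v) T" by fact
    show "geodesic_segment F d (\<rho> v) (\<rho> 0) (\<rho> ` {0..v})"
      using geodesic_path_segment(2)[OF \<rho>, of 0 v] v by auto
    have "w = u" if "w \<in> {0..u}" "\<alpha> w \<in> T" for w using u(4)[of w] that T(1) by force
    then have "\<alpha> ` {0..u} \<inter> T \<subseteq> {\<alpha> u}" by blast
    moreover have "\<alpha> u \<in> \<alpha> ` {0..u}" using u(1) by simp
    ultimately show "\<alpha> ` {0..u} \<inter> T = {\<alpha> u}" using T(2) by blast
    have "w = v" if "w \<in> {0..v}" "\<rho> w \<in> T" for w using v(4)[of w] that T(1) by force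
    then have "\<rho> ` {0..v} \<inter> T \<subseteq> {\<rho> v}" by blast
    moreover have "\<rho> v \<in> \<rho> ` {0..v}" using v(1) by simp
    ultimately show "T \<inter> \<rho> ` {0..v} = {\<rho> v}" using T(3) by blast
    show "\<rho> ` {0..v} \<inter> \<alpha> ` {0..u} = {\<rho> 0}" by fact
  qed
  \<comment> \<open>Up to \<open>m\<close> the path \<open>\<rho>\<close> lies both in
    \<open>P i\<close>, by convexity, and in \<open>P j\<close>. The pieces then agree, although
    \<open>\<alpha> u\<close> belongs to the second and \<open>\<alpha>\<close> has left the
    first.\<close>
  define m where "m = min v s0"
  have m: "0 < m" "m \<le> v" "m \<le> s0" using pos s0 by (auto simp: m_def)
  have "\<rho> m \<in> P i"
    using piece_convex[OF i geodesic_path_shift[OF \<rho>, of 0 s0], of m] p s0 m by auto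
  moreover have "\<rho> m \<in> P j" "\<rho> 0 \<in> P j" using j(3) m v(1) by (simp_all add: image_subset_iff)
  moreover have uj: "\<alpha> u \<in> P j" using j(2) u(1) by (simp add: image_subset_iff)
  moreover have "\<rho> m \<noteq> \<rho> 0" using inj\<rho>[of m 0] m v(1,2) by auto
  ultimately have "i = j" using piece_eqI[OF i j(1)] p by blast
  then show False using uj out[OF pos(1) u(2)] by simp
qed

text \<open>A point of the piece closer than \<open>p\<close> to some \<open>\<alpha> t\<close>
  would also be closer to \<open>x\<close>. So \<open>p\<close> stays nearest along the path, and
  the path leaves the piece at once.\<close>

lemma nearest_point_path:
  assumes i: "i \<in> I" and x: "x \<in> F" and np: "nearest_point d (P i) x p"
  obtains \<alpha> where "geodesic_path F d \<alpha> (d p x)" "\<alpha> 0 = p" "\<alpha> (d p x) = x"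
    "\<And>t. 0 < t \<Longrightarrow> t \<le> d p x \<Longrightarrow> \<alpha> t \<notin> P i"
    "\<And>t. 0 \<le> t \<Longrightarrow> t \<le> d p x \<Longrightarrow> nearest_point d (P i) (\<alpha> t) p"
proof -
  have p: "p \<in> P i" "p \<in> F" "\<And>z. z \<in> P i \<Longrightarrow> d x p \<le> d x z"
    using np piece_subset[OF i] unfolding nearest_point_def by auto
  obtain \<alpha> where \<alpha>: "geodesic_path F d \<alpha> (d p x)" "\<alpha> 0 = p" "\<alpha> (d p x) = x"
    using geodesic_exists[OF p(2) x] by blast
  note a = geodesic_pathD[OF \<alpha>(1)]
  have near: "d (\<alpha> t) p \<le> d (\<alpha> t) z" if "0 \<le> t" "t \<le> d p x" "z \<in> P i" for t z
  proof -
    have "d x z \<le> d x (\<alpha> t) + d (\<alpha> t) z"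
      using triangle[of x "\<alpha> t" z] that a(2) x piece_subset[OF i] by auto
    moreover have "d x (\<alpha> t) = d p x - t" "d (\<alpha> t) p = t"
      using a(3)[of "d p x" t] a(3)[of t 0] \<alpha> that by auto
    ultimately show ?thesis using p(3)[OF that(3)] commute[of x p] by auto
  qed
  show thesis
  proof (rule that[OF \<alpha>])
    show "\<alpha> t \<notin> P i" if "0 < t" "t \<le> d p x" for t
    proof
      assume "\<alpha> t \<in> P i"
      with near[of t "\<alpha> t"] that have "d (\<alpha> t) p \<le> d (\<alpha> t) (\<alpha> t)" by auto
      then show False using a(3)[of t 0] a(3)[of t t] \<alpha> that by auto
    qed
    show "nearest_point d (P i) (\<alpha> t) p" if "0 \<le> t" "t \<le> d p x" for t
      using near[OF that] p(1) by (simp add: nearest_point_def)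
  qed
qed

text \<open>A geodesic from \<open>p\<close> to \<open>x\<close> stays outside of the piece and one
  from \<open>p\<close> to \<open>q\<close> can be taken inside, so they meet only at
  \<open>p\<close>; by the corner argument every geodesic from \<open>x\<close> to \<open>q\<close>
  passes through \<open>p\<close>.\<close>

lemma dist_through_nearest_point:
  assumes i: "i \<in> I" and x: "x \<in> F" and np: "nearest_point d (P i) x p" and q: "q \<in> P i"
  shows "d x q = d x p + d p q"
proof (cases "p = q")
  case True
  then show ?thesis using q piece_subset[OF i] by auto
next
  case False
  have p: "p \<in> P i" using np by (simp add: nearest_point_def)
  have F: "p \<in> F" "q \<in> F" using p q piece_subset[OF i] by auto
  obtain \<alpha> where \<alpha>: "geodesic_path F d \<alpha> (d p x)" "\<alpha> 0 = p" "\<alpha> (d p x) = x"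
    "\<And>t. 0 < t \<Longrightarrow> t \<le> d p x \<Longrightarrow> \<alpha> t \<notin> P i"
    using nearest_point_path[OF i x np] by metis
  obtain \<rho> where \<rho>: "geodesic_path F d \<rho> (d p q)" "\<rho> 0 = p" "\<rho> (d p q) = q"
    "\<And>t. 0 \<le> t \<Longrightarrow> t \<le> d p q \<Longrightarrow> \<rho> t \<in> P i"
    using piece_geodesic_exists[OF i p q] by metis
  obtain \<sigma> where \<sigma>: "geodesic_path F d \<sigma> (d x q)" "\<sigma> 0 = x" "\<sigma> (d x q) = q"
    using geodesic_exists[OF x F(2)] by blast
  have "d p q > 0" using False F by simp
  then have "\<rho> 0 \<in> \<sigma> ` {0..d x q}"
    using geodesic_through_corner[OF i \<alpha>(1) \<rho>(1) \<sigma>(1), of "d p q"] \<alpha> \<rho> \<sigma> p q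
    by (metis less_imp_le order_refl)
  then obtain t where t: "t \<in> {0..d x q}" "p = \<sigma> t" using \<rho> by auto
  then show ?thesis
    using geodesic_pathD(3)[OF \<sigma>(1), of 0 t] geodesic_pathD(3)[OF \<sigma>(1), of t "d x q"] \<sigma> by auto
qed

text \<open>The corner argument at \<open>p\<close>, with \<open>\<rho>\<close> running inside the
  piece to \<open>q\<close> and then on to \<open>y\<close>; this is geodesic by the preceding
  lemma. A point common to \<open>\<alpha>\<close> and the second half of \<open>\<rho>\<close>
  would have both \<open>p\<close> and \<open>q\<close> as nearest points, which that lemma
  forbids.\<close>

lemma geodesic_through_nearest_point:
  assumes i: "i \<in> I" and xy: "x \<in> F" "y \<in> F"
    and np: "nearest_point d (P i) x p" and nq: "nearest_point d (P i) y q" and "p \<noteq> q"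
    and \<sigma>: "geodesic_path F d \<sigma> S" "\<sigma> 0 = x" "\<sigma> S = y"
  shows "p \<in> \<sigma> ` {0..S}"
proof -
  have pq: "p \<in> P i" "q \<in> P i" using np nq by (auto simp: nearest_point_def)
  have F: "p \<in> F" "q \<in> F" using pq piece_subset[OF i] by auto
  obtain \<alpha> where \<alpha>: "geodesic_path F d \<alpha> (d p x)" "\<alpha> 0 = p" "\<alpha> (d p x) = x"
    "\<And>t. 0 < t \<Longrightarrow> t \<le> d p x \<Longrightarrow> \<alpha> t \<notin> P i"
    "\<And>t. 0 \<le> t \<Longrightarrow> t \<le> d p x \<Longrightarrow> nearest_point d (P i) (\<alpha> t) p"
    using nearest_point_path[OF i xy(1) np] by metis
  obtain \<beta> where \<beta>: "geodesic_path F d \<beta> (d q y)" "\<beta> 0 = q" "\<beta> (d q y) = y"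
    "\<And>t. 0 \<le> t \<Longrightarrow> t \<le> d q y \<Longrightarrow> nearest_point d (P i) (\<beta> t) q"
    using nearest_point_path[OF i xy(2) nq] by metis
  obtain \<kappa> where \<kappa>: "geodesic_path F d \<kappa> (d p q)" "\<kappa> 0 = p" "\<kappa> (d p q) = q"
    "\<And>t. 0 \<le> t \<Longrightarrow> t \<le> d p q \<Longrightarrow> \<kappa> t \<in> P i"
    using piece_geodesic_exists[OF i pq] by metis
  define \<rho> where "\<rho> = (\<lambda>t. if t \<le> d p q then \<kappa> t else \<beta> (t - d p q))"
  have len: "d p y = d p q + d q y"
    using dist_through_nearest_point[OF i xy(2) nq pq(1)] by (simp add: commute)
  have \<rho>: "geodesic_path F d \<rho> (d p q + d q y)"
    unfolding \<rho>_def using geodesic_path_append[OF \<kappa>(1) \<beta>(1)] \<kappa> \<beta> len by simp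
  have pos: "d p q > 0" using F \<open>p \<noteq> q\<close> by simp
  have "\<rho> 0 \<in> \<sigma> ` {0..S}"
  proof (rule geodesic_through_corner[OF i \<alpha>(1) \<rho> \<sigma>(1) _ _ _ _ pos])
    show "\<alpha> 0 = \<rho> 0" "\<sigma> 0 = \<alpha> (d p x)" using \<alpha> \<rho>_def \<kappa> \<sigma> by auto
    show "\<rho> 0 \<in> P i" "\<rho> (d p q) \<in> P i" using \<kappa> pq by (auto simp: \<rho>_def)
    show "\<sigma> S = \<rho> (d p q + d q y)"
      using \<beta> \<kappa> \<sigma> nonneg[of q y] by (auto simp: \<rho>_def order_less_le simp del: nonneg)
    show "d p q \<le> d p q + d q y" by simp
    show "\<alpha> t \<notin> P i" if "0 < t" "t \<le> d p x" for t using \<alpha>(4) that .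
    show "\<alpha> s \<noteq> \<rho> t" if "0 < s" "s \<le> d p x" "0 < t" "t \<le> d p q + d q y" for s t
    proof (cases "t \<le> d p q")
      case True
      then show ?thesis using \<alpha>(4)[of s] \<kappa>(4)[of t] that by (auto simp: \<rho>_def)
    next
      case False
      show ?thesis
      proof
        assume eq: "\<alpha> s = \<rho> t"
        with False have "\<alpha> s = \<beta> (t - d p q)" by (simp add: \<rho>_def)
        then have "nearest_point d (P i) (\<alpha> s) q" "nearest_point d (P i) (\<alpha> s) p" "\<alpha> s \<in> F"
          using \<alpha>(5)[of s] \<beta>(4)[of "t - d p q"] that False geodesic_pathD(2)[OF \<alpha>(1), of s] by auto
        note * = this
        have "d (\<alpha> s) q = d (\<alpha> s) p + d p q"
          using dist_through_nearest_point[OF i *(3,2) pq(2)] .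
        moreover have "d (\<alpha> s) q \<le> d (\<alpha> s) p"
          using *(1) pq(1) unfolding nearest_point_def by blast
        ultimately show False using pos by simp
      qed
    qed
  qed
  then show ?thesis using \<kappa> by (simp add: \<rho>_def)
qed

lemma geodesic_through_both_nearest_points:
  assumes i: "i \<in> I" and xy: "x \<in> F" "y \<in> F"
    and np: "nearest_point d (P i) x p" and nq: "nearest_point d (P i) y q" and "p \<noteq> q"
    and \<sigma>: "geodesic_path F d \<sigma> S" "\<sigma> 0 = x" "\<sigma> S = y"
  shows "p \<in> \<sigma> ` {0..S}" "q \<in> \<sigma> ` {0..S}"
proof -
  show "p \<in> \<sigma> ` {0..S}" using geodesic_through_nearest_point[OF assms] .
  have S: "0 \<le> S" using geodesic_pathD(1)[OF \<sigma>(1)] .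
  have "q \<in> (\<lambda>t. \<sigma> (S - t)) ` {0..S}"
    using geodesic_through_nearest_point[OF i xy(2,1) nq np _ geodesic_path_reverse[OF \<sigma>(1), of 0 S]]
      \<open>p \<noteq> q\<close> \<sigma> S by auto
  then show "q \<in> \<sigma> ` {0..S}" by force
qed

text \<open>A geodesic from \<open>x\<close> to \<open>y\<close> through \<open>z\<close> meets
  \<open>p\<close> at time \<open>d x p\<close>, before \<open>z\<close>, and \<open>q\<close> after
  \<open>z\<close>; convexity of the piece does the rest. The projections differ because a path
  through a common projection would be shorter than \<open>d x y\<close>.\<close>

lemma between_nearest_points:
  assumes i: "i \<in> I" and F: "x \<in> F" "y \<in> F" "z \<in> F"
    and np: "nearest_point d (P i) x p" and nq: "nearest_point d (P i) y q"
    and between: "d x z + d z y = d x y" and close: "d x p < d x z" "d y q < d z y"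
  shows "z \<in> P i"
proof -
  have pq: "p \<in> F" "q \<in> F" using np nq piece_subset[OF i] by (auto simp: nearest_point_def)
  have ne: "p \<noteq> q"
  proof
    assume "p = q"
    then have "d x y \<le> d x p + d y q" using triangle[OF F(1) pq(1) F(2)] by (simp add: commute)
    then show False using between close by simp
  qed
  obtain \<gamma> where \<gamma>: "geodesic_path F d \<gamma> (d x z)" "\<gamma> 0 = x" "\<gamma> (d x z) = z"
    using geodesic_exists F by metis
  obtain \<delta> where \<delta>: "geodesic_path F d \<delta> (d z y)" "\<delta> 0 = z" "\<delta> (d z y) = y"
    using geodesic_exists F by metis
  define \<sigma> where "\<sigma> = (\<lambda>t. if t \<le> d x z then \<gamma> t else \<delta> (t - d x z))"
  have \<sigma>: "geodesic_path F d \<sigma> (d x y)"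
    unfolding \<sigma>_def using geodesic_path_append[OF \<gamma>(1) \<delta>(1)] \<gamma> \<delta> between by simp
  note s = geodesic_pathD[OF \<sigma>]
  have "\<sigma> 0 = x" "\<sigma> (d x z) = z" "\<sigma> (d x y) = y"
  proof -
    show "\<sigma> 0 = x" "\<sigma> (d x z) = z" using \<gamma> by (auto simp: \<sigma>_def)
    have "d z y = d x y - d x z" using between by simp
    show "\<sigma> (d x y) = y"
    proof (cases "d x y \<le> d x z")
      case True
      with between have "d z y = 0" using nonneg[of z y] by linarith
      then show ?thesis using True \<gamma>(3) F between by (simp add: \<sigma>_def)
    next
      case False
      then show ?thesis using \<delta>(3) \<open>d z y = _\<close> by (simp add: \<sigma>_def)
    qed
  qed
  then obtain u v where uv: "u \<in> {0..d x y}" "p = \<sigma> u" "v \<in> {0..d x y}" "q = \<sigma> v"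
    using geodesic_through_both_nearest_points[OF i F(1,2) np nq ne \<sigma>] by auto
  have "u = d x p" "d x y - v = d y q"
    using s(3)[of 0 u] s(3)[of "d x y" v] uv \<open>\<sigma> 0 = x\<close> \<open>\<sigma> (d x y) = y\<close> by auto
  with close between have *: "u < d x z" "d x z < v" by auto
  have "\<sigma> (u + (d x z - u)) \<in> P i"
    using piece_convex[OF i geodesic_path_shift[OF \<sigma>, of u v], of "d x z - u"] uv * np nq
    by (auto simp: nearest_point_def)
  then show ?thesis using \<open>\<sigma> (d x z) = z\<close> by simp
qed

end

section \<open>Ultrafilters\<close>

text \<open>Zorn's lemma for families whose finite subfamilies have infinite intersection. Demanding
  infinite instead of nonempty intersections is what makes the result nonprincipal.\<close>

lemma nonprincipal_ultrafilter_exists: "\<exists>\<omega>. nonprincipal_ultrafilter \<omega>"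
proof -
  define \<A> where "\<A> = {M :: nat set set. \<forall>B\<subseteq>M. finite B \<longrightarrow> infinite (\<Inter>B)}"
  have "\<exists>M\<in>\<A>. \<forall>X\<in>\<A>. M \<subseteq> X \<longrightarrow> X = M"
  proof (rule subset_Zorn_nonempty)
    have "{} \<in> \<A>" by (simp add: \<A>_def)
    then show "\<A> \<noteq> {}" by blast
    fix \<C> assume \<C>: "\<C> \<noteq> {}" "subset.chain \<A> \<C>"
    show "\<Union>\<C> \<in> \<A>"
      unfolding \<A>_def
    proof (intro CollectI allI impI)
      fix B assume B: "B \<subseteq> \<Union>\<C>" "finite B"
      then obtain C where "C \<in> \<C>" "B \<subseteq> C"
        using finite_subset_Union_chain[OF B(2,1) \<C>] by blast
      moreover have "\<C> \<subseteq> \<A>" using \<C>(2) by (simp add: subset_chain_def)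
      ultimately show "infinite (\<Inter>B)" using B(2) unfolding \<A>_def by blast
    qed
  qed
  then obtain M where M: "M \<in> \<A>" and max: "\<And>X. X \<in> \<A> \<Longrightarrow> M \<subseteq> X \<Longrightarrow> X = M" by blast
  have inf: "infinite (\<Inter>B)" if "B \<subseteq> M" "finite B" for B
    using M that unfolding \<A>_def by blast
  \<comment> \<open>Maximality in usable form: a set outside of \<open>M\<close> meets some finite
    intersection from \<open>M\<close> in a finite set only. Closure under supersets and the
    ultrafilter alternative both follow from it.\<close>
  have out: "\<exists>B. B \<subseteq> M \<and> finite B \<and> finite (\<Inter>B \<inter> Q)" if "Q \<notin> M" for Q
  proof -
    have "insert Q M \<notin> \<A>" using max[of "insert Q M"] that by blast
    then obtain B where B: "B \<subseteq> insert Q M" "finite B" "finite (\<Inter>B)"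
      unfolding \<A>_def by blast
    have "\<Inter>(B - {Q}) \<inter> Q \<subseteq> \<Inter>B" by blast
    with B show ?thesis by (intro exI[of _ "B - {Q}"]) (auto intro: finite_subset)
  qed
  have up: "Q \<in> M" if C: "C \<subseteq> M" "finite C" "\<Inter>C \<subseteq> Q" for C Q
  proof (rule ccontr)
    assume "Q \<notin> M"
    then obtain B where B: "B \<subseteq> M" "finite B" "finite (\<Inter>B \<inter> Q)" using out by blast
    have "\<Inter>(B \<union> C) \<subseteq> \<Inter>B \<inter> Q" using C(3) by blast
    then have "finite (\<Inter>(B \<union> C))" using B(3) finite_subset by blast
    then show False using inf[of "B \<union> C"] B C by simp
  qed
  define \<omega> where "\<omega> = Abs_filter (\<lambda>P. Collect P \<in> M)"
  have ev: "eventually P \<omega> \<longleftrightarrow> Collect P \<in> M" for P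
    unfolding \<omega>_def
  proof (rule eventually_Abs_filter, rule is_filter.intro)
    show "Collect (\<lambda>x. True) \<in> M" by (rule up[of "{}"]) auto
    show "Collect (\<lambda>x. P x \<and> Q x) \<in> M" if "Collect P \<in> M" "Collect Q \<in> M" for P Q
      using that by (intro up[of "{Collect P, Collect Q}"]) auto
    show "Collect Q \<in> M" if "\<forall>x. P x \<longrightarrow> Q x" "Collect P \<in> M" for P Q
      using that by (intro up[of "{Collect P}"]) auto
  qed
  have small: "Q \<notin> M" if "finite Q" for Q
    using inf[of "{Q}"] that by auto
  have "nonprincipal_ultrafilter \<omega>"
    unfolding nonprincipal_ultrafilter_def
  proof (intro conjI allI)
    show "\<omega> \<noteq> bot" using ev[of "\<lambda>_. False"] small[of "{}"] by (auto simp: trivial_limit_def)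
    show "\<not> eventually (\<lambda>n. n = k) \<omega>" for k using ev[of "\<lambda>n. n = k"] small[of "{k}"] by simp
    show "eventually Q \<omega> \<or> eventually (\<lambda>n. \<not> Q n) \<omega>" for Q
    proof (rule ccontr)
      assume "\<not> (eventually Q \<omega> \<or> eventually (\<lambda>n. \<not> Q n) \<omega>)"
      then have "Collect Q \<notin> M" "- Collect Q \<notin> M"
        using ev[of Q] ev[of "\<lambda>n. \<not> Q n"] by (auto simp: Collect_neg_eq)
      then obtain B C where BC: "B \<subseteq> M" "finite B" "finite (\<Inter>B \<inter> Collect Q)"
        "C \<subseteq> M" "finite C" "finite (\<Inter>C \<inter> - Collect Q)" using out by meson
      have "\<Inter>(B \<union> C) \<subseteq> (\<Inter>B \<inter> Collect Q) \<union> (\<Inter>C \<inter> - Collect Q)" by blast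
      then have "finite (\<Inter>(B \<union> C))" using BC(3,6) finite_subset by blast
      then show False using inf[of "B \<union> C"] BC by simp
    qed
  qed
  then show ?thesis by blast
qed

text \<open>Removing one point at a time leaves every tail in the ultrafilter.\<close>

lemma nonprincipal_ultrafilter_le_sequentially:
  assumes "nonprincipal_ultrafilter \<omega>"
  shows "\<omega> \<le> sequentially"
proof -
  have "eventually (\<lambda>n. k \<le> n) \<omega>" for k :: nat
  proof (induction k)
    case (Suc k)
    have "eventually (\<lambda>n. \<not> n = k) \<omega>"
      using assms unfolding nonprincipal_ultrafilter_def by blast
    with Suc show ?case by eventually_elim auto
  qed simp
  then show ?thesis
    unfolding le_filter_def eventually_sequentially
    by (metis (no_types, lifting) eventually_mono)
qed

text \<open>Compactness yields a cluster point; along an ultrafilter a cluster point is a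
  limit.\<close>

lemma nonprincipal_ultrafilter_bounded_tendsto:
  fixes f :: "nat \<Rightarrow> real"
  assumes u: "nonprincipal_ultrafilter \<omega>" and B: "eventually (\<lambda>n. \<bar>f n\<bar> \<le> B) \<omega>"
  shows "\<exists>l. (f \<longlongrightarrow> l) \<omega>"
proof -
  have "\<omega> \<noteq> bot" using u by (simp add: nonprincipal_ultrafilter_def)
  then have "filtermap f \<omega> \<noteq> bot" by (simp add: filtermap_bot_iff)
  moreover have "eventually (\<lambda>x. x \<in> {-B..B}) (filtermap f \<omega>)"
    using B unfolding eventually_filtermap by eventually_elim auto
  ultimately obtain l where l: "inf (nhds l) (filtermap f \<omega>) \<noteq> bot"
    using compact_Icc[of "-B" B] unfolding compact_filter by blast
  have "(f \<longlongrightarrow> l) \<omega>"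
  proof (rule topological_tendstoI, rule ccontr)
    fix S assume S: "open S" "l \<in> S" "\<not> eventually (\<lambda>n. f n \<in> S) \<omega>"
    then have "eventually (\<lambda>n. f n \<notin> S) \<omega>"
      using u unfolding nonprincipal_ultrafilter_def by blast
    then have "eventually (\<lambda>x. x \<notin> S) (filtermap f \<omega>)" by (simp add: eventually_filtermap)
    moreover have "eventually (\<lambda>x. x \<in> S) (nhds l)" using S by (simp add: eventually_nhds_in_open)
    ultimately have "eventually (\<lambda>x. False) (inf (nhds l) (filtermap f \<omega>))"
      unfolding eventually_inf by blast
    then show False using l by (simp add: trivial_limit_def)
  qed
  then show ?thesis by blast
qed

section \<open>Asymptotic cones\<close>

text \<open>The base points vary with the index, because the counterexamples collected in a cone sit
  at unrelated places of \<open>X\<close>.\<close>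

locale relatively_hyperbolic_cone =
  fixes X :: "'x set" and d :: "'x \<Rightarrow> 'x \<Rightarrow> real" and \<P> :: "'x set set"
    and \<omega> :: "nat filter" and e :: "nat \<Rightarrow> 'x" and r :: "nat \<Rightarrow> real"
  assumes hyperbolic: "hyperbolic_relative X d \<P>"
    and ultrafilter: "nonprincipal_ultrafilter \<omega>"
    and base: "\<And>n. e n \<in> X" and scale_pos: "\<And>n. 0 < r n"
    and scale_at_top: "filterlim r at_top \<omega>"
begin

abbreviation "bounded_seqs \<equiv> cone_seqs X d \<omega> e r"
abbreviation "cone_space \<equiv> asymp_cone X d \<omega> e r"
abbreviation "cdist \<equiv> cone_dist X d \<omega> e r"
abbreviation "pieces \<equiv> cone_piece_indices X d \<P> \<omega> e r"
abbreviation "piece \<equiv> cone_piece X d \<omega> e r"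

definition point :: "(nat \<Rightarrow> 'x) \<Rightarrow> (nat \<Rightarrow> 'x) set" where
  "point x = cone_rel X d \<omega> e r `` {x}"

definition index :: "(nat \<Rightarrow> 'x set) \<Rightarrow> (nat \<Rightarrow> 'x set) set" where
  "index A = as_equal \<P> \<omega> `` {A}"

sublocale tree_graded_space cone_space cdist pieces piece
  using hyperbolic ultrafilter base scale_pos scale_at_top
  unfolding hyperbolic_relative_def by unfold_locales blast

lemma metric: "Metric_space X d"
  using hyperbolic unfolding hyperbolic_relative_def geodesic_space_def by blast

lemma not_bot: "\<omega> \<noteq> bot"
  using ultrafilter by (simp add: nonprincipal_ultrafilter_def)

lemma bounded_seqsI:
  assumes "\<And>n. x n \<in> X" "\<And>n. d (e n) (x n) \<le> B * r n"
  shows "x \<in> bounded_seqs"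
proof -
  have "d (e n) (x n) / r n \<le> B" for n using assms(2) scale_pos by (simp add: divide_le_eq)
  then show ?thesis
    using assms(1) unfolding cone_seqs_def by (auto intro!: exI[of _ B] always_eventually)
qed

lemma bounded_seqs_in: "x \<in> bounded_seqs \<Longrightarrow> x n \<in> X"
  by (simp add: cone_seqs_def)

text \<open>Makes the cone distance independent of representatives; moving only the second sequence
  gives transitivity of the cone relation.\<close>

lemma tendsto_triangle:
  assumes x: "x \<in> bounded_seqs" "y \<in> bounded_seqs" "x' \<in> bounded_seqs" "y' \<in> bounded_seqs"
    and "((\<lambda>n. d (x n) (x' n) / r n) \<longlongrightarrow> 0) \<omega>" "((\<lambda>n. d (y n) (y' n) / r n) \<longlongrightarrow> 0) \<omega>"
    and l: "((\<lambda>n. d (x n) (y n) / r n) \<longlongrightarrow> l) \<omega>"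
  shows "((\<lambda>n. d (x' n) (y' n) / r n) \<longlongrightarrow> l) \<omega>"
proof -
  interpret X: Metric_space X d by (rule metric)
  have "((\<lambda>n. d (x' n) (y' n) / r n - d (x n) (y n) / r n) \<longlongrightarrow> 0) \<omega>"
  proof (rule Lim_null_comparison)
    show "((\<lambda>n. d (x n) (x' n) / r n + d (y n) (y' n) / r n) \<longlongrightarrow> 0) \<omega>"
      using tendsto_add[OF assms(5,6)] by simp
    have "\<bar>d (x' n) (y' n) - d (x n) (y n)\<bar> \<le> d (x n) (x' n) + d (y n) (y' n)" for n
      using X.triangle[of "x n" "x' n" "y n"] X.triangle[of "x' n" "y' n" "y n"]
        X.triangle[of "x' n" "x n" "y' n"] X.triangle[of "x n" "y n" "y' n"]
        x[THEN bounded_seqs_in] X.commute by (smt (verit))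
    then show "\<forall>\<^sub>F n in \<omega>. norm (d (x' n) (y' n) / r n - d (x n) (y n) / r n)
                 \<le> d (x n) (x' n) / r n + d (y n) (y' n) / r n"
      using scale_pos
      by (intro always_eventually allI)
        (simp add: diff_divide_distrib[symmetric] add_divide_distrib[symmetric] abs_divide divide_right_mono
          abs_of_pos less_imp_le)
  qed
  from tendsto_add[OF this l] show ?thesis by simp
qed

lemma equiv_cone_rel: "equiv bounded_seqs (cone_rel X d \<omega> e r)"
proof -
  interpret X: Metric_space X d by (rule metric)
  have refl: "((\<lambda>n. d (x n) (x n) / r n) \<longlongrightarrow> 0) \<omega>" if "x \<in> bounded_seqs" for x
    using bounded_seqs_in[OF that] by simp
  show ?thesis
  proof (rule equivI)
    show "cone_rel X d \<omega> e r \<subseteq> bounded_seqs \<times> bounded_seqs" by (auto simp: cone_rel_def)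
    show "refl_on bounded_seqs (cone_rel X d \<omega> e r)"
      using refl by (auto simp: refl_on_def cone_rel_def)
    show "sym (cone_rel X d \<omega> e r)"
      by (auto simp: sym_def cone_rel_def X.commute)
    show "trans (cone_rel X d \<omega> e r)"
    proof (rule transI)
      fix x y z assume "(x, y) \<in> cone_rel X d \<omega> e r" "(y, z) \<in> cone_rel X d \<omega> e r"
      then have *: "x \<in> bounded_seqs" "y \<in> bounded_seqs" "z \<in> bounded_seqs"
        "((\<lambda>n. d (x n) (y n) / r n) \<longlongrightarrow> 0) \<omega>" "((\<lambda>n. d (y n) (z n) / r n) \<longlongrightarrow> 0) \<omega>"
        by (auto simp: cone_rel_def)
      then show "(x, z) \<in> cone_rel X d \<omega> e r"
        using tendsto_triangle[OF *(1,2,1,3) refl[OF *(1)] *(5,4)] by (simp add: cone_rel_def)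
    qed
  qed
qed

lemma point_in_cone: "x \<in> bounded_seqs \<Longrightarrow> point x \<in> cone_space"
  unfolding point_def asymp_cone_def by (rule quotientI)

lemma cone_pointE:
  assumes "p \<in> cone_space" obtains x where "x \<in> bounded_seqs" "p = point x"
  using assms unfolding asymp_cone_def point_def by (rule quotientE)

lemma in_point_iff:
  "x \<in> bounded_seqs \<Longrightarrow>
    y \<in> point x \<longleftrightarrow> y \<in> bounded_seqs \<and> ((\<lambda>n. d (x n) (y n) / r n) \<longlongrightarrow> 0) \<omega>"
  by (simp add: point_def cone_rel_def)

lemma point_self: "x \<in> bounded_seqs \<Longrightarrow> x \<in> point x"
  unfolding point_def using equiv_class_self[OF equiv_cone_rel] .

lemma point_eq: "x \<in> bounded_seqs \<Longrightarrow> y \<in> point x \<Longrightarrow> point y = point x"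
  unfolding point_def using equiv_class_eq[OF equiv_cone_rel] by blast

text \<open>Rescaled distances of sequences in the cone are bounded, so the ultrafilter supplies a
  limit; its independence of representatives makes the definite description in
  \<open>cone_dist\<close> meaningful.\<close>

lemma cdist_tendsto:
  assumes x: "x \<in> bounded_seqs" and y: "y \<in> bounded_seqs"
  shows "((\<lambda>n. d (x n) (y n) / r n) \<longlongrightarrow> cdist (point x) (point y)) \<omega>"
proof -
  interpret X: Metric_space X d by (rule metric)
  obtain B where B: "eventually (\<lambda>n. d (e n) (x n) / r n \<le> B) \<omega>"
    using x by (auto simp: cone_seqs_def)
  obtain C where C: "eventually (\<lambda>n. d (e n) (y n) / r n \<le> C) \<omega>"
    using y by (auto simp: cone_seqs_def)
  have "eventually (\<lambda>n. \<bar>d (x n) (y n) / r n\<bar> \<le> B + C) \<omega>"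
    using B C
  proof eventually_elim
    case (elim n)
    have "d (x n) (y n) \<le> d (e n) (x n) + d (e n) (y n)"
      using X.triangle''[of "x n" "e n" "y n"] base bounded_seqs_in x y X.commute by metis
    then have "d (x n) (y n) / r n \<le> d (e n) (x n) / r n + d (e n) (y n) / r n"
      using scale_pos[of n] by (simp add: add_divide_distrib[symmetric] divide_right_mono)
    with elim scale_pos[of n] show ?case by simp
  qed
  then obtain l where l: "((\<lambda>n. d (x n) (y n) / r n) \<longlongrightarrow> l) \<omega>"
    using nonprincipal_ultrafilter_bounded_tendsto[OF ultrafilter, of "\<lambda>n. d (x n) (y n) / r n"]
    by blast
  have uniq: "m = l" if "x' \<in> point x" "y' \<in> point y" "((\<lambda>n. d (x' n) (y' n) / r n) \<longlongrightarrow> m) \<omega>" for x' y' m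
  proof -
    have "((\<lambda>n. d (x' n) (y' n) / r n) \<longlongrightarrow> l) \<omega>"
      using that(1,2) x y l by (auto simp: in_point_iff intro: tendsto_triangle)
    then show ?thesis using tendsto_unique[OF not_bot] that(3) by blast
  qed
  have "(THE m. \<exists>x'\<in>point x. \<exists>y'\<in>point y. ((\<lambda>n. d (x' n) (y' n) / r n) \<longlongrightarrow> m) \<omega>) = l"
    using l uniq point_self x y by (intro the_equality) blast+
  then have "cdist (point x) (point y) = l"
    using point_in_cone x y by (simp add: cone_dist_def)
  then show ?thesis using l by simp
qed

lemma cdist_le:
  assumes "x \<in> bounded_seqs" "y \<in> bounded_seqs" "\<And>n. d (x n) (y n) \<le> c * r n"
  shows "cdist (point x) (point y) \<le> c"
  by (rule tendsto_upperbound[OF cdist_tendsto[OF assms(1,2)] _ not_bot])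
    (use assms(3) scale_pos in \<open>simp add: divide_le_eq\<close>)

lemma cdist_ge:
  assumes "x \<in> bounded_seqs" "y \<in> bounded_seqs" "\<And>n. c * r n \<le> d (x n) (y n)"
  shows "c \<le> cdist (point x) (point y)"
  by (rule tendsto_lowerbound[OF cdist_tendsto[OF assms(1,2)] _ not_bot])
    (use assms(3) scale_pos in \<open>simp add: le_divide_eq\<close>)

lemma index_in_pieces:
  assumes A: "\<And>n. A n \<in> \<P>" and x: "x \<in> bounded_seqs" "\<And>n. x n \<in> A n"
  shows "index A \<in> pieces" "point x \<in> piece (index A)"
proof -
  have "A \<in> index A" using A by (simp add: index_def as_equal_def)
  moreover have "point x \<in> ultralimit X d \<omega> e r A"
    unfolding ultralimit_def using point_in_cone[OF x(1)] point_self[OF x(1)] x(2)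
    by (auto intro!: bexI[of _ x] always_eventually)
  ultimately show p: "point x \<in> piece (index A)" by (auto simp: cone_piece_def)
  have "index A \<in> {A. \<forall>n. A n \<in> \<P>} // as_equal \<P> \<omega>"
    unfolding index_def using A by (intro quotientI) simp
  then show "index A \<in> pieces" using p by (auto simp: cone_piece_indices_def)
qed

text \<open>An index is a class of sequences, but almost sure equality allows membership to be
  tested on the given \<open>A\<close>.\<close>

lemma in_pieceE:
  assumes "p \<in> piece (index A)"
  obtains z where "z \<in> bounded_seqs" "p = point z" "eventually (\<lambda>n. z n \<in> A n) \<omega>"
proof -
  obtain B z where B: "B \<in> index A" and z: "p \<in> cone_space" "z \<in> p" "eventually (\<lambda>n. z n \<in> B n) \<omega>"
    using assms by (auto simp: cone_piece_def ultralimit_def)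
  obtain x where x: "x \<in> bounded_seqs" "p = point x" using z(1) by (rule cone_pointE)
  have "p = point z" "z \<in> bounded_seqs" using point_eq x z(2) in_point_iff by auto
  moreover have "eventually (\<lambda>n. A n = B n) \<omega>" using B by (simp add: index_def as_equal_def)
  with z(3) have "eventually (\<lambda>n. z n \<in> A n) \<omega>" by eventually_elim simp
  ultimately show thesis using that by blast
qed

lemma index_neq:
  assumes "\<And>n. A n \<in> \<P>" "\<And>n. B n \<in> \<P>" "\<And>n. A n \<noteq> B n"
  shows "index A \<noteq> index B"
proof
  assume "index A = index B"
  moreover have "B \<in> index B" using assms(2) by (simp add: index_def as_equal_def)
  ultimately have "eventually (\<lambda>n. A n = B n) \<omega>" by (auto simp: index_def as_equal_def)
  then show False using assms(3) not_bot by (simp add: trivial_limit_def)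
qed

text \<open>A competitor in the limit piece is represented by a sequence lying in \<open>A n\<close>
  almost surely, and the inequalities for that sequence pass to the limit.\<close>

lemma nearest_point_cone:
  assumes A: "\<And>n. A n \<in> \<P>" and x: "x \<in> bounded_seqs" and p: "p \<in> bounded_seqs"
    and near: "\<And>n. nearest_point d (A n) (x n) (p n)"
  shows "nearest_point cdist (piece (index A)) (point x) (point p)"
  unfolding nearest_point_def
proof (intro conjI ballI)
  show "point p \<in> piece (index A)"
    using index_in_pieces(2)[OF A p] near by (simp add: nearest_point_def)
  fix w assume "w \<in> piece (index A)"
  then obtain z where z: "z \<in> bounded_seqs" "w = point z" "eventually (\<lambda>n. z n \<in> A n) \<omega>"
    by (rule in_pieceE)
  have "eventually (\<lambda>n. d (x n) (p n) / r n \<le> d (x n) (z n) / r n) \<omega>"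
    using z(3)
  proof eventually_elim
    case (elim n)
    then show ?case using near[of n] scale_pos[of n]
      by (auto simp: nearest_point_def intro: divide_right_mono)
  qed
  then show "cdist (point x) (point p) \<le> cdist (point x) w"
    unfolding z(2) by (rule tendsto_le[OF not_bot cdist_tendsto[OF x z(1)] cdist_tendsto[OF x p]])
qed

end

text \<open>The condition \<open>real n < r n\<close> gives positive scales and divergence along
  every nonprincipal ultrafilter at once.\<close>

lemma relatively_hyperbolic_cone_exists:
  assumes "hyperbolic_relative X d \<P>" "\<And>n. e n \<in> X" "\<And>n. real n < r n"
  obtains \<omega> where "relatively_hyperbolic_cone X d \<P> \<omega> e r"
proof -
  obtain \<omega> where \<omega>: "nonprincipal_ultrafilter \<omega>" using nonprincipal_ultrafilter_exists by blast
  have "filterlim r at_top sequentially"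
    by (rule filterlim_at_top_mono[OF filterlim_real_sequentially]) (use assms(3) in \<open>auto intro!: always_eventually less_imp_le\<close>)
  then have "filterlim r at_top \<omega>"
    using filterlim_mono order_refl nonprincipal_ultrafilter_le_sequentially[OF \<omega>] by blast
  moreover have "0 < r n" for n using assms(3)[of n] of_nat_0_le_iff[of n] by linarith
  ultimately show thesis using that[of \<omega>] assms \<omega> by (auto intro!: relatively_hyperbolic_cone.intro)
qed

lemma hyperbolic_relativeD:
  assumes "hyperbolic_relative X d \<P>"
  shows "Metric_space X d" "\<And>A. A \<in> \<P> \<Longrightarrow> A \<subseteq> X"
  using assms by (simp_all add: hyperbolic_relative_def geodesic_space_def)

section \<open>Projections in relatively hyperbolic spaces\<close>

text \<open>Failures at arbitrarily large scales produce a cone with a geodesic of length at most 1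
  and countably many distinct pieces, each containing the part of it between two projections, of
  length at least \<epsilon>. Two such parts overlap in a nontrivial segment, but different pieces
  share at most one point. The bound \<open>2 * n\<close> keeps the projections at finite distance
  in the cone.\<close>

lemma finite_pieces_with_large_projection:
  fixes \<epsilon> :: real
  assumes H: "hyperbolic_relative X d \<P>" and \<epsilon>: "\<epsilon> > 0"
  shows "\<exists>N. \<forall>n\<ge>N. \<forall>x\<in>X. \<forall>y\<in>X. d x y \<le> n \<longrightarrow>
    finite {A\<in>\<P>. \<exists>p q. nearest_point d A x p \<and> nearest_point d A y q \<and> d x p \<le> 2 * n \<and> \<epsilon> * n \<le> d p q}"
    (is "\<exists>N. \<forall>n\<ge>N. \<forall>x\<in>X. \<forall>y\<in>X. d x y \<le> n \<longrightarrow> finite (?Q n x y)")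
proof (rule ccontr)
  assume neg': "\<not> ?thesis"
  define Q where "Q n x y = ?Q n x y" for n x y
  have neg: "\<not> (\<forall>n\<ge>N. \<forall>x\<in>X. \<forall>y\<in>X. d x y \<le> n \<longrightarrow> finite (Q n x y))" for N
    using neg'[unfolded not_ex, THEN spec, of N] unfolding Q_def .
  have "\<exists>n x y. real k + 1 \<le> n \<and> x \<in> X \<and> y \<in> X \<and> d x y \<le> n \<and> infinite (Q n x y)" for k :: nat
    using neg[of "real k + 1"] by blast
  then obtain r x y where r: "\<And>k. real k + 1 \<le> r k" and xy: "\<And>k::nat. x k \<in> X" "\<And>k. y k \<in> X"
    and dxy: "\<And>k. d (x k) (y k) \<le> r k" and inf: "\<And>k. infinite (Q (r k) (x k) (y k))"
    by metis
  \<comment> \<open>At each scale \<open>k\<close> an injective list of bad pieces is chosen. For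
    fixed \<open>j\<close> the pieces \<open>A k j\<close> form a sequence in \<open>k\<close>, and
    sequences for different \<open>j\<close> differ at every \<open>k\<close>, so they give
    different pieces of the cone.\<close>
  have "\<forall>k. \<exists>f::nat \<Rightarrow> 'a set. inj f \<and> range f \<subseteq> Q (r k) (x k) (y k)"
    using inf infinite_countable_subset by meson
  from choice[OF this] obtain A :: "nat \<Rightarrow> nat \<Rightarrow> 'a set"
    where A': "\<forall>k. inj (A k) \<and> range (A k) \<subseteq> Q (r k) (x k) (y k)"
    by blast
  then have A: "inj (A k)" "range (A k) \<subseteq> Q (r k) (x k) (y k)" for k
    by simp_all
  have "\<forall>j k. A k j \<in> \<P> \<and> (\<exists>p q. nearest_point d (A k j) (x k) p \<and> nearest_point d (A k j) (y k) q \<and>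
      d (x k) p \<le> 2 * r k \<and> \<epsilon> * r k \<le> d p q)"
  proof (intro allI)
    fix j k
    have "A k j \<in> Q (r k) (x k) (y k)" using A(2) by blast
    then show "A k j \<in> \<P> \<and> (\<exists>p q. nearest_point d (A k j) (x k) p \<and> nearest_point d (A k j) (y k) q \<and>
        d (x k) p \<le> 2 * r k \<and> \<epsilon> * r k \<le> d p q)"
      unfolding Q_def by (rule CollectD)
  qed
  then obtain p q where AP: "\<And>j k. A k j \<in> \<P>" and near: "\<And>j k. nearest_point d (A k j) (x k) (p j k)"
      "\<And>j k. nearest_point d (A k j) (y k) (q j k)"
    and dp: "\<And>j k. d (x k) (p j k) \<le> 2 * r k" and dpq: "\<And>j k. \<epsilon> * r k \<le> d (p j k) (q j k)"
    by metis
  have "real k < r k" for k using r[of k] by linarith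
  then obtain \<omega> where cone: "relatively_hyperbolic_cone X d \<P> \<omega> x r"
    using relatively_hyperbolic_cone_exists[where e = x and r = r, OF H xy(1)] by blast
  interpret relatively_hyperbolic_cone X d \<P> \<omega> x r by (rule cone)
  interpret X: Metric_space X d by (rule metric)
  have sub: "A k j \<subseteq> X" for j k using hyperbolic_relativeD(2)[OF H AP] .
  have pq: "p j k \<in> A k j" "q j k \<in> A k j" "p j k \<in> X" "q j k \<in> X" for j k
    using near[where j = j and k = k] sub unfolding nearest_point_def by blast+
  have bx: "x \<in> bounded_seqs" by (rule bounded_seqsI[where B = 0]) (use xy in auto)
  have byy: "y \<in> bounded_seqs" by (rule bounded_seqsI[where B = 1]) (use xy dxy in auto)
  have bp: "p j \<in> bounded_seqs" for j by (rule bounded_seqsI[where B = 2]) (use pq dp in auto)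
  \<comment> \<open>The distance from \<open>x\<close> to \<open>y\<close> contributes 1, and
    \<open>q\<close> is at most as far from \<open>y\<close> as \<open>p\<close> is, which is at
    most 1 + 2.\<close>
  have bq: "q j \<in> bounded_seqs" for j
  proof (rule bounded_seqsI[where B = 4])
    fix k
    have "d (y k) (q j k) \<le> d (y k) (p j k)"
      using near(2)[where j = j and k = k] pq(1) by (auto simp: nearest_point_def)
    also have "\<dots> \<le> d (x k) (y k) + d (x k) (p j k)"
      using X.triangle''[of "y k" "x k" "p j k"] xy pq X.commute by metis
    finally show "d (x k) (q j k) \<le> 4 * r k"
      using X.triangle[of "x k" "y k" "q j k"] xy pq dxy[of k] dp[where j = j and k = k] by force
  qed (use pq in auto)
  define i where "i j = index (\<lambda>k. A k j)" for j
  have i: "i j \<in> pieces" for j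
    unfolding i_def by (rule index_in_pieces(1)[OF AP bp pq(1)])
  have i_inj: "i j \<noteq> i j'" if "j \<noteq> j'" for j j'
    unfolding i_def by (rule index_neq[OF AP AP]) (use that A(1) in \<open>auto dest: injD\<close>)
  have np: "nearest_point cdist (piece (i j)) (point x) (point (p j))"
    and nq: "nearest_point cdist (piece (i j)) (point y) (point (q j))" for j
    unfolding i_def by (rule nearest_point_cone[OF AP bx bp near(1)], rule nearest_point_cone[OF AP byy bq near(2)])
  let ?L = "cdist (point x) (point y)"
  have L: "?L \<le> 1" by (rule cdist_le[OF bx byy]) (simp add: dxy)
  have pq_far: "\<epsilon> \<le> cdist (point (p j)) (point (q j))" for j
    by (rule cdist_ge[OF bp bq]) (rule dpq)
  obtain \<sigma> where \<sigma>: "geodesic_path cone_space cdist \<sigma> ?L" "\<sigma> 0 = point x" "\<sigma> ?L = point y"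
    using geodesic_exists point_in_cone bx byy by metis
  note s = geodesic_pathD[OF \<sigma>(1)]
  \<comment> \<open>Every interval of length \<open>\<epsilon>\<close> contains a full cell of the
    grid of mesh \<open>h\<close>, and only finitely many cells are available on a geodesic of
    length at most 1; so two of the pieces contain the same cell.\<close>
  define h where "h = \<epsilon> / 3"
  have h: "h > 0" using \<epsilon> by (simp add: h_def)
  have "\<exists>m \<le> nat \<lceil>1 / h\<rceil>. \<exists>u. real m * h = u \<and> 0 \<le> u \<and> u + h \<le> ?L \<and>
      \<sigma> u \<in> piece (i j) \<and> \<sigma> (u + h) \<in> piece (i j)" for j
  proof -
    have pqj: "point (p j) \<in> piece (i j)" "point (q j) \<in> piece (i j)"
      using np nq by (auto simp: nearest_point_def)
    have "point (p j) \<noteq> point (q j)"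
    proof
      assume eq: "point (p j) = point (q j)"
      have "cdist (point (q j)) (point (q j)) = 0" using point_in_cone[OF bq] by simp
      with pq_far[of j] \<epsilon> eq show False by simp
    qed
    from geodesic_through_both_nearest_points[OF i point_in_cone[OF bx] point_in_cone[OF byy] np nq this \<sigma>]
    obtain a b where ab: "a \<in> {0..?L}" "b \<in> {0..?L}" "\<sigma> a = point (p j)" "\<sigma> b = point (q j)" by auto
    define a' where "a' = min a b"
    define b' where "b' = max a b"
    have ab': "0 \<le> a'" "a' \<le> b'" "b' \<le> ?L" using ab by (auto simp: a'_def b'_def)
    have "\<bar>a - b\<bar> \<ge> \<epsilon>" using s(3)[of a b] ab pq_far[of j] by auto
    then have gap: "a' + 3 * h \<le> b'" by (auto simp: a'_def b'_def h_def abs_if split: if_splits)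
    have ends: "\<sigma> a' \<in> piece (i j)" "\<sigma> b' \<in> piece (i j)"
      using ab pqj by (auto simp: a'_def b'_def min_def max_def)
    have conv: "\<sigma> t \<in> piece (i j)" if "a' \<le> t" "t \<le> b'" for t
      using piece_convex[OF i geodesic_path_shift[OF \<sigma>(1) ab'], of j "t - a'"] ends that by simp
    define m where "m = nat \<lceil>a' / h\<rceil>"
    have m1: "a' / h \<le> real m" "real m < a' / h + 1"
      using ab'(1) h unfolding m_def by (simp_all add: of_nat_ceiling) linarith
    then have m: "a' \<le> real m * h" "real m * h < a' + h"
      using h by (simp_all add: field_simps)
    have "a' \<le> 1" using ab' L by simp
    then have "m \<le> nat \<lceil>1 / h\<rceil>"
      unfolding m_def using h by (intro nat_mono ceiling_mono divide_right_mono) auto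
    then show ?thesis using m conv[of "real m * h"] conv[of "real m * h + h"] gap ab' h
      by (intro exI[of _ m] conjI exI[of _ "real m * h"]) auto
  qed
  then obtain m where m: "\<And>j. m j \<le> nat \<lceil>1 / h\<rceil>"
    and \<sigma>m: "\<And>j. 0 \<le> real (m j) * h" "\<And>j. real (m j) * h + h \<le> ?L"
      "\<And>j. \<sigma> (real (m j) * h) \<in> piece (i j)" "\<And>j. \<sigma> (real (m j) * h + h) \<in> piece (i j)"
    by metis
  have "\<not> inj m"
  proof
    assume "inj m"
    moreover have "range m \<subseteq> {..nat \<lceil>1 / h\<rceil>}" using m by auto
    ultimately show False using finite_imageD finite_subset infinite_UNIV_nat by blast
  qed
  then obtain j j' where jj: "j \<noteq> j'" "m j = m j'" by (auto simp: inj_def)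
  have "\<sigma> (real (m j) * h) \<noteq> \<sigma> (real (m j) * h + h)"
    using geodesic_path_inj[OF \<sigma>(1)] \<sigma>m(1,2)[of j] h by simp
  then have "i j = i j'"
    using piece_eqI[OF i i] \<sigma>m(3,4)[of j] \<sigma>m(3,4)[of j'] jj(2) by metis
  then show False using i_inj jj(1) by blast
qed

text \<open>Rescaled by \<open>d x p\<close>, the point \<open>x\<close> has distance 1 from the
  piece and at most 1/2 from \<open>y\<close>. If the projections differed in the cone, a geodesic
  from \<open>x\<close> to \<open>y\<close> would have to reach the projection of \<open>x\<close>,
  which is too far away.\<close>

lemma projection_sublinear_far_away:
  fixes \<epsilon> :: real
  assumes H: "hyperbolic_relative X d \<P>" and \<epsilon>: "\<epsilon> > 0"
  shows "\<exists>N. \<forall>A\<in>\<P>. \<forall>x\<in>X. \<forall>y\<in>X. \<forall>p q. nearest_point d A x p \<and> nearest_point d A y q \<and>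
    N \<le> d x p \<and> d x y \<le> d x p / 2 \<longrightarrow> d p q \<le> \<epsilon> * d x p"
proof (rule ccontr)
  assume neg: "\<not> ?thesis"
  have "\<exists>A x y p q. A \<in> \<P> \<and> x \<in> X \<and> y \<in> X \<and> nearest_point d A x p \<and>
      nearest_point d A y q \<and> real k + 1 \<le> d x p \<and> d x y \<le> d x p / 2 \<and> \<epsilon> * d x p < d p q" for k :: nat
    using neg[unfolded not_ex, THEN spec, of "real k + 1"] by (simp add: not_le) blast
  then obtain A x y p q where AP: "\<And>k::nat. A k \<in> \<P>" and xy: "\<And>k. x k \<in> X" "\<And>k. y k \<in> X"
    and near: "\<And>k. nearest_point d (A k) (x k) (p k)" "\<And>k. nearest_point d (A k) (y k) (q k)"
    and large: "\<And>k. real k + 1 \<le> d (x k) (p k)"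
    and dxy: "\<And>k. d (x k) (y k) \<le> d (x k) (p k) / 2"
    and dpq: "\<And>k. \<epsilon> * d (x k) (p k) < d (p k) (q k)"
    by metis
  define r where "r = (\<lambda>k. d (x k) (p k))"
  have "real k < r k" for k using large[of k] unfolding r_def by linarith
  then obtain \<omega> where cone: "relatively_hyperbolic_cone X d \<P> \<omega> x r"
    using relatively_hyperbolic_cone_exists[where e = x and r = r, OF H xy(1)] by blast
  interpret relatively_hyperbolic_cone X d \<P> \<omega> x r by (rule cone)
  interpret X: Metric_space X d by (rule metric)
  have sub: "A k \<subseteq> X" for k using hyperbolic_relativeD(2)[OF H AP] .
  have pq: "p k \<in> A k" "q k \<in> A k" "p k \<in> X" "q k \<in> X" for k
    using near[where k = k] sub unfolding nearest_point_def by blast+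
  have bx: "x \<in> bounded_seqs" by (rule bounded_seqsI[where B = 0]) (use xy in auto)
  have byy: "y \<in> bounded_seqs"
    by (rule bounded_seqsI[where B = "1/2"]) (use xy dxy in \<open>auto simp: r_def\<close>)
  have bp: "p \<in> bounded_seqs" by (rule bounded_seqsI[where B = 1]) (use pq in \<open>auto simp: r_def\<close>)
  \<comment> \<open>The bound is 1/2 for \<open>x\<close> to \<open>y\<close> plus 1/2 + 1 for
    \<open>y\<close> to \<open>p\<close>, which dominates \<open>y\<close> to
    \<open>q\<close>.\<close>
  have bq: "q \<in> bounded_seqs"
  proof (rule bounded_seqsI[where B = 2])
    fix k
    have "d (y k) (q k) \<le> d (y k) (p k)"
      using near(2)[where k = k] pq(1) by (auto simp: nearest_point_def)
    also have "\<dots> \<le> d (x k) (y k) + d (x k) (p k)"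
      using X.triangle''[of "y k" "x k" "p k"] xy pq X.commute by metis
    finally show "d (x k) (q k) \<le> 2 * r k"
      using X.triangle[of "x k" "y k" "q k"] xy pq dxy[of k] unfolding r_def by force
  qed (use pq in auto)
  have i: "index A \<in> pieces" by (rule index_in_pieces(1)[OF AP bp pq(1)])
  have np: "nearest_point cdist (piece (index A)) (point x) (point p)"
    and nq: "nearest_point cdist (piece (index A)) (point y) (point q)"
    by (rule nearest_point_cone[OF AP bx bp near(1)], rule nearest_point_cone[OF AP byy bq near(2)])
  have "\<epsilon> \<le> cdist (point p) (point q)"
    by (rule cdist_ge[OF bp bq]) (use dpq in \<open>auto simp: r_def less_imp_le\<close>)
  then have "point p \<noteq> point q" using \<epsilon> point_in_cone[OF bq] by auto
  moreover
  let ?L = "cdist (point x) (point y)"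
  obtain \<sigma> where \<sigma>: "geodesic_path cone_space cdist \<sigma> ?L" "\<sigma> 0 = point x" "\<sigma> ?L = point y"
    using geodesic_exists point_in_cone bx byy by metis
  ultimately have "point p \<in> \<sigma> ` {0..?L}"
    using geodesic_through_nearest_point[OF i point_in_cone[OF bx] point_in_cone[OF byy] np nq] by blast
  then obtain t where "t \<in> {0..?L}" "point p = \<sigma> t" by blast
  then have "cdist (point x) (point p) \<le> ?L"
    using geodesic_pathD(3)[OF \<sigma>(1), of 0 t] \<sigma>(2) by auto
  moreover have "?L \<le> 1/2" by (rule cdist_le[OF bx byy]) (use dxy in \<open>simp add: r_def\<close>)
  moreover have "1 \<le> cdist (point x) (point p)" by (rule cdist_ge[OF bx bp]) (simp add: r_def)
  ultimately show False by simp
qed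

text \<open>Otherwise a point at maximal distance from the piece, rescaled by that distance, lies in the
  cone on a geodesic between two points whose projections enclose it.\<close>

lemma discrete_geodesics_near_piece:
  assumes H: "hyperbolic_relative X d \<P>"
  shows "\<exists>K. \<forall>A\<in>\<P>. \<forall>u (m::nat). (\<forall>i\<le>m. u i \<in> X \<and> (\<exists>p. nearest_point d A (u i) p)) \<and>
    (\<forall>i\<le>m. \<forall>j\<le>m. d (u i) (u j) = \<bar>real i - real j\<bar>) \<and> u 0 \<in> A \<and> u m \<in> A \<longrightarrow>
    (\<forall>i\<le>m. \<exists>p\<in>A. d (u i) p \<le> K)"
proof (rule ccontr)
  assume neg: "\<not> ?thesis"
  have Xm: "Metric_space X d" using hyperbolic_relativeD(1)[OF H] .
  \<comment> \<open>The two inequalities with \<open>d z w\<close> added on the left become strict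
    in the cone and place \<open>z\<close> between the projections; the last two keep
    \<open>x\<close> and \<open>y\<close> at bounded rescaled distance.\<close>
  have "\<exists>A x y z p q w. A \<in> \<P> \<and> x \<in> X \<and> y \<in> X \<and> z \<in> X \<and> nearest_point d A x p \<and>
      nearest_point d A y q \<and> nearest_point d A z w \<and> real k + 1 \<le> d z w \<and>
      d x z + d z y = d x y \<and> d x p + d z w \<le> d x z \<and> d y q + d z w \<le> d z y \<and>
      d z x \<le> 3 * d z w + 1 \<and> d z y \<le> 3 * d z w + 1" for k :: nat
  proof -
    interpret X: Metric_space X d by (rule Xm)
    from neg[unfolded not_ex not_all ball_simps(10), THEN spec, of "real k + 1"]
    obtain A u m where A: "A \<in> \<P>"
      and bad: "\<not> ((\<forall>i\<le>m. u i \<in> X \<and> (\<exists>p. nearest_point d A (u i) p)) \<and>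
        (\<forall>i\<le>m. \<forall>j\<le>m. d (u i) (u j) = \<bar>real i - real j\<bar>) \<and> u 0 \<in> A \<and> u m \<in> A \<longrightarrow>
        (\<forall>i\<le>m. \<exists>p\<in>A. d (u i) p \<le> real k + 1))"
      by (elim bexE exE) (rule that)
    from bad have u: "\<And>i. i \<le> m \<Longrightarrow> u i \<in> X" "\<And>i. i \<le> m \<Longrightarrow> \<exists>p. nearest_point d A (u i) p"
      and geo: "\<And>i j. i \<le> m \<Longrightarrow> j \<le> m \<Longrightarrow> d (u i) (u j) = \<bar>real i - real j\<bar>"
      and ends: "u 0 \<in> A" "u m \<in> A"
      and far: "\<not> (\<forall>i\<le>m. \<exists>p\<in>A. d (u i) p \<le> real k + 1)"
      unfolding not_imp by blast+
    from far obtain i0 where i0: "i0 \<le> m" "\<And>p. p \<in> A \<Longrightarrow> real k + 1 < d (u i0) p"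
      by (meson not_le)
    define \<pi> where "\<pi> i = (SOME p. nearest_point d A (u i) p)" for i
    have \<pi>: "nearest_point d A (u i) (\<pi> i)" if "i \<le> m" for i
      unfolding \<pi>_def using u(2)[OF that] by (rule someI_ex)
    define f where "f i = d (u i) (\<pi> i)" for i
    have fle: "f i \<le> d (u i) a" if "i \<le> m" "a \<in> A" for i a
      using \<pi> that by (auto simp: f_def nearest_point_def)
    have "Max (f ` {..m}) \<in> f ` {..m}" by (rule Max_in) auto
    then obtain i where i': "Max (f ` {..m}) = f i" "i \<in> {..m}" by (rule imageE)
    then have i: "i \<le> m" by simp
    have fmax: "f j \<le> f i" if "j \<le> m" for j unfolding i'(1)[symmetric] using that by simp
    have fi: "real k + 1 < f i"
      using fmax[OF i0(1)] i0(2)[of "\<pi> i0"] \<pi>[OF i0(1)] by (auto simp: f_def nearest_point_def)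
    \<comment> \<open>As \<open>f i\<close> is maximal, \<open>f\<close> at a point \<open>N\<close>
      steps away plus \<open>f i\<close> is at most \<open>2 * f i\<close>, below \<open>N\<close>.
      Being proportional to \<open>f i\<close>, the number \<open>N\<close> also survives the
      rescaling.\<close>
    define N where "N = nat \<lceil>3 * f i\<rceil>"
    have N: "3 * f i \<le> real N" "real N \<le> 3 * f i + 1"
      using fi unfolding N_def by linarith+
    have z0: "f 0 = 0" "f m = 0"
      using fle[of 0 "u 0"] fle[of m "u m"] ends geo[of 0 0] geo[of m m] X.nonneg
      by (auto simp: f_def order_antisym)
    have "f i \<le> real i" "f i \<le> real m - real i"
      using fle[OF i ends(1)] fle[OF i ends(2)] geo[OF i, of 0] geo[OF i, of m] i by auto
    \<comment> \<open>If the path ends too early, truncated subtraction gives \<open>a = 0\<close>,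
      and \<open>min\<close> gives \<open>b = m\<close>. There \<open>f\<close> vanishes, and the
      distance of \<open>u i\<close> from the end of the path is already at least
      \<open>f i\<close>.\<close>
    define a where "a = i - N"
    define b where "b = min m (i + N)"
    have ab: "a \<le> i" "i \<le> b" "b \<le> m" "a \<le> m" using i by (auto simp: a_def b_def)
    have "f a + f i \<le> real i - real a"
    proof (cases "i \<le> N")
      case True
      then show ?thesis using z0 \<open>f i \<le> real i\<close> by (simp add: a_def)
    next
      case False
      then have "real i - real a = real N" by (simp add: a_def of_nat_diff)
      then show ?thesis using fmax[OF ab(4)] N(1) fi by linarith
    qed
    moreover have "f b + f i \<le> real b - real i"
    proof (cases "m \<le> i + N")
      case True
      then show ?thesis using z0 \<open>f i \<le> real m - real i\<close> by (simp add: b_def)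
    next
      case False
      then have "real b - real i = real N" by (simp add: b_def)
      then show ?thesis using fmax[OF ab(3)] N(1) fi by linarith
    qed
    moreover have N': "real i - real a \<le> 3 * f i + 1" "real b - real i \<le> 3 * f i + 1"
      using N(2) i fi by (auto simp: a_def b_def of_nat_diff min_def)
    moreover have g: "d (u a) (u i) = real i - real a" "d (u i) (u b) = real b - real i"
        "d (u a) (u b) = real b - real a" "d (u i) (u a) = real i - real a"
      using geo[OF ab(4) i] geo[OF i ab(3)] geo[OF ab(4,3)] geo[OF i ab(4)] ab by linarith+
    ultimately have *: "d (u a) (u i) + d (u i) (u b) = d (u a) (u b)"
        "f a + f i \<le> d (u a) (u i)" "f b + f i \<le> d (u i) (u b)"
        "d (u i) (u a) \<le> 3 * f i + 1" "d (u i) (u b) \<le> 3 * f i + 1" "real k + 1 \<le> f i"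
      using fi by linarith+
    show ?thesis
      by (intro exI[of _ A] exI[of _ "u a"] exI[of _ "u b"] exI[of _ "u i"] exI[of _ "\<pi> a"]
          exI[of _ "\<pi> b"] exI[of _ "\<pi> i"] conjI A u(1) \<pi> i ab *[unfolded f_def])
  qed
  then obtain A x y z p q w where AP: "\<And>k::nat. A k \<in> \<P>"
    and X: "\<And>k. x k \<in> X" "\<And>k. y k \<in> X" "\<And>k. z k \<in> X"
    and near: "\<And>k. nearest_point d (A k) (x k) (p k)" "\<And>k. nearest_point d (A k) (y k) (q k)"
      "\<And>k. nearest_point d (A k) (z k) (w k)"
    and large: "\<And>k. real k + 1 \<le> d (z k) (w k)"
    and between: "\<And>k. d (x k) (z k) + d (z k) (y k) = d (x k) (y k)"
    and gap: "\<And>k. d (x k) (p k) + d (z k) (w k) \<le> d (x k) (z k)"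
      "\<And>k. d (y k) (q k) + d (z k) (w k) \<le> d (z k) (y k)"
    and upper: "\<And>k. d (z k) (x k) \<le> 3 * d (z k) (w k) + 1" "\<And>k. d (z k) (y k) \<le> 3 * d (z k) (w k) + 1"
    by metis
  define r where "r = (\<lambda>k. d (z k) (w k))"
  have r: "real k < r k" "1 \<le> r k" for k using large[of k] unfolding r_def by linarith+
  then obtain \<omega> where cone: "relatively_hyperbolic_cone X d \<P> \<omega> z r"
    using relatively_hyperbolic_cone_exists[where e = z and r = r, OF H X(3)] by blast
  interpret relatively_hyperbolic_cone X d \<P> \<omega> z r by (rule cone)
  interpret X: Metric_space X d by (rule metric)
  have sub: "A k \<subseteq> X" for k using hyperbolic_relativeD(2)[OF H AP] .
  have pq: "p k \<in> A k" "q k \<in> A k" "w k \<in> A k" "p k \<in> X" "q k \<in> X" "w k \<in> X" for k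
    using near[where k = k] sub unfolding nearest_point_def by blast+
  have up: "d (z k) (x k) \<le> 4 * r k" "d (z k) (y k) \<le> 4 * r k" for k
    using upper[of k] r(2)[of k] unfolding r_def by linarith+
  have bz: "z \<in> bounded_seqs" by (rule bounded_seqsI[where B = 0]) (use X in auto)
  have bw: "w \<in> bounded_seqs" by (rule bounded_seqsI[where B = 1]) (use pq in \<open>auto simp: r_def\<close>)
  have bx: "x \<in> bounded_seqs" by (rule bounded_seqsI[where B = 4]) (use X up in auto)
  have byy: "y \<in> bounded_seqs" by (rule bounded_seqsI[where B = 4]) (use X up in auto)
  have bp: "p \<in> bounded_seqs"
  proof (rule bounded_seqsI[where B = 8])
    show "d (z k) (p k) \<le> 8 * r k" for k
      using X.triangle[OF X(3,1) pq(4), of k k k] up(1)[of k] gap(1)[of k] X.nonneg[of "z k" "w k"]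
        X.commute[of "x k" "z k"] by linarith
  qed (use pq in auto)
  have bq: "q \<in> bounded_seqs"
  proof (rule bounded_seqsI[where B = 8])
    show "d (z k) (q k) \<le> 8 * r k" for k
      using X.triangle[OF X(3,2) pq(5), of k k k] up(2)[of k] gap(2)[of k] X.nonneg[of "z k" "w k"]
      by linarith
  qed (use pq in auto)
  have i: "index A \<in> pieces" by (rule index_in_pieces(1)[OF AP bp pq(1)])
  note np = nearest_point_cone[OF AP bx bp near(1)] and nq = nearest_point_cone[OF AP byy bq near(2)]
    and nw = nearest_point_cone[OF AP bz bw near(3)]
  have "cdist (point x) (point z) + cdist (point z) (point y) = cdist (point x) (point y)"
  proof (rule tendsto_unique[OF not_bot _ cdist_tendsto[OF bx byy]])
    show "((\<lambda>n. d (x n) (y n) / r n) \<longlongrightarrow> cdist (point x) (point z) + cdist (point z) (point y)) \<omega>"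
      using tendsto_add[OF cdist_tendsto[OF bx bz] cdist_tendsto[OF bz byy]]
      by (simp add: add_divide_distrib[symmetric] between)
  qed
  \<comment> \<open>The scale is \<open>d z w\<close> itself, so this gap has size 1 in the
    cone.\<close>
  moreover have "cdist (point x) (point p) + 1 \<le> cdist (point x) (point z)"
  proof (rule tendsto_le[OF not_bot cdist_tendsto[OF bx bz] tendsto_add[OF cdist_tendsto[OF bx bp] tendsto_const]])
    show "\<forall>\<^sub>F n in \<omega>. d (x n) (p n) / r n + 1 \<le> d (x n) (z n) / r n"
      using gap(1) scale_pos by (intro always_eventually allI) (simp add: field_simps r_def)
  qed
  moreover have "cdist (point y) (point q) + 1 \<le> cdist (point z) (point y)"
  proof (rule tendsto_le[OF not_bot cdist_tendsto[OF bz byy] tendsto_add[OF cdist_tendsto[OF byy bq] tendsto_const]])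
    show "\<forall>\<^sub>F n in \<omega>. d (y n) (q n) / r n + 1 \<le> d (z n) (y n) / r n"
      using gap(2) scale_pos by (intro always_eventually allI) (simp add: field_simps r_def)
  qed
  ultimately have "point z \<in> piece (index A)"
    using between_nearest_points[OF i point_in_cone[OF bx] point_in_cone[OF byy] point_in_cone[OF bz] np nq]
    by simp
  then have "cdist (point z) (point w) \<le> cdist (point z) (point z)"
    using nw by (simp add: nearest_point_def)
  moreover have "1 \<le> cdist (point z) (point w)" by (rule cdist_ge[OF bz bw]) (simp add: r_def)
  ultimately show False using point_in_cone[OF bz] by simp
qed

section \<open>Word metrics\<close>

locale word_metric = group G for G (structure) +
  fixes S
  assumes gens: "S \<subseteq> carrier G" and generates: "generate G S = carrier G"
begin

abbreviation "gens_sym \<equiv> S \<union> m_inv G ` S"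
abbreviation "len \<equiv> word_length G S"
abbreviation "wdist \<equiv> word_dist G S"

text \<open>The value of a word does not depend on \<open>S\<close>, so one word can be measured
  against two generating sets.\<close>

definition eval_word :: "'a list \<Rightarrow> 'a" where
  "eval_word ws = foldr (\<otimes>) ws \<one>"

lemma eval_word_simps [simp]: "eval_word [] = \<one>" "eval_word (w # ws) = w \<otimes> eval_word ws"
  by (simp_all add: eval_word_def)

lemma eval_word_closed [simp]: "set ws \<subseteq> carrier G \<Longrightarrow> eval_word ws \<in> carrier G"
  by (induction ws) auto

lemma eval_word_append:
  "set vs \<subseteq> carrier G \<Longrightarrow> set ws \<subseteq> carrier G \<Longrightarrow> eval_word (vs @ ws) = eval_word vs \<otimes> eval_word ws"
  by (induction vs) (auto simp: m_assoc)

lemma gens_sym_closed: "gens_sym \<subseteq> carrier G"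
  using gens by auto

lemma gens_sym_inv: "w \<in> gens_sym \<Longrightarrow> inv w \<in> gens_sym"
  using gens by (auto simp: image_iff)

lemma eval_word_rev:
  "set ws \<subseteq> carrier G \<Longrightarrow> eval_word (rev (map (m_inv G) ws)) = inv (eval_word ws)"
proof (induction ws)
  case (Cons w ws)
  then have "set (rev (map (m_inv G) ws)) \<subseteq> carrier G" by auto
  then show ?case using Cons by (simp add: eval_word_append inv_mult_group)
qed simp

lemma word_exists:
  assumes "x \<in> carrier G"
  shows "\<exists>ws. set ws \<subseteq> gens_sym \<and> eval_word ws = x"
proof -
  have "x \<in> generate G S" using assms generates by simp
  then show ?thesis
  proof (induction rule: generate.induct)
    case one
    show ?case by (rule exI[of _ "[]"]) simp
  next
    case (incl h)
    then show ?case using gens by (intro exI[of _ "[h]"]) auto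
  next
    case (inv h)
    then show ?case using gens by (intro exI[of _ "[inv h]"]) auto
  next
    case (eng h1 h2)
    then obtain vs ws where vw: "set vs \<subseteq> gens_sym" "eval_word vs = h1"
      "set ws \<subseteq> gens_sym" "eval_word ws = h2" by auto
    then show ?case
      using gens_sym_closed by (intro exI[of _ "vs @ ws"]) (simp add: eval_word_append subset_trans)
  qed
qed

lemma shortest_word:
  assumes "x \<in> carrier G"
  obtains ws where "length ws = len x" "set ws \<subseteq> gens_sym" "eval_word ws = x"
proof -
  have "\<exists>n. \<exists>ws. length ws = n \<and> set ws \<subseteq> gens_sym \<and> foldr (\<otimes>) ws \<one> = x"
    using word_exists[OF assms] by (auto simp: eval_word_def)
  from LeastI_ex[OF this] show thesis
    using that unfolding word_length_def eval_word_def by blast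
qed

lemma len_le: "set ws \<subseteq> gens_sym \<Longrightarrow> len (eval_word ws) \<le> length ws"
  unfolding word_length_def eval_word_def by (rule Least_le) blast

lemma len_one [simp]: "len \<one> = 0"
  using len_le[of "[]"] by simp

lemma len_zero_imp: "x \<in> carrier G \<Longrightarrow> len x = 0 \<Longrightarrow> x = \<one>"
  by (metis eval_word_simps(1) length_0_conv shortest_word)

lemma len_mult: 
  assumes "x \<in> carrier G" "y \<in> carrier G"
  shows "len (x \<otimes> y) \<le> len x + len y"
proof -
  obtain vs where vs: "length vs = len x" "set vs \<subseteq> gens_sym" "eval_word vs = x"
    by (rule shortest_word[OF assms(1)])
  obtain ws where ws: "length ws = len y" "set ws \<subseteq> gens_sym" "eval_word ws = y"
    by (rule shortest_word[OF assms(2)])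
  have "x \<otimes> y = eval_word (vs @ ws)"
    using vs ws gens_sym_closed by (simp add: eval_word_append subset_trans)
  then show ?thesis using len_le[of "vs @ ws"] vs ws by simp
qed

lemma len_inv [simp]:
  assumes "x \<in> carrier G"
  shows "len (inv x) = len x"
proof -
  have *: "len (inv y) \<le> len y" if y: "y \<in> carrier G" for y
  proof -
    obtain ws where ws: "length ws = len y" "set ws \<subseteq> gens_sym" "eval_word ws = y"
      by (rule shortest_word[OF y])
    have "eval_word (rev (map (m_inv G) ws)) = inv y"
      using eval_word_rev[of ws] ws gens_sym_closed by (metis subset_trans)
    moreover have "set (rev (map (m_inv G) ws)) \<subseteq> gens_sym" using ws(2) gens_sym_inv by auto
    ultimately show ?thesis using len_le ws(1) by (metis length_map length_rev)
  qed
  show ?thesis using *[of x] *[of "inv x"] assms by simp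
qed

lemma wdist_nonneg [simp]: "0 \<le> wdist x y"
  by (simp add: word_dist_def)

lemma wdist_self [simp]: "x \<in> carrier G \<Longrightarrow> wdist x x = 0"
  by (simp add: word_dist_def)

lemma wdist_commute: "x \<in> carrier G \<Longrightarrow> y \<in> carrier G \<Longrightarrow> wdist x y = wdist y x"
  using len_inv[of "inv x \<otimes> y"] by (simp add: word_dist_def inv_mult_group)

lemma wdist_triangle:
  assumes "x \<in> carrier G" "y \<in> carrier G" "z \<in> carrier G"
  shows "wdist x z \<le> wdist x y + wdist y z"
proof -
  have "inv x \<otimes> z = (inv x \<otimes> y) \<otimes> (inv y \<otimes> z)"
    using assms by (metis inv_closed inv_solve_left' m_assoc m_closed)
  then show ?thesis
    using len_mult[of "inv x \<otimes> y" "inv y \<otimes> z"] assms by (simp add: word_dist_def)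
qed

lemma wdist_translate:
  assumes "g \<in> carrier G" "x \<in> carrier G" "y \<in> carrier G"
  shows "wdist (g \<otimes> x) (g \<otimes> y) = wdist x y"
proof -
  have "inv (g \<otimes> x) \<otimes> (g \<otimes> y) = inv x \<otimes> y"
    using assms by (simp add: inv_mult_group m_assoc) (metis inv_closed l_inv l_one m_assoc)
  then show ?thesis by (simp add: word_dist_def)
qed

lemma wdist_one: "x \<in> carrier G \<Longrightarrow> wdist \<one> x = real (len x)"
  by (simp add: word_dist_def)

text \<open>The prefixes of a shortest word. The subword between two prefixes bounds their distance
  from above; a smaller distance would bring \<open>x\<close> closer to \<open>\<one>\<close> than
  its length allows. Past the end of the word the prefixes are constant, so membership in the group
  holds for all \<open>i\<close>.\<close>

lemma geodesic_word:
  assumes x: "x \<in> carrier G"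
  obtains u where "u 0 = \<one>" "u (len x) = x" "\<And>i. u i \<in> carrier G"
    "\<And>i j. i \<le> len x \<Longrightarrow> j \<le> len x \<Longrightarrow> wdist (u i) (u j) = \<bar>real i - real j\<bar>"
proof -
  obtain ws where ws: "length ws = len x" "set ws \<subseteq> gens_sym" "eval_word ws = x"
    by (rule shortest_word[OF x])
  define u where "u i = eval_word (take i ws)" for i
  have part: "set (take i ws) \<subseteq> gens_sym" "set (drop i ws) \<subseteq> gens_sym"
      "set (take i (drop j ws)) \<subseteq> gens_sym" for i j
    using ws(2) set_take_subset set_drop_subset by (meson subset_trans)+
  note part' = part[THEN subset_trans, OF gens_sym_closed]
  have uc: "u i \<in> carrier G" for i using part'(1) by (simp add: u_def)
  have le: "wdist (u i) (u j) \<le> real j - real i" if "i \<le> j" "j \<le> len x" for i j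
  proof -
    have "take j ws = take i ws @ take (j - i) (drop i ws)"
      using that by (metis le_add_diff_inverse take_add)
    then have "u j = u i \<otimes> eval_word (take (j - i) (drop i ws))"
      using part' by (simp add: u_def eval_word_append)
    then have "inv (u i) \<otimes> u j = eval_word (take (j - i) (drop i ws))"
      using uc part'(3) by (metis eval_word_closed inv_closed inv_solve_left m_closed)
    then have "len (inv (u i) \<otimes> u j) \<le> j - i"
      using len_le[OF part(3)[of "j - i" i]] that ws(1) by simp
    then show ?thesis using that by (simp add: word_dist_def of_nat_diff)
  qed
  have u: "u 0 = \<one>" "u (len x) = x" using ws by (simp_all add: u_def)
  have eq: "wdist (u i) (u j) = real j - real i" if "i \<le> j" "j \<le> len x" for i j
  proof (rule antisym[OF le[OF that]])
    have "real (len x) = wdist (u 0) (u (len x))" using u x by (simp add: wdist_one)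
    also have "\<dots> \<le> wdist (u 0) (u i) + wdist (u i) (u j) + wdist (u j) (u (len x))"
      using wdist_triangle[OF uc uc uc, of 0 "len x" i] wdist_triangle[OF uc uc uc, of i "len x" j] by linarith
    also have "\<dots> \<le> real i + wdist (u i) (u j) + (real (len x) - real j)"
      using le[of 0 i] le[of j "len x"] that by simp
    finally show "real j - real i \<le> wdist (u i) (u j)" by simp
  qed
  show thesis
  proof (rule that[OF u uc])
    fix i j assume ij: "i \<le> len x" "j \<le> len x"
    show "wdist (u i) (u j) = \<bar>real i - real j\<bar>"
    proof (cases "i \<le> j")
      case True then show ?thesis using eq[of i j] ij by simp
    next
      case False then show ?thesis using eq[of j i] ij wdist_commute[OF uc uc, of i j] by simp
    qed
  qed
qed

lemma finite_len_ball:
  assumes "finite S"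
  shows "finite {x \<in> carrier G. len x \<le> n}"
proof -
  have "finite {ws. set ws \<subseteq> gens_sym \<and> length ws \<le> n}"
    using assms by (intro finite_lists_length_le) auto
  moreover have "{x \<in> carrier G. len x \<le> n} \<subseteq> eval_word ` {ws. set ws \<subseteq> gens_sym \<and> length ws \<le> n}"
  proof
    fix x assume "x \<in> {x \<in> carrier G. len x \<le> n}"
    then show "x \<in> eval_word ` {ws. set ws \<subseteq> gens_sym \<and> length ws \<le> n}"
      using shortest_word[of x] by (auto simp: image_iff) metis
  qed
  ultimately show ?thesis using finite_surj by blast
qed

lemma len_eval_word_le:
  assumes "set ws \<subseteq> carrier G" "\<And>w. w \<in> set ws \<Longrightarrow> real (len w) \<le> A"
  shows "real (len (eval_word ws)) \<le> A * real (length ws)"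
  using assms
proof (induction ws)
  case (Cons w ws)
  have "len (w \<otimes> eval_word ws) \<le> len w + len (eval_word ws)" using Cons by (intro len_mult) auto
  moreover have "real (len (eval_word ws)) \<le> A * real (length ws)" "real (len w) \<le> A"
    using Cons by auto
  ultimately show ?case by (simp add: algebra_simps)
qed simp

text \<open>Lengths are natural numbers, so the minimum is attained. As \<open>x\<close> is
  arbitrary, projections can later be used without side conditions.\<close>

lemma nearest_point_exists:
  assumes "C \<noteq> {}"
  shows "\<exists>p. nearest_point wdist C x p"
proof -
  obtain c where "c \<in> C" using assms by blast
  then obtain p where "p \<in> C" "\<forall>z. z \<in> C \<longrightarrow> len (inv x \<otimes> p) \<le> len (inv x \<otimes> z)"
    using ex_has_least_nat[of "\<lambda>p. p \<in> C" c "\<lambda>p. len (inv x \<otimes> p)"] by metis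
  then show ?thesis by (auto simp: nearest_point_def word_dist_def)
qed

lemma nearest_point_translate:
  assumes "nearest_point wdist C x p" "C \<subseteq> carrier G" "x \<in> carrier G" "a \<in> carrier G"
  shows "nearest_point wdist (a <# C) (a \<otimes> x) (a \<otimes> p)"
  unfolding nearest_point_def
proof (intro conjI ballI)
  have p: "p \<in> C" "\<And>z. z \<in> C \<Longrightarrow> wdist x p \<le> wdist x z"
    using assms(1) by (simp_all add: nearest_point_def)
  then show "a \<otimes> p \<in> a <# C" by (auto simp: l_coset_def)
  fix z assume "z \<in> a <# C"
  then obtain c where "c \<in> C" "z = a \<otimes> c" by (auto simp: l_coset_def)
  then show "wdist (a \<otimes> x) (a \<otimes> p) \<le> wdist (a \<otimes> x) z"
    using p assms by (simp add: wdist_translate subset_iff)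
qed

end

text \<open>Each letter of an \<open>S\<close>-word is replaced by a \<open>Y\<close>-word. The sum
  over the finitely many letters stands in for a maximum.\<close>

lemma word_metric_compare:
  assumes S: "word_metric G S" "finite S" and Y: "word_metric G Y"
  obtains \<kappa> where "\<kappa> \<ge> 1"
    "\<And>x y. x \<in> carrier G \<Longrightarrow> y \<in> carrier G \<Longrightarrow> word_dist G Y x y \<le> \<kappa> * word_dist G S x y"
proof -
  interpret S: word_metric G S by fact
  interpret Y: word_metric G Y by fact
  define \<kappa> where "\<kappa> = 1 + (\<Sum>w\<in>S.gens_sym. real (Y.len w))"
  have fin: "finite S.gens_sym" using S(2) by simp
  have *: "real (Y.len w) \<le> \<kappa>" if "w \<in> S.gens_sym" for w
    using member_le_sum[OF that _ fin, of "\<lambda>w. real (Y.len w)"] by (simp add: \<kappa>_def)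
  have len: "real (Y.len x) \<le> \<kappa> * real (S.len x)" if x: "x \<in> carrier G" for x
  proof -
    obtain ws where ws: "length ws = S.len x" "set ws \<subseteq> S.gens_sym" "S.eval_word ws = x"
      by (rule S.shortest_word[OF x])
    have "S.eval_word ws = Y.eval_word ws" by (simp add: S.eval_word_def Y.eval_word_def)
    then show ?thesis
      using Y.len_eval_word_le[of ws \<kappa>] ws * S.gens_sym_closed by auto
  qed
  show thesis
  proof (rule that)
    show "\<kappa> \<ge> 1" by (simp add: \<kappa>_def sum_nonneg)
    show "word_dist G Y x y \<le> \<kappa> * word_dist G S x y" if "x \<in> carrier G" "y \<in> carrier G" for x y
      using len[of "inv\<^bsub>G\<^esub> x \<otimes>\<^bsub>G\<^esub> y"] that by (simp add: word_dist_def)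
  qed
qed

section \<open>Vertices of Cayley graphs\<close>

lemma supp_vertex [simp]: "supp (vertex u) = {u}"
  by (auto simp: supp_def vertex_def)

lemma inj_vertex: "inj vertex"
  by (metis injI singleton_inject supp_vertex)

lemma vertex_in_cayley_graph: "u \<in> carrier G \<Longrightarrow> vertex u \<in> cayley_graph G Y"
  unfolding cayley_graph_def cayley_cells_def by (auto simp: vertex_def supp_def)

text \<open>Distinct vertices in a common cell are the ends of an edge, and half the l1-distance of
  their indicator functions is 1, as is their word distance. Otherwise the minimum runs over a
  single pair.\<close>

lemma (in word_metric) cayley_dist_vertex:
  assumes u: "u \<in> carrier G" and v: "v \<in> carrier G"
  shows "cayley_dist G S (vertex u) (vertex v) = wdist u v"
proof (cases "\<exists>c\<in>cayley_cells G S. supp (vertex u) \<union> supp (vertex v) \<subseteq> c")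
  case cell: True
  show ?thesis
  proof (cases "u = v")
    case True
    then show ?thesis using cell u by (simp add: cayley_dist_def vertex_in_cayley_graph)
  next
    case False
    from cell obtain c where c: "c \<in> cayley_cells G S" "u \<in> c" "v \<in> c" by auto
    then obtain w y where wy: "w \<in> carrier G" "y \<in> S" "c = {w, w \<otimes> y}"
      using False unfolding cayley_cells_def by blast
    have y: "y \<in> carrier G" using wy gens by auto
    have "len y \<le> 1" using len_le[of "[y]"] wy y by simp
    have "v = u \<otimes> y \<or> u = v \<otimes> y" using c wy False by auto
    then have "wdist u v \<le> 1"
    proof
      assume "v = u \<otimes> y"
      then have "inv u \<otimes> v = y" using u y by (metis inv_closed l_inv l_one m_assoc)
      then show ?thesis using \<open>len y \<le> 1\<close> by (simp add: word_dist_def)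
    next
      assume "u = v \<otimes> y"
      then have "inv v \<otimes> u = y" using v y by (metis inv_closed l_inv l_one m_assoc)
      then show ?thesis using \<open>len y \<le> 1\<close> wdist_commute[OF u v] by (simp add: word_dist_def)
    qed
    moreover have "wdist u v \<noteq> 0"
    proof
      assume "wdist u v = 0"
      then have "inv u \<otimes> v = \<one>" using len_zero_imp u v by (simp add: word_dist_def)
      then show False using False u v by (metis inv_closed inv_equality inv_inv)
    qed
    ultimately have "wdist u v = 1" by (simp add: word_dist_def)
    moreover have "(\<Sum>w\<in>{u, v}. \<bar>vertex u w - vertex v w\<bar>) = 2"
      using False by (simp add: vertex_def)
    ultimately show ?thesis
      using cell u v unfolding cayley_dist_def by (simp add: vertex_in_cayley_graph insert_commute)
  qed
next
  case False
  have "cayley_dist G S (vertex u) (vertex v) =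
      Min {(1 - vertex u a) + wdist a b + (1 - vertex v b) | a b. a \<in> {u} \<and> b \<in> {v}}"
    using u v unfolding cayley_dist_def if_not_P[OF False] by (simp add: vertex_in_cayley_graph)
  also have "{(1 - vertex u a) + wdist a b + (1 - vertex v b) | a b. a \<in> {u} \<and> b \<in> {v}} = {wdist u v}"
    by (auto simp: vertex_def)
  finally show ?thesis by simp
qed

section \<open>Infinite order elements of virtually cyclic subgroups\<close>

text \<open>Let \<open>a\<close> generate a cyclic subgroup of finite index in \<open>E\<close>. Two
  powers of \<open>g\<close> lie in one coset of it, so \<open>g [^] m = a [^] l\<close> with
  \<open>m > 0\<close>, and \<open>l \<noteq> 0\<close> as \<open>g\<close> has infinite order.
  Division by \<open>l\<close> trades powers of \<open>a\<close> for powers of \<open>g\<close> up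
  to a remainder.\<close>

lemma (in group) virtually_cyclic_transversal:
  assumes E: "subgroup E G" and vc: "virtually_cyclic (G\<lparr>carrier := E\<rparr>)"
    and g: "g \<in> E" "ord g = 0"
  shows "\<exists>F. finite F \<and> F \<subseteq> E \<and> (\<forall>x\<in>E. \<exists>k::int. \<exists>f\<in>F. x = g [^] k \<otimes> f)"
proof -
  interpret E: subgroup E G by fact
  have gc: "g \<in> carrier G" using g(1) by simp
  obtain a where a: "a \<in> E" and fin: "finite (rcosets\<^bsub>G\<lparr>carrier := E\<rparr>\<^esub> (generate (G\<lparr>carrier := E\<rparr>) {a}))"
    using vc unfolding virtually_cyclic_def by auto
  have ac: "a \<in> carrier G" using a by simp
  define H where "H = {a [^] (k::int) | k. True}"
  have H: "generate (G\<lparr>carrier := E\<rparr>) {a} = H"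
    using generate_consistent[OF _ E, of "{a}"] a generate_pow[OF ac] by (simp add: H_def)
  define c where "c x = (\<Union>h\<in>H. {h \<otimes> x})" for x
  have finc: "finite (c ` E)"
  proof -
    have "rcosets\<^bsub>G\<lparr>carrier := E\<rparr>\<^esub> H = c ` E"
      unfolding RCOSETS_def r_coset_def c_def by auto
    then show ?thesis using fin H by simp
  qed
  have in_c: "x \<in> c y \<longleftrightarrow> (\<exists>k::int. x = a [^] k \<otimes> y)" for x y
    unfolding c_def H_def by auto
  have self: "x \<in> c x" if "x \<in> E" for x
    unfolding in_c using that by (intro exI[of _ "0::int"]) simp
  have gpow: "g [^] (i::int) \<in> E" "a [^] i \<in> E" for i
    using E.subgroup_axioms a g(1) by (meson subgroup_int_pow_closed E)+
  have "\<not> inj (\<lambda>i::nat. c (g [^] int i))"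
  proof
    assume "inj (\<lambda>i::nat. c (g [^] int i))"
    moreover have "range (\<lambda>i::nat. c (g [^] int i)) \<subseteq> c ` E" using gpow by auto
    ultimately show False using finc finite_imageD finite_subset infinite_UNIV_nat by blast
  qed
  then obtain i j :: nat where "i < j" "c (g [^] int i) = c (g [^] int j)"
    unfolding inj_def by (metis linorder_neqE_nat)
  then obtain l :: int where l: "g [^] int j = a [^] l \<otimes> g [^] int i"
    using self[OF gpow(1), of "int j"] in_c by blast
  define m where "m = int j - int i"
  have m: "m > 0" using \<open>i < j\<close> by (simp add: m_def)
  have gm: "g [^] m = a [^] l"
    unfolding m_def int_pow_diff[OF gc] l using ac gc by (simp add: m_assoc)
  have l0: "l \<noteq> 0"
  proof
    assume "l = 0"
    then have "g [^] m = \<one>" using gm by simp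
    then show False using int_pow_eq_id[OF gc, of m] g(2) m by simp
  qed
  obtain X where X: "X \<subseteq> E" "finite X" "c ` E = c ` X"
    using finite_subset_image[OF finc order_refl] by blast
  \<comment> \<open>The remainder \<open>k mod l\<close> has the sign of \<open>l\<close>, which may
    be negative; hence the symmetric interval.\<close>
  define F where "F = (\<lambda>(r::int, x). a [^] r \<otimes> x) ` ({-\<bar>l\<bar>..\<bar>l\<bar>} \<times> X)"
  show ?thesis
  proof (intro exI[of _ F] conjI ballI)
    show "finite F" using X(2) by (simp add: F_def)
    show "F \<subseteq> E" using X(1) gpow by (auto simp: F_def)
    fix x assume x: "x \<in> E"
    then obtain x' where x': "x' \<in> X" "c x = c x'" using X(3) by blast
    then obtain k :: int where k: "x = a [^] k \<otimes> x'" using self[OF x] in_c by blast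
    have x'c: "x' \<in> carrier G" using x'(1) X(1) by auto
    have "k = l * (k div l) + k mod l" by simp
    then have "a [^] k = (a [^] l) [^] (k div l) \<otimes> a [^] (k mod l)"
      using int_pow_mult[OF ac] int_pow_pow[OF ac] by metis
    also have "(a [^] l) [^] (k div l) = g [^] (m * (k div l))"
      using gm int_pow_pow[OF gc] by metis
    finally have "x = g [^] (m * (k div l)) \<otimes> (a [^] (k mod l) \<otimes> x')"
      using k ac gc x'c by (simp add: m_assoc)
    moreover have "\<bar>k mod l\<bar> \<le> \<bar>l\<bar>" using l0 abs_mod_less[of l k] by simp
    then have "a [^] (k mod l) \<otimes> x' \<in> F" using x'(1) by (force simp: F_def)
    ultimately show "\<exists>k::int. \<exists>f\<in>F. x = g [^] k \<otimes> f" by blast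
  qed
qed

section \<open>Hyperbolically embedded subgroups\<close>

locale hyperbolically_embedded_subgroup = group G for G (structure) +
  fixes Y E
  assumes embedded: "hyperbolically_embedded_wrt G Y {E}"
begin

lemma embeddedD:
  shows "subgroup E G" "Y \<subseteq> carrier G" "generate G Y = carrier G"
    "hyperbolic_relative (cayley_graph G Y) (cayley_dist G Y) {vertex ` (x <# E) | x. x \<in> carrier G}"
    "\<And>x R. x \<in> E \<Longrightarrow> finite {h \<in> E. cayley_dist G Y (vertex x) (vertex h) \<le> R}"
  using embedded unfolding hyperbolically_embedded_wrt_def by simp_all

end

sublocale hyperbolically_embedded_subgroup \<subseteq> Y: word_metric G Y
  by unfold_locales (rule embeddedD)+

sublocale hyperbolically_embedded_subgroup \<subseteq> E: subgroup E G
  by (rule embeddedD)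

section \<open>Projection to \<open>E\<close>, quasi-convexity and distortion\<close>

context hyperbolically_embedded_subgroup
begin

abbreviation "d \<equiv> word_dist G Y"

definition \<pi> :: "'a \<Rightarrow> 'a" where
  "\<pi> x = (SOME p. nearest_point d E x p)"

lemma proj_nearest: "nearest_point d E x (\<pi> x)"
  unfolding \<pi>_def by (rule someI_ex[OF Y.nearest_point_exists]) (use E.one_closed in blast)

lemma proj_in: "\<pi> x \<in> E"
  using proj_nearest by (simp add: nearest_point_def)

lemma proj_le: "h \<in> E \<Longrightarrow> d x (\<pi> x) \<le> d x h"
  using proj_nearest by (simp add: nearest_point_def)

lemma coset_subset: "a \<in> carrier G \<Longrightarrow> a <# E \<subseteq> carrier G"
  by (auto simp: l_coset_def)

lemma one_coset: "\<one> <# E = E"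
  by (auto simp: l_coset_def)

text \<open>The pieces consist of vertices only, so interior points of edges never compete for being
  nearest.\<close>

lemma nearest_point_vertex:
  assumes "C \<subseteq> carrier G" "x \<in> carrier G" "nearest_point d C x p"
  shows "nearest_point (cayley_dist G Y) (vertex ` C) (vertex x) (vertex p)"
  using assms by (auto simp: nearest_point_def Y.cayley_dist_vertex subset_iff)

lemma finite_cosets_with_large_projection:
  fixes \<epsilon> :: real
  assumes "\<epsilon> > 0"
  shows "\<exists>N. \<forall>n\<ge>N. \<forall>x\<in>carrier G. \<forall>y\<in>carrier G. d x y \<le> n \<longrightarrow>
    finite {C. (\<exists>a\<in>carrier G. C = a <# E) \<and>
      (\<exists>p q. nearest_point d C x p \<and> nearest_point d C y q \<and> d x p \<le> 2 * n \<and> \<epsilon> * n \<le> d p q)}"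
proof -
  let ?\<P> = "{vertex ` (x <# E) | x. x \<in> carrier G}"
  let ?D = "cayley_dist G Y"
  from finite_pieces_with_large_projection[OF embeddedD(4) assms]
  obtain N where N: "\<And>n x y. n \<ge> N \<Longrightarrow> x \<in> cayley_graph G Y \<Longrightarrow> y \<in> cayley_graph G Y \<Longrightarrow>
      ?D x y \<le> n \<Longrightarrow> finite {A\<in>?\<P>. \<exists>p q. nearest_point ?D A x p \<and> nearest_point ?D A y q \<and>
        ?D x p \<le> 2 * n \<and> \<epsilon> * n \<le> ?D p q}"
    by blast
  show ?thesis
  proof (intro exI[of _ N] allI impI ballI)
    fix n x y assume n: "n \<ge> N" and x: "x \<in> carrier G" and y: "y \<in> carrier G" and "d x y \<le> n"
    let ?A = "{C. (\<exists>a\<in>carrier G. C = a <# E) \<and>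
      (\<exists>p q. nearest_point d C x p \<and> nearest_point d C y q \<and> d x p \<le> 2 * n \<and> \<epsilon> * n \<le> d p q)}"
    let ?B = "{A\<in>?\<P>. \<exists>p q. nearest_point ?D A (vertex x) p \<and> nearest_point ?D A (vertex y) q \<and>
        ?D (vertex x) p \<le> 2 * n \<and> \<epsilon> * n \<le> ?D p q}"
    have fin: "finite ?B"
      using N[OF n vertex_in_cayley_graph[OF x] vertex_in_cayley_graph[OF y]] \<open>d x y \<le> n\<close>
      by (simp add: Y.cayley_dist_vertex x y)
    have sub: "image vertex ` ?A \<subseteq> ?B"
    proof
      fix A assume "A \<in> image vertex ` ?A"
      then obtain a p q where A: "A = vertex ` (a <# E)" and a: "a \<in> carrier G"
        and near: "nearest_point d (a <# E) x p" "nearest_point d (a <# E) y q"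
        and le: "d x p \<le> 2 * n" "\<epsilon> * n \<le> d p q" by blast
      note sub = coset_subset[OF a]
      have "p \<in> carrier G" "q \<in> carrier G"
        using near sub unfolding nearest_point_def by blast+
      then have "?D (vertex x) (vertex p) \<le> 2 * n" "\<epsilon> * n \<le> ?D (vertex p) (vertex q)"
        using le x by (simp_all add: Y.cayley_dist_vertex)
      then show "A \<in> ?B"
        unfolding A using a nearest_point_vertex[OF sub x near(1)] nearest_point_vertex[OF sub y near(2)]
        by blast
    qed
    have "inj_on (image vertex) ?A"
      by (rule inj_onI, erule iffD1[OF inj_image_eq_iff[OF inj_vertex]])
    then show "finite ?A" by (rule inj_on_finite[OF _ sub fin])
  qed
qed

lemma projection_sublinear_far:
  fixes \<epsilon> :: real
  assumes "\<epsilon> > 0"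
  shows "\<exists>N. \<forall>x\<in>carrier G. \<forall>y\<in>carrier G. N \<le> d x (\<pi> x) \<and> d x y \<le> d x (\<pi> x) / 2 \<longrightarrow>
    d (\<pi> x) (\<pi> y) \<le> \<epsilon> * d x (\<pi> x)"
proof -
  let ?\<P> = "{vertex ` (x <# E) | x. x \<in> carrier G}"
  let ?D = "cayley_dist G Y"
  from projection_sublinear_far_away[OF embeddedD(4) assms]
  obtain N where N: "\<And>A x y p q. A \<in> ?\<P> \<Longrightarrow> x \<in> cayley_graph G Y \<Longrightarrow> y \<in> cayley_graph G Y \<Longrightarrow>
      nearest_point ?D A x p \<Longrightarrow> nearest_point ?D A y q \<Longrightarrow> N \<le> ?D x p \<Longrightarrow> ?D x y \<le> ?D x p / 2 \<Longrightarrow>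
      ?D p q \<le> \<epsilon> * ?D x p"
    by blast
  have E: "vertex ` E \<in> ?\<P>" using one_coset one_closed by (metis (mono_tags, lifting) mem_Collect_eq)
  show ?thesis
  proof (intro exI[of _ N] ballI impI)
    fix x y assume x: "x \<in> carrier G" and y: "y \<in> carrier G"
      and "N \<le> d x (\<pi> x) \<and> d x y \<le> d x (\<pi> x) / 2"
    moreover have "\<pi> x \<in> carrier G" "\<pi> y \<in> carrier G" using proj_in by auto
    ultimately show "d (\<pi> x) (\<pi> y) \<le> \<epsilon> * d x (\<pi> x)"
      using N[OF E vertex_in_cayley_graph[OF x] vertex_in_cayley_graph[OF y]
          nearest_point_vertex[OF E.subset x proj_nearest] nearest_point_vertex[OF E.subset y proj_nearest]]
      by (simp add: Y.cayley_dist_vertex)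
  qed
qed

lemma geodesics_near_subgroup:
  "\<exists>K\<ge>0. \<forall>u m. (\<forall>i. u i \<in> carrier G) \<and> (\<forall>i\<le>m. \<forall>j\<le>m. d (u i) (u j) = \<bar>real i - real j\<bar>) \<and>
    u 0 \<in> E \<and> u m \<in> E \<longrightarrow> (\<forall>i\<le>m. \<exists>p\<in>E. d (u i) p \<le> K)"
proof -
  let ?\<P> = "{vertex ` (x <# E) | x. x \<in> carrier G}"
  let ?D = "cayley_dist G Y"
  have E: "vertex ` E \<in> ?\<P>" using one_coset one_closed by (metis (mono_tags, lifting) mem_Collect_eq)
  from discrete_geodesics_near_piece[OF embeddedD(4)]
  obtain K where K': "\<forall>A\<in>?\<P>. \<forall>u (m::nat). (\<forall>i\<le>m. u i \<in> cayley_graph G Y \<and> (\<exists>p. nearest_point ?D A (u i) p)) \<and>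
    (\<forall>i\<le>m. \<forall>j\<le>m. ?D (u i) (u j) = \<bar>real i - real j\<bar>) \<and> u 0 \<in> A \<and> u m \<in> A \<longrightarrow>
    (\<forall>i\<le>m. \<exists>p\<in>A. ?D (u i) p \<le> K)"
    by (rule exE)
  have K: "(\<forall>i\<le>m. \<exists>p\<in>vertex ` E. ?D (u i) p \<le> K)"
    if "(\<forall>i\<le>m. u i \<in> cayley_graph G Y \<and> (\<exists>p. nearest_point ?D (vertex ` E) (u i) p)) \<and>
    (\<forall>i\<le>m. \<forall>j\<le>m. ?D (u i) (u j) = \<bar>real i - real j\<bar>) \<and> u 0 \<in> vertex ` E \<and> u m \<in> vertex ` E" for u and m :: nat
    using bspec[OF K' E, THEN spec, THEN spec, THEN mp, OF that] .
  show ?thesis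
  proof (intro exI[of _ "max 0 K"] conjI allI impI)
    show "0 \<le> max 0 K" by simp
    fix u :: "nat \<Rightarrow> 'a" and m i :: nat
    assume *: "(\<forall>i. u i \<in> carrier G) \<and> (\<forall>i\<le>m. \<forall>j\<le>m. d (u i) (u j) = \<bar>real i - real j\<bar>) \<and>
      u 0 \<in> E \<and> u m \<in> E" and i: "i \<le> m"
    then have uc: "u i \<in> carrier G" for i by blast
    have "\<exists>p. nearest_point ?D (vertex ` E) (vertex (u i)) p" for i
      using nearest_point_vertex[OF E.subset uc proj_nearest] by blast
    then have "\<forall>i\<le>m. \<exists>p\<in>vertex ` E. ?D (vertex (u i)) p \<le> K"
      using * by (intro K) (simp add: vertex_in_cayley_graph Y.cayley_dist_vertex uc)
    then obtain p where "p \<in> E" "?D (vertex (u i)) (vertex p) \<le> K" using i by blast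
    then show "\<exists>p\<in>E. d (u i) p \<le> max 0 K"
      using Y.cayley_dist_vertex[OF uc, of p i] by (intro bexI[of _ p]) simp_all
  qed
qed

text \<open>The standard argument for quasi-convex subgroups: each vertex of a geodesic from
  \<open>\<one>\<close> to \<open>x\<close> is replaced by a point of \<open>E\<close> within
  \<open>K\<close>. Consecutive quotients lie in \<open>E\<close> and have \<open>d\<close>-length
  at most \<open>2 * K + 1\<close>, and properness leaves finitely many of those. Since the word
  length equals \<open>Y.len x\<close>, any length function on \<open>E\<close> that is bounded on
  \<open>B\<close> and subadditive is linearly controlled by \<open>d\<close>.\<close>

lemma subgroup_words:
  "\<exists>B. finite B \<and> B \<subseteq> E \<and> (\<forall>x\<in>E. \<exists>ws. set ws \<subseteq> B \<and> length ws = Y.len x \<and> Y.eval_word ws = x)"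
proof -
  obtain K where K0: "K \<ge> 0" and K: "\<And>u m. (\<forall>i. u i \<in> carrier G) \<and>
      (\<forall>i\<le>m. \<forall>j\<le>m. d (u i) (u j) = \<bar>real i - real j\<bar>) \<and> u 0 \<in> E \<and> u m \<in> E \<Longrightarrow>
      (\<forall>i\<le>m. \<exists>p\<in>E. d (u i) p \<le> K)"
    using geodesics_near_subgroup by blast
  define B where "B = {h \<in> E. d \<one> h \<le> 2 * K + 1}"
  have "B \<subseteq> {h \<in> E. cayley_dist G Y (vertex \<one>) (vertex h) \<le> 2 * K + 1}"
    by (auto simp: B_def Y.cayley_dist_vertex)
  then have "finite B" using embeddedD(5)[OF E.one_closed] finite_subset by blast
  moreover have "\<exists>ws. set ws \<subseteq> B \<and> length ws = Y.len x \<and> Y.eval_word ws = x" if x: "x \<in> E" for x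
  proof -
    have xc: "x \<in> carrier G" using x by simp
    obtain u where u: "u 0 = \<one>" "u (Y.len x) = x" "\<And>i. u i \<in> carrier G"
      "\<And>i j. i \<le> Y.len x \<Longrightarrow> j \<le> Y.len x \<Longrightarrow> d (u i) (u j) = \<bar>real i - real j\<bar>"
      by (rule Y.geodesic_word[OF xc]) blast
    define m where "m = Y.len x"
    have ex: "\<exists>p\<in>E. d (u i) p \<le> K" if "i \<le> m" for i
      using K[of u m] u x that E.one_closed by (simp add: m_def)
    \<comment> \<open>Points already in \<open>E\<close> are kept, so the replaced path still runs
      exactly from \<open>\<one>\<close> to \<open>x\<close>.\<close>
    define e where "e i = (if u i \<in> E then u i else (SOME p. p \<in> E \<and> d (u i) p \<le> K))" for i
    have e: "e i \<in> E" "d (u i) (e i) \<le> K" if "i \<le> m" for i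
    proof -
      have "(SOME p. p \<in> E \<and> d (u i) p \<le> K) \<in> E \<and> d (u i) (SOME p. p \<in> E \<and> d (u i) p \<le> K) \<le> K"
        using someI_ex[of "\<lambda>p. p \<in> E \<and> d (u i) p \<le> K"] ex[OF that] by blast
      then show "e i \<in> E" "d (u i) (e i) \<le> K" using K0 u(3) by (auto simp: e_def)
    qed
    have e0: "e 0 = \<one>" "e m = x" using u x E.one_closed by (auto simp: e_def m_def)
    have "\<exists>ws. set ws \<subseteq> B \<and> length ws = i \<and> Y.eval_word ws = e i" if "i \<le> m" for i
      using that
    proof (induction i)
      case 0
      then show ?case using e0 by (intro exI[of _ "[]"]) simp
    next
      case (Suc i)
      then obtain ws where ws: "set ws \<subseteq> B" "length ws = i" "Y.eval_word ws = e i" by auto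
      let ?h = "inv (e i) \<otimes> e (Suc i)"
      have ee: "e i \<in> E" "e (Suc i) \<in> E" "d (u i) (e i) \<le> K" "d (u (Suc i)) (e (Suc i)) \<le> K"
        using e Suc.prems by simp_all
      then have ec: "e i \<in> carrier G" "e (Suc i) \<in> carrier G" by auto
      have "d (u i) (u (Suc i)) = 1" using u(4)[of i "Suc i"] Suc.prems by (simp add: m_def)
      then have "d (e i) (e (Suc i)) \<le> 2 * K + 1"
        using Y.wdist_triangle[OF ec(1) u(3) ec(2), of i] Y.wdist_triangle[OF u(3) u(3) ec(2), of i "Suc i"]
          Y.wdist_commute[OF ec(1) u(3), of i] ee by linarith
      moreover have "d \<one> ?h = d (e i) (e (Suc i))"
        using ec by (simp add: word_dist_def)
      ultimately have h: "?h \<in> B" using ee by (simp add: B_def)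
      have "set ws \<subseteq> carrier G" using ws(1) by (auto simp: B_def)
      then have "Y.eval_word (ws @ [?h]) = e (Suc i)"
        using ws(3) ec by (simp add: Y.eval_word_append m_assoc[symmetric])
      then show ?case using ws h by (intro exI[of _ "ws @ [?h]"]) simp
    qed
    from this[of m] e0 show ?thesis by (simp add: m_def)
  qed
  moreover have "B \<subseteq> E" by (auto simp: B_def)
  ultimately show ?thesis by blast
qed

text \<open>A word over \<open>B\<close> is brought into the form \<open>g [^] k \<otimes> f\<close>
  with \<open>f \<in> F\<close> letter by letter. Appending \<open>b\<close> changes the exponent by
  \<open>\<kappa> (f \<otimes> b)\<close>, which is bounded because \<open>F\<close> and
  \<open>B\<close> are finite.\<close>

lemma cyclic_subgroup_undistorted:
  assumes g: "g \<in> E" "ord g = 0" and vc: "virtually_cyclic (G\<lparr>carrier := E\<rparr>)"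
  shows "\<exists>A B. \<forall>k::int. real_of_int \<bar>k\<bar> \<le> A * real (Y.len (g [^] k)) + B"
proof -
  have gc: "g \<in> carrier G" using g(1) by simp
  obtain B where B: "finite B" "B \<subseteq> E"
    and words: "\<And>x. x \<in> E \<Longrightarrow> \<exists>ws. set ws \<subseteq> B \<and> length ws = Y.len x \<and> Y.eval_word ws = x"
    using subgroup_words by blast
  obtain F where F: "finite F" "F \<subseteq> E" and rep: "\<And>x. x \<in> E \<Longrightarrow> \<exists>k::int. \<exists>f\<in>F. x = g [^] k \<otimes> f"
    using virtually_cyclic_transversal[OF E.subgroup_axioms vc g] by blast
  then obtain \<kappa> \<phi> where \<kappa>: "\<And>x. x \<in> E \<Longrightarrow> \<phi> x \<in> F \<and> x = g [^] (\<kappa> x :: int) \<otimes> \<phi> x" by metis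
  define A where "A = (\<Sum>(f, b)\<in>F \<times> B. \<bar>\<kappa> (f \<otimes> b)\<bar>)"
  have A: "\<bar>\<kappa> (f \<otimes> b)\<bar> \<le> A" if "f \<in> F" "b \<in> B" for f b
    unfolding A_def using member_le_sum[of "(f, b)" "F \<times> B" "\<lambda>(f, b). \<bar>\<kappa> (f \<otimes> b)\<bar>"] that B(1) F(1) by auto
  have bound: "set ws \<subseteq> B \<Longrightarrow> \<exists>k::int. \<exists>f\<in>F. Y.eval_word ws = g [^] k \<otimes> f \<and> \<bar>k\<bar> \<le> A * int (length ws) + \<bar>\<kappa> \<one>\<bar>" for ws
  proof (induction ws rule: rev_induct)
    case Nil
    then show ?case using \<kappa>[OF E.one_closed] by auto
  next
    case (snoc b ws)
    then obtain k :: int and f where kf: "f \<in> F" "Y.eval_word ws = g [^] k \<otimes> f"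
      "\<bar>k\<bar> \<le> A * int (length ws) + \<bar>\<kappa> \<one>\<bar>" by auto
    have b: "b \<in> B" using snoc.prems by simp
    have fb: "f \<in> E" "b \<in> E" "f \<in> carrier G" "b \<in> carrier G" using kf b B(2) F(2) by auto
    then have fbE: "f \<otimes> b \<in> E" by simp
    define k' where "k' = \<kappa> (f \<otimes> b)"
    have \<phi>: "\<phi> (f \<otimes> b) \<in> F" "f \<otimes> b = g [^] k' \<otimes> \<phi> (f \<otimes> b)"
      using \<kappa>[OF fbE] by (simp_all add: k'_def)
    have \<phi>c: "\<phi> (f \<otimes> b) \<in> carrier G" using \<phi>(1) F(2) by auto
    have "set ws \<subseteq> carrier G" using snoc.prems B(2) by auto
    then have "Y.eval_word (ws @ [b]) = g [^] k \<otimes> (f \<otimes> b)"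
      using kf(2) fb gc by (simp add: Y.eval_word_append m_assoc)
    also have "\<dots> = g [^] (k + k') \<otimes> \<phi> (f \<otimes> b)"
      using \<phi>(2) gc \<phi>c by (metis int_pow_closed int_pow_mult m_assoc)
    finally have "Y.eval_word (ws @ [b]) = g [^] (k + k') \<otimes> \<phi> (f \<otimes> b)" .
    moreover have "\<bar>k + k'\<bar> \<le> A * int (length (ws @ [b])) + \<bar>\<kappa> \<one>\<bar>"
      using kf(3) A[OF kf(1) b] by (simp add: k'_def algebra_simps)
    ultimately show ?case using \<phi>(1) by blast
  qed
  have inj: "inj (\<lambda>k::int. g [^] k)"
  proof (rule injI)
    fix i j :: int assume "g [^] i = g [^] j"
    then have "g [^] (i - j) = \<one>" using gc by (simp add: int_pow_diff)
    then show "i = j" using int_pow_eq_id[OF gc, of "i - j"] g(2) by simp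
  qed
  \<comment> \<open>A power of \<open>g\<close> may be represented with a nontrivial
    \<open>f\<close>, which is then itself a power of \<open>g\<close> in \<open>F\<close>. As
    powers are distinct, only finitely many exponents can occur, so the error is bounded.\<close>
  have "finite ((\<lambda>k::int. g [^] k) -` F)" using finite_vimageI[OF F(1) inj] .
  then obtain C where C: "\<And>k::int. g [^] k \<in> F \<Longrightarrow> \<bar>k\<bar> \<le> C"
    using finite_imageI[of _ abs] Max_ge by (metis (no_types, lifting) imageI vimage_eq)
  have "real_of_int \<bar>k\<bar> \<le> real_of_int A * real (Y.len (g [^] k)) + real_of_int (\<bar>\<kappa> \<one>\<bar> + C)" for k :: int
  proof -
    have "g [^] k \<in> E" using subgroup_int_pow_closed[OF E.subgroup_axioms g(1)] .
    then obtain ws where ws: "set ws \<subseteq> B" "length ws = Y.len (g [^] k)" "Y.eval_word ws = g [^] k"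
      using words by blast
    then obtain k' :: int and f where k': "f \<in> F" "g [^] k = g [^] k' \<otimes> f"
      "\<bar>k'\<bar> \<le> A * int (Y.len (g [^] k)) + \<bar>\<kappa> \<one>\<bar>" using bound[OF ws(1)] by auto
    have "f \<in> carrier G" using k'(1) F(2) by auto
    then have "f = inv (g [^] k') \<otimes> g [^] k" using k'(2) gc by (simp add: m_assoc[symmetric])
    also have "\<dots> = g [^] (k - k')" using gc by (metis add_uminus_conv_diff int_pow_mult int_pow_neg add.commute)
    finally have "\<bar>k - k'\<bar> \<le> C" using C k'(1) by simp
    then have "\<bar>k\<bar> \<le> A * int (Y.len (g [^] k)) + (\<bar>\<kappa> \<one>\<bar> + C)" using k'(3) by linarith
    then have "real_of_int \<bar>k\<bar> \<le> real_of_int (A * int (Y.len (g [^] k)) + (\<bar>\<kappa> \<one>\<bar> + C))"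
      by (simp only: of_int_le_iff)
    then show ?thesis by simp
  qed
  then show ?thesis by blast
qed

end

section \<open>Projections of quasi-geodesics\<close>

locale hyperbolically_embedded_finite_gens =
  hyperbolically_embedded_subgroup G Y E + S: word_metric G S for G (structure) and Y E S +
  assumes finite_gens: "finite S"
begin

abbreviation "dS \<equiv> word_dist G S"

lemma dist_compare:
  obtains \<kappa> where "\<kappa> \<ge> 1" "\<And>x y. x \<in> carrier G \<Longrightarrow> y \<in> carrier G \<Longrightarrow> d x y \<le> \<kappa> * dS x y"
  by (rule word_metric_compare[OF S.word_metric_axioms finite_gens Y.word_metric_axioms]) blast

text \<open>Reading the words over \<open>B\<close> with lengths for \<open>S\<close> turns bounds
  on projections in \<open>d\<close> back into bounds in \<open>dS\<close>.\<close>

lemma subgroup_undistorted: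
  "\<exists>A\<ge>1. \<forall>x\<in>E. \<forall>y\<in>E. dS x y \<le> A * d x y"
proof -
  obtain B where B: "finite B" "B \<subseteq> E"
    and words: "\<And>x. x \<in> E \<Longrightarrow> \<exists>ws. set ws \<subseteq> B \<and> length ws = Y.len x \<and> Y.eval_word ws = x"
    using subgroup_words by blast
  define A where "A = 1 + (\<Sum>b\<in>B. real (S.len b))"
  have A: "real (S.len b) \<le> A" if "b \<in> B" for b
    using member_le_sum[OF that _ B(1), of "\<lambda>b. real (S.len b)"] by (simp add: A_def)
  have "real (S.len x) \<le> A * real (Y.len x)" if x: "x \<in> E" for x
  proof -
    obtain ws where ws: "set ws \<subseteq> B" "length ws = Y.len x" "Y.eval_word ws = x"
      using words[OF x] by blast
    have "S.eval_word ws = x" using ws(3) by (simp add: S.eval_word_def Y.eval_word_def)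
    moreover have "set ws \<subseteq> carrier G" using ws(1) B(2) by auto
    ultimately show ?thesis using S.len_eval_word_le[of ws A] A ws by auto
  qed
  then have "\<forall>x\<in>E. \<forall>y\<in>E. dS x y \<le> A * d x y" by (simp add: word_dist_def)
  moreover have "A \<ge> 1" by (simp add: A_def sum_nonneg)
  ultimately show ?thesis by blast
qed

text \<open>Far away from \<open>E\<close> in the finitely generated metric, short steps move the projection by little:
  up to translation there are only finitely many steps, and each of them is seen by finitely many
  cosets of \<open>E\<close> only.\<close>

lemma projection_step:
  assumes \<epsilon>: "\<epsilon> > 0" and \<kappa>: "\<kappa> > 0" "\<And>x y. x \<in> carrier G \<Longrightarrow> y \<in> carrier G \<Longrightarrow> d x y \<le> \<kappa> * dS x y"
  shows "\<exists>n0. \<forall>n\<ge>n0. \<exists>R. \<forall>x\<in>carrier G. \<forall>y\<in>carrier G. (\<forall>h\<in>E. R < dS x h) \<and>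
    \<kappa> * dS x y \<le> max n (d x (\<pi> x) / 2) \<longrightarrow> d (\<pi> x) (\<pi> y) \<le> \<epsilon> * max n (d x (\<pi> x) / 2)"
proof -
  obtain N1 where N1: "\<And>n x y. n \<ge> N1 \<Longrightarrow> x \<in> carrier G \<Longrightarrow> y \<in> carrier G \<Longrightarrow> d x y \<le> n \<Longrightarrow>
    finite {C. (\<exists>a\<in>carrier G. C = a <# E) \<and>
      (\<exists>p q. nearest_point d C x p \<and> nearest_point d C y q \<and> d x p \<le> 2 * n \<and> \<epsilon> * n \<le> d p q)}"
    using finite_cosets_with_large_projection[OF \<epsilon>] by blast
  \<comment> \<open>The step is measured by half the distance to \<open>E\<close>, and
    \<open>\<epsilon> / 2 * d x (\<pi> x)\<close> is \<open>\<epsilon>\<close> times that half.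
    Likewise \<open>N2 / 2\<close> below: the far case has distance at least
    \<open>2 * n\<close>.\<close>
  have "\<epsilon> / 2 > 0" using \<epsilon> by simp
  from projection_sublinear_far[OF this]
  obtain N2 where N2: "\<And>x y. x \<in> carrier G \<Longrightarrow> y \<in> carrier G \<Longrightarrow> N2 \<le> d x (\<pi> x) \<Longrightarrow>
      d x y \<le> d x (\<pi> x) / 2 \<Longrightarrow> d (\<pi> x) (\<pi> y) \<le> \<epsilon> / 2 * d x (\<pi> x)"
    by blast
  have "\<exists>R. \<forall>x\<in>carrier G. \<forall>y\<in>carrier G. (\<forall>h\<in>E. R < dS x h) \<and>
    \<kappa> * dS x y \<le> max n (d x (\<pi> x) / 2) \<longrightarrow> d (\<pi> x) (\<pi> y) \<le> \<epsilon> * max n (d x (\<pi> x) / 2)"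
    if n: "n \<ge> max N1 (N2 / 2)" for n
  proof -
    \<comment> \<open>Translating \<open>x\<close> to \<open>\<one>\<close> turns \<open>E\<close>
      into the coset \<open>inv x <# E\<close>; \<open>Q w\<close> collects the cosets on which the
      step from \<open>\<one>\<close> to \<open>w\<close> has a large projection.\<close>
    define Q where "Q w = {C. (\<exists>a\<in>carrier G. C = a <# E) \<and>
      (\<exists>p q. nearest_point d C \<one> p \<and> nearest_point d C w q \<and> d \<one> p \<le> 2 * n \<and> \<epsilon> * n \<le> d p q)}" for w
    define W where "W = {w \<in> carrier G. S.len w \<le> nat \<lfloor>n / \<kappa>\<rfloor> \<and> d \<one> w \<le> n}"
    have "finite W"
      by (rule finite_subset[OF _ S.finite_len_ball[OF finite_gens, of "nat \<lfloor>n / \<kappa>\<rfloor>"]]) (auto simp: W_def)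
    moreover have "finite (Q w)" if "w \<in> W" for w
      unfolding Q_def using that n by (intro N1) (auto simp: W_def)
    ultimately have finU: "finite (\<Union>w\<in>W. Q w)" by blast
    \<comment> \<open>At least the length of one chosen element of each coset concerned. In
      \<open>inv x <# E\<close> that element is \<open>inv x \<otimes> h\<close> with
      \<open>h \<in> E\<close>, and its length is \<open>dS x h\<close>; so a violating
      \<open>x\<close> would be within \<open>R\<close> of \<open>E\<close>.\<close>
    define R where "R = (\<Sum>C\<in>(\<Union>w\<in>W. Q w). real (S.len (SOME c. c \<in> C)))"
    show ?thesis
    proof (intro exI[of _ R] ballI impI)
      fix x y assume x: "x \<in> carrier G" and y: "y \<in> carrier G"
      assume "(\<forall>h\<in>E. R < dS x h) \<and> \<kappa> * dS x y \<le> max n (d x (\<pi> x) / 2)"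
      then have far: "\<And>h. h \<in> E \<Longrightarrow> R < dS x h" and short: "\<kappa> * dS x y \<le> max n (d x (\<pi> x) / 2)" by auto
      have dxy: "d x y \<le> max n (d x (\<pi> x) / 2)" using \<kappa>(2)[OF x y] short by linarith
      have \<pi>c: "\<pi> x \<in> carrier G" "\<pi> y \<in> carrier G" using proj_in by auto
      show "d (\<pi> x) (\<pi> y) \<le> \<epsilon> * max n (d x (\<pi> x) / 2)"
      proof (cases "n \<le> d x (\<pi> x) / 2")
        case True
        then show ?thesis using N2[OF x y] dxy n by (simp add: max_absorb2)
      next
        case False
        then have mx: "max n (d x (\<pi> x) / 2) = n" by simp
        show ?thesis
        proof (rule ccontr)
          assume "\<not> ?thesis"
          then have big: "\<epsilon> * n \<le> d (\<pi> x) (\<pi> y)" using mx by simp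
          define w where "w = inv x \<otimes> y"
          have w: "w \<in> carrier G" using x y by (simp add: w_def)
          define C where "C = inv x <# E"
          have "\<kappa> * dS x y \<le> n" using short mx by simp
          then have "real (S.len w) \<le> n / \<kappa>"
            using \<kappa>(1) by (simp add: w_def word_dist_def field_simps)
          then have "S.len w \<le> nat \<lfloor>n / \<kappa>\<rfloor>" by (simp add: le_nat_floor)
          moreover have "d \<one> w = d x y" using x y by (simp add: w_def word_dist_def)
          ultimately have wW: "w \<in> W" using w dxy mx by (simp add: W_def)
          have "nearest_point d C (inv x \<otimes> x) (inv x \<otimes> \<pi> x)" "nearest_point d C w (inv x \<otimes> \<pi> y)"
            unfolding C_def w_def
            using Y.nearest_point_translate[OF proj_nearest E.subset x inv_closed[OF x]]
              Y.nearest_point_translate[OF proj_nearest E.subset y inv_closed[OF x]] by auto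
          moreover have "d \<one> (inv x \<otimes> \<pi> x) \<le> 2 * n"
            using False x \<pi>c by (simp add: word_dist_def)
          moreover have "\<epsilon> * n \<le> d (inv x \<otimes> \<pi> x) (inv x \<otimes> \<pi> y)"
            using big x \<pi>c by (simp add: Y.wdist_translate)
          moreover have "\<exists>a\<in>carrier G. C = a <# E" using x by (auto simp: C_def)
          ultimately have "C \<in> Q w" unfolding Q_def using x by auto
          then have CU: "C \<in> (\<Union>w\<in>W. Q w)" using wW by blast
          have "inv x \<otimes> \<one> \<in> C" unfolding C_def l_coset_def using E.one_closed by blast
          then have "(SOME c. c \<in> C) \<in> C" by (rule someI)
          then obtain h where h: "h \<in> E" "(SOME c. c \<in> C) = inv x \<otimes> h"
            unfolding C_def l_coset_def by blast
          have "real (S.len (inv x \<otimes> h)) \<le> R"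
            using member_le_sum[OF CU _ finU, of "\<lambda>C. real (S.len (SOME c. c \<in> C))"] h(2)
            by (simp add: R_def)
          then show False using far[OF h(1)] by (simp add: word_dist_def)
        qed
      qed
    qed
  qed
  then show ?thesis by blast
qed

lemma path_length:
  assumes "\<And>i. u i \<in> carrier G" "\<And>i. dS (u i) (u (Suc i)) \<le> \<eta>" "i \<le> j"
  shows "dS (u i) (u j) \<le> \<eta> * real (j - i)"
  using assms(3)
proof (induction j rule: dec_induct)
  case base
  show ?case using assms(1) by simp
next
  case (step j)
  have "dS (u i) (u (Suc j)) \<le> dS (u i) (u j) + dS (u j) (u (Suc j))"
    using assms(1) by (intro S.wdist_triangle)
  also have "\<dots> \<le> \<eta> * real (j - i) + \<eta>" using step.IH assms(2)[of j] by linarith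
  also have "\<dots> = \<eta> * real (Suc j - i)" using step.hyps by (simp add: Suc_diff_le algebra_simps)
  finally show ?case .
qed

text \<open>Far out in \<open>d\<close> the steps are taken proportional to the distance from \<open>E\<close>.\<close>

lemma projection_path:
  assumes pos: "\<epsilon> > 0" "\<kappa> > 0" "\<eta> > 0" and n: "\<kappa> * \<eta> \<le> n"
    and \<kappa>: "\<And>x y. x \<in> carrier G \<Longrightarrow> y \<in> carrier G \<Longrightarrow> d x y \<le> \<kappa> * dS x y"
    and step: "\<And>x y. x \<in> carrier G \<Longrightarrow> y \<in> carrier G \<Longrightarrow> (\<And>h. h \<in> E \<Longrightarrow> R < dS x h) \<Longrightarrow>
      \<kappa> * dS x y \<le> max n (d x (\<pi> x) / 2) \<Longrightarrow> d (\<pi> x) (\<pi> y) \<le> \<epsilon> * max n (d x (\<pi> x) / 2)"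
    and u: "\<And>i. u i \<in> carrier G" "\<And>i. dS (u i) (u (Suc i)) \<le> \<eta>"
    and far: "\<And>i h. a \<le> i \<Longrightarrow> i \<le> b \<Longrightarrow> h \<in> E \<Longrightarrow> R < dS (u i) h" and ab: "a \<le> b"
  shows "d (\<pi> (u a)) (\<pi> (u b)) \<le> 2 * \<epsilon> * \<kappa> * \<eta> * real (b - a) + \<epsilon> * (n + d (u b) (\<pi> (u b)))"
  using far ab
proof (induction "b - a" arbitrary: a rule: less_induct)
  case less
  define s where "s = max n (d (u a) (\<pi> (u a)) / 2)"
  \<comment> \<open>The largest number of steps of size \<open>\<eta>\<close> that
    \<open>step\<close> permits at once; it is positive because \<open>n\<close> is at least
    \<open>\<kappa> * \<eta>\<close>.\<close>
  define N where "N = nat \<lfloor>s / (\<kappa> * \<eta>)\<rfloor>"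
  have kl: "\<kappa> * \<eta> > 0" using pos by simp
  have "s \<ge> \<kappa> * \<eta>" using n by (simp add: s_def)
  then have "1 \<le> s / (\<kappa> * \<eta>)" using kl by (simp add: le_divide_eq)
  then have N: "1 \<le> N" "real N \<le> s / (\<kappa> * \<eta>)" "s / (\<kappa> * \<eta>) < real N + 1"
    unfolding N_def by linarith+
  have sN: "\<kappa> * (\<eta> * real N) \<le> s" "s \<le> \<kappa> * \<eta> * (real N + 1)"
    using N(2,3) kl by (simp_all add: field_simps)
  have \<pi>c: "\<pi> x \<in> carrier G" for x using proj_in by auto
  have jump: "d (\<pi> (u a)) (\<pi> (u j)) \<le> \<epsilon> * s" if "a \<le> j" "j - a \<le> N" for j
  proof -
    have "dS (u a) (u j) \<le> \<eta> * real (j - a)" by (rule path_length[where u = u, OF u that(1)])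
    also have "\<dots> \<le> \<eta> * real N" using that(2) pos by simp
    finally have "\<kappa> * dS (u a) (u j) \<le> \<kappa> * (\<eta> * real N)" using pos by simp
    then show ?thesis
      unfolding s_def using less.prems u(1) sN(1) by (intro step) (auto simp: s_def)
  qed
  show ?case
  proof (cases "b - a \<le> N")
    case True
    \<comment> \<open>When \<open>s\<close> is half the distance of \<open>u a\<close> from
      \<open>E\<close>, moving to \<open>u b\<close> shortens this distance by at most
      \<open>s\<close>; so the distance of \<open>u b\<close> is still at least
      \<open>s\<close>.\<close>
    have "s \<le> n + d (u b) (\<pi> (u b))"
    proof (cases "d (u a) (\<pi> (u a)) / 2 \<le> n")
      case True
      then show ?thesis by (simp add: s_def)
    next
      case False
      have "d (u a) (u b) \<le> \<kappa> * dS (u a) (u b)" by (rule \<kappa>[OF u(1) u(1)])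
      also have "\<dots> \<le> \<kappa> * (\<eta> * real (b - a))"
        using path_length[where u = u, OF u less.prems(2)] pos by simp
      also have "\<dots> \<le> \<kappa> * (\<eta> * real N)" using \<open>b - a \<le> N\<close> pos by simp
      finally have "d (u a) (u b) \<le> s" using sN(1) by linarith
      moreover have "d (u a) (\<pi> (u a)) \<le> d (u a) (\<pi> (u b))" by (rule proj_le[OF proj_in])
      moreover have "d (u a) (\<pi> (u b)) \<le> d (u a) (u b) + d (u b) (\<pi> (u b))"
        by (rule Y.wdist_triangle[OF u(1) u(1) \<pi>c])
      moreover have "s = d (u a) (\<pi> (u a)) / 2" using False by (simp add: s_def)
      moreover have "n \<ge> 0" using n kl by linarith
      ultimately show ?thesis by linarith
    qed
    then have "\<epsilon> * s \<le> \<epsilon> * (n + d (u b) (\<pi> (u b)))" using pos by simp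
    moreover have "0 \<le> 2 * \<epsilon> * \<kappa> * \<eta> * real (b - a)" using pos by simp
    ultimately show ?thesis using jump[OF less.prems(2) True] by linarith
  next
    case False
    define a' where "a' = a + N"
    have a': "a \<le> a'" "a' \<le> b" "b - a' < b - a" "a' - a = N" using False N(1) by (auto simp: a'_def)
    have IH: "d (\<pi> (u a')) (\<pi> (u b)) \<le> 2 * \<epsilon> * \<kappa> * \<eta> * real (b - a') + \<epsilon> * (n + d (u b) (\<pi> (u b)))"
      using a' less.prems(1) by (intro less.hyps) auto
    \<comment> \<open>Rounding costs one step, and \<open>N + 1\<close> is at most
      \<open>2 * N\<close>; this is the factor 2 in the bound.\<close>
    have "s \<le> \<kappa> * \<eta> * (real N + 1)" by (rule sN(2))
    also have "\<dots> \<le> \<kappa> * \<eta> * (2 * real N)" using N(1) kl by (intro mult_left_mono) auto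
    finally have "\<epsilon> * s \<le> \<epsilon> * (\<kappa> * \<eta> * (2 * real N))" using pos by simp
    then have "d (\<pi> (u a)) (\<pi> (u a')) \<le> 2 * \<epsilon> * \<kappa> * \<eta> * real N"
      using jump[OF a'(1)] a'(4) by (simp add: algebra_simps)
    moreover have "d (\<pi> (u a)) (\<pi> (u b)) \<le> d (\<pi> (u a)) (\<pi> (u a')) + d (\<pi> (u a')) (\<pi> (u b))"
      by (rule Y.wdist_triangle[OF \<pi>c \<pi>c \<pi>c])
    moreover have "real (b - a) = real N + real (b - a')" using a' by (simp add: a'_def of_nat_diff)
    ultimately show ?thesis using IH by (simp add: algebra_simps)
  qed
qed

text \<open>For an excursion of \<open>l\<close> unit time steps, the route through the projections
  bounds the distance of its ends by a constant plus \<open>l / (2 * \<mu>)\<close>, while the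
  quasi-geodesic inequality demands at least \<open>l / \<mu> - c\<close>. Hence
  \<open>l \<le> M\<close>, and every point of the excursion is within \<open>\<eta> * M\<close> of
  its start.\<close>

lemma quasi_geodesics_near_subgroup:
  assumes \<mu>: "\<mu> \<ge> 1" and c: "c \<ge> 0"
  shows "\<exists>C. \<forall>a b \<gamma>. quasi_geodesic \<mu> c (carrier G) dS a b \<gamma> \<and> \<gamma> a \<in> E \<and> \<gamma> b \<in> E \<longrightarrow>
    (\<forall>t\<in>{a..b}. \<exists>h\<in>E. dS (\<gamma> t) h \<le> C)"
proof -
  obtain \<kappa> where \<kappa>: "\<kappa> \<ge> 1" "\<And>x y. x \<in> carrier G \<Longrightarrow> y \<in> carrier G \<Longrightarrow> d x y \<le> \<kappa> * dS x y"
    by (rule dist_compare) blast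
  obtain A where A: "A \<ge> 1" "\<And>x y. x \<in> E \<Longrightarrow> y \<in> E \<Longrightarrow> dS x y \<le> A * d x y"
    using subgroup_undistorted by blast
  \<comment> \<open>Bounds the displacement of a quasi-geodesic in time 1.\<close>
  define \<eta> where "\<eta> = \<mu> + c"
  \<comment> \<open>Chosen to make the slope of the projection bound, multiplied by the distortion
    \<open>A\<close>, equal to \<open>1 / (2 * \<mu>)\<close>.\<close>
  define \<epsilon> where "\<epsilon> = 1 / (4 * \<mu> * A * \<kappa> * \<eta>)"
  have pos: "\<eta> > 0" "\<kappa> > 0" "A > 0" "\<mu> > 0" using \<mu> c \<kappa>(1) A(1) by (simp_all add: \<eta>_def)
  have \<epsilon>: "\<epsilon> > 0" "A * (2 * \<epsilon> * \<kappa> * \<eta>) = 1 / (2 * \<mu>)"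
    using pos by (simp_all add: \<epsilon>_def field_simps)
  obtain n0 where n0: "\<And>n. n \<ge> n0 \<Longrightarrow> \<exists>R. \<forall>x\<in>carrier G. \<forall>y\<in>carrier G. (\<forall>h\<in>E. R < dS x h) \<and>
    \<kappa> * dS x y \<le> max n (d x (\<pi> x) / 2) \<longrightarrow> d (\<pi> x) (\<pi> y) \<le> \<epsilon> * max n (d x (\<pi> x) / 2)"
    using projection_step[OF \<epsilon>(1) pos(2) \<kappa>(2)] by blast
  define n where "n = max n0 (\<kappa> * \<eta>)"
  have "n0 \<le> n" by (simp add: n_def)
  from n0[OF this] obtain R where step: "\<And>x y. x \<in> carrier G \<Longrightarrow> y \<in> carrier G \<Longrightarrow>
      (\<And>h. h \<in> E \<Longrightarrow> R < dS x h) \<Longrightarrow>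
      \<kappa> * dS x y \<le> max n (d x (\<pi> x) / 2) \<Longrightarrow> d (\<pi> x) (\<pi> y) \<le> \<epsilon> * max n (d x (\<pi> x) / 2)"
    by blast
  \<comment> \<open>Nonnegative, so that points of \<open>E\<close> count as near and both ends of
    the curve stop an excursion.\<close>
  define R' where "R' = max 0 R"
  define \<rho> where "\<rho> = \<kappa> * (\<eta> + R')"
  \<comment> \<open>The bound obtained by solving for \<open>l\<close>. The term
    \<open>4 * \<rho>\<close> accounts for four legs: at each end of the excursion one to a nearby
    point of \<open>E\<close> and one to the projection.\<close>
  define M where "M = 2 * \<mu> * (c + 2 * (\<eta> + R') + A * (4 * \<rho> + \<epsilon> * (n + \<rho>)))"
  define C where "C = \<eta> + max R' (\<eta> * M + \<eta> + R')"
  have "\<exists>h\<in>E. dS (\<gamma> t) h \<le> C"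
    if qg: "quasi_geodesic \<mu> c (carrier G) dS a b \<gamma>" and ends: "\<gamma> a \<in> E" "\<gamma> b \<in> E"
      and t: "t \<in> {a..b}" for a b \<gamma> t
  proof -
    have \<gamma>c: "\<gamma> s \<in> carrier G" if "a \<le> s" "s \<le> b" for s
      using qg that by (auto simp: quasi_geodesic_def qi_embedding_def)
    have lower: "\<bar>s - s'\<bar> / \<mu> - c \<le> dS (\<gamma> s) (\<gamma> s')" and upper: "dS (\<gamma> s) (\<gamma> s') \<le> \<mu> * \<bar>s - s'\<bar> + c"
      if "a \<le> s" "s \<le> b" "a \<le> s'" "s' \<le> b" for s s'
      using qg that by (auto simp: quasi_geodesic_def qi_embedding_def dist_real_def)
    have close: "dS (\<gamma> s) (\<gamma> s') \<le> \<eta>" if "a \<le> s" "s \<le> b" "a \<le> s'" "s' \<le> b" "\<bar>s - s'\<bar> \<le> 1" for s s'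
    proof -
      have "\<mu> * \<bar>s - s'\<bar> \<le> \<mu> * 1" using that(5) pos by (intro mult_left_mono) auto
      then show ?thesis using upper[OF that(1-4)] by (simp add: \<eta>_def)
    qed
    have ab: "a \<le> b" using t by auto
    \<comment> \<open>Capping at \<open>b\<close> gives an infinite sequence with bounded steps that
      is eventually constant.\<close>
    define \<tau> where "\<tau> i = min (a + real i) b" for i :: nat
    have \<tau>: "a \<le> \<tau> i" "\<tau> i \<le> b" for i using ab by (auto simp: \<tau>_def)
    define u where "u i = \<gamma> (\<tau> i)" for i
    have uc: "u i \<in> carrier G" for i using \<gamma>c \<tau> by (simp add: u_def)
    have us: "dS (u i) (u (Suc i)) \<le> \<eta>" for i
      unfolding u_def using \<tau> by (intro close) (auto simp: \<tau>_def)
    define N where "N = nat \<lceil>b - a\<rceil>"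
    have N: "b - a \<le> real N" "\<And>i. i < N \<Longrightarrow> real i < b - a"
      unfolding N_def by (auto simp: real_nat_ceiling_ge) linarith
    have "\<tau> 0 = a" "\<tau> N = b" using ab N(1) by (simp_all add: \<tau>_def)
    then have u0: "u 0 \<in> E" "u N \<in> E" using ends by (simp_all add: u_def)
    define i where "i = nat \<lfloor>t - a\<rfloor>"
    have i: "real i \<le> t - a" "t - a < real i + 1" using t unfolding i_def by (simp_all add: of_nat_floor)
    then have ti: "\<tau> i = a + real i" using t by (auto simp: \<tau>_def)
    have tu: "dS (\<gamma> t) (u i) \<le> \<eta>"
      unfolding u_def using t \<tau> i ti by (intro close) auto
    define near where "near j \<longleftrightarrow> (\<exists>h\<in>E. dS (u j) h \<le> R')" for j
    have R'0: "R' \<ge> 0" "R \<le> R'" by (simp_all add: R'_def)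
    have nearE: "near j" if "u j \<in> E" for j
      unfolding near_def using that R'0 by (intro bexI[of _ "u j"]) auto
    have "\<exists>h\<in>E. dS (u i) h \<le> max R' (\<eta> * M + \<eta> + R')"
    proof (cases "near i")
      case True
      then obtain h where "h \<in> E" "dS (u i) h \<le> R'" by (auto simp: near_def)
      then show ?thesis by (intro bexI[of _ h]) auto
    next
      case nn: False
      have "i \<le> N" using i(1) t N(1) by (simp add: of_nat_le_iff[where 'a = real, symmetric] del: of_nat_le_iff)
      then have iN: "i < N" using nn nearE u0(2) by (metis order_less_le)
      have i0: "0 < i" using nn nearE u0(1) by (metis gr0I)
      define i1 where "i1 = Max {j. j < i \<and> near j}"
      have i1: "i1 < i" "near i1" "\<And>j. i1 < j \<Longrightarrow> j \<le> i \<Longrightarrow> \<not> near j"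
      proof -
        have fin: "finite {j. j < i \<and> near j}" and ne: "0 \<in> {j. j < i \<and> near j}"
          using i0 nearE[OF u0(1)] by auto
        have "i1 \<in> {j. j < i \<and> near j}" unfolding i1_def using fin ne Max_in by blast
        then show "i1 < i" "near i1" by auto
        show "\<not> near j" if "i1 < j" "j \<le> i" for j
        proof
          assume "near j"
          then have "j \<in> {j. j < i \<and> near j}" using that(2) nn by (cases "j = i") auto
          from Max_ge[OF fin this] that(1) show False unfolding i1_def by simp
        qed
      qed
      define i2 where "i2 = (LEAST j. i < j \<and> near j)"
      have ex2: "i < N \<and> near N" using iN nearE[OF u0(2)] by simp
      have i2: "i < i2" "near i2" "i2 \<le> N" "\<And>j. i < j \<Longrightarrow> j < i2 \<Longrightarrow> \<not> near j"
      proof -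
        have "i < i2 \<and> near i2" unfolding i2_def by (rule LeastI[where k = N]) (rule ex2)
        then show "i < i2" "near i2" by simp_all
        show "i2 \<le> N" unfolding i2_def by (rule Least_le) (rule ex2)
        show "\<not> near j" if "i < j" "j < i2" for j
          using not_less_Least[of j "\<lambda>j. i < j \<and> near j"] that by (simp add: i2_def)
      qed
      \<comment> \<open>First and last index of the excursion: both still far from \<open>E\<close>,
        as the projection estimate requires, but one step away from near points.\<close>
      define p where "p = Suc i1"
      define q where "q = i2 - 1"
      have pq: "p \<le> i" "i \<le> q" "q < N" "Suc q = i2" using i1(1) i2(1,3) by (auto simp: p_def q_def)
      have far: "R < dS (u j) h" if "p \<le> j" "j \<le> q" "h \<in> E" for j h
      proof -
        have "\<not> near j"
        proof (cases "j \<le> i")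
          case True
          then show ?thesis using i1(3)[of j] that by (simp add: p_def)
        next
          case False
          then show ?thesis using i2(4)[of j] that pq by auto
        qed
        then have "R' < dS (u j) h" using that(3) by (auto simp: near_def not_le)
        then show ?thesis using R'0 by linarith
      qed
      obtain h1 where h1: "h1 \<in> E" "dS (u i1) h1 \<le> R'" using i1(2) by (auto simp: near_def)
      obtain h2 where h2: "h2 \<in> E" "dS (u i2) h2 \<le> R'" using i2(2) by (auto simp: near_def)
      have hc: "h1 \<in> carrier G" "h2 \<in> carrier G" using h1 h2 by auto
      have \<pi>c: "\<pi> x \<in> carrier G" for x using proj_in by auto
      have ph: "dS (u p) h1 \<le> \<eta> + R'"
        using S.wdist_triangle[OF uc uc hc(1), of p i1] S.wdist_commute[OF uc uc, of p i1] us[of i1] h1(2)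
        unfolding p_def by linarith
      have qh: "dS (u q) h2 \<le> \<eta> + R'"
        using S.wdist_triangle[OF uc uc hc(2), of q i2] us[of q] h2(2) pq(4) by simp
      have dph: "d (u p) h1 \<le> \<rho>"
        using \<kappa>(2)[OF uc hc(1), of p] mult_left_mono[OF ph less_imp_le[OF pos(2)]]
        unfolding \<rho>_def by linarith
      have dqh: "d (u q) h2 \<le> \<rho>"
        using \<kappa>(2)[OF uc hc(2), of q] mult_left_mono[OF qh less_imp_le[OF pos(2)]]
        unfolding \<rho>_def by linarith
      have dp\<pi>: "d (u p) (\<pi> (u p)) \<le> \<rho>" and dq\<pi>: "d (u q) (\<pi> (u q)) \<le> \<rho>"
        using proj_le[OF h1(1), of "u p"] proj_le[OF h2(1), of "u q"] dph dqh by linarith+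
      define l where "l = real (q - p)"
      have "p \<le> q" using pq by simp
      have "d (\<pi> (u p)) (\<pi> (u q)) \<le> 2 * \<epsilon> * \<kappa> * \<eta> * l + \<epsilon> * (n + d (u q) (\<pi> (u q)))"
        unfolding l_def
        by (rule projection_path[where u = u, OF \<epsilon>(1) pos(2,1) _ \<kappa>(2) step uc us far \<open>p \<le> q\<close>])
          (simp_all add: n_def)
      also have "\<dots> \<le> 2 * \<epsilon> * \<kappa> * \<eta> * l + \<epsilon> * (n + \<rho>)" using dq\<pi> \<epsilon>(1) by simp
      finally have D: "d (\<pi> (u p)) (\<pi> (u q)) \<le> 2 * \<epsilon> * \<kappa> * \<eta> * l + \<epsilon> * (n + \<rho>)" .
      have "d h1 h2 \<le> d h1 (u p) + d (u p) (\<pi> (u p)) + d (\<pi> (u p)) (\<pi> (u q)) + d (\<pi> (u q)) (u q) + d (u q) h2"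
        using Y.wdist_triangle[OF hc(1) uc hc(2), of p] Y.wdist_triangle[OF uc \<pi>c hc(2), of p "u p"]
          Y.wdist_triangle[OF \<pi>c \<pi>c hc(2), of "u p" "u q"] Y.wdist_triangle[OF \<pi>c uc hc(2), of "u q" q]
        by linarith
      also have "\<dots> \<le> 4 * \<rho> + d (\<pi> (u p)) (\<pi> (u q))"
        using dph dqh dp\<pi> dq\<pi> Y.wdist_commute[OF hc(1) uc, of p] Y.wdist_commute[OF \<pi>c uc, of "u q" q]
        by linarith
      finally have "d h1 h2 \<le> 4 * \<rho> + \<epsilon> * (n + \<rho>) + 2 * \<epsilon> * \<kappa> * \<eta> * l" using D by linarith
      then have "A * d h1 h2 \<le> A * (4 * \<rho> + \<epsilon> * (n + \<rho>) + 2 * \<epsilon> * \<kappa> * \<eta> * l)" using pos by simp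
      also have "\<dots> = A * (4 * \<rho> + \<epsilon> * (n + \<rho>)) + (A * (2 * \<epsilon> * \<kappa> * \<eta>)) * l"
        by (simp add: algebra_simps)
      also have "\<dots> = A * (4 * \<rho> + \<epsilon> * (n + \<rho>)) + l / (2 * \<mu>)" using \<epsilon>(2) by simp
      finally have Ah: "dS h1 h2 \<le> A * (4 * \<rho> + \<epsilon> * (n + \<rho>)) + l / (2 * \<mu>)"
        using A(2)[OF h1(1) h2(1)] by linarith
      \<comment> \<open>Here \<open>k\<close> is \<open>l / \<mu>\<close> and \<open>z\<close> its
        half: one half is absorbed by the estimate for \<open>dS h1 h2\<close>, the other is what
        gets bounded.\<close>
      have arith: "z \<le> c + 2 * v + w" if "m \<le> x + h + y" "k - c \<le> m" "k = z + z" "h \<le> w + z" "x \<le> v" "y \<le> v"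
        for m x y h k z v w :: real using that by linarith
      have "dS (u p) (u q) \<le> dS (u p) h1 + dS h1 h2 + dS (u q) h2"
        using S.wdist_triangle[OF uc hc(1) uc, of p q] S.wdist_triangle[OF hc(1,2) uc, of q]
          S.wdist_commute[OF uc hc(2), of q] by linarith
      moreover have "l / \<mu> - c \<le> dS (u p) (u q)"
      proof -
        have "\<tau> p = a + real p" "\<tau> q = a + real q"
          using N(2)[of p] N(2)[of q] pq by (auto simp: \<tau>_def)
        then have "\<bar>\<tau> p - \<tau> q\<bar> = l" using \<open>p \<le> q\<close> by (simp add: l_def of_nat_diff)
        then show ?thesis using lower[OF \<tau> \<tau>, of p q] by (simp add: u_def)
      qed
      moreover have "l / \<mu> = l / (2 * \<mu>) + l / (2 * \<mu>)" using pos by (simp add: field_simps)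
      ultimately have "l / (2 * \<mu>) \<le> c + 2 * (\<eta> + R') + A * (4 * \<rho> + \<epsilon> * (n + \<rho>))"
        by (rule arith[OF _ _ _ Ah ph qh])
      then have lM: "l \<le> M" using pos by (simp add: M_def field_simps)
      have "dS (u p) (u i) \<le> \<eta> * real (i - p)" by (rule path_length[where u = u, OF uc us pq(1)])
      also have "\<dots> \<le> \<eta> * l" using pq pos by (simp add: l_def)
      also have "\<dots> \<le> \<eta> * M" using lM pos by simp
      finally have "dS (u i) h1 \<le> \<eta> * M + \<eta> + R'"
        using S.wdist_triangle[OF uc uc hc(1), of i p] S.wdist_commute[OF uc uc, of i p] ph by linarith
      then show ?thesis using h1(1) by (intro bexI[of _ h1]) auto
    qed
    then obtain h where h: "h \<in> E" "dS (u i) h \<le> max R' (\<eta> * M + \<eta> + R')" by blast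
    have "dS (\<gamma> t) h \<le> dS (\<gamma> t) (u i) + dS (u i) h"
      using t h(1) \<gamma>c uc by (intro S.wdist_triangle) auto
    then show ?thesis using h tu by (intro bexI[of _ h]) (auto simp: C_def)
  qed
  then show ?thesis by blast
qed

end

section \<open>Passage from \<open>E\<close> to the cyclic subgroup of \<open>g\<close>\<close>

theorem theorem1:
  fixes G :: "('a, 'b) monoid_scheme" (structure) and S E :: "'a set" and g :: 'a
  assumes "group G"
    and "finite S" and "S \<subseteq> carrier G" and "generate G S = carrier G"
    and "g \<in> carrier G" and "group.ord G g = 0"
    and "subgroup E G" and "virtually_cyclic (G\<lparr>carrier := E\<rparr>)" and "g \<in> E"
    and "hyperbolically_embedded G {E}"
  shows "morse G S g"
proof -
  obtain Y where Y: "hyperbolically_embedded_wrt G Y {E}"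
    using assms(10) by (auto simp: hyperbolically_embedded_def)
  interpret group G by fact
  interpret H: hyperbolically_embedded_finite_gens G Y E S
    using Y assms(2-4) by unfold_locales auto
  have cyc: "generate G {g} = {g [^] (k::int) | k. k \<in> UNIV}" by (rule generate_pow[OF assms(5)])
  have pow: "inv (g [^] s) \<otimes> g [^] t = g [^] (t - s)" for s t :: int
    using assms(5) by (metis add.commute add_uminus_conv_diff int_pow_mult int_pow_neg)
  have dpow: "word_dist G T (g [^] s) (g [^] t) = real (word_length G T (g [^] (t - s)))" for T and s t :: int
    by (simp add: word_dist_def pow)
  obtain \<kappa> where \<kappa>: "\<kappa> \<ge> 1" "\<And>x y. x \<in> carrier G \<Longrightarrow> y \<in> carrier G \<Longrightarrow> H.d x y \<le> \<kappa> * H.dS x y"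
    by (rule H.dist_compare) blast
  obtain A B where AB: "\<And>k::int. real_of_int \<bar>k\<bar> \<le> A * real (H.Y.len (g [^] k)) + B"
    using H.cyclic_subgroup_undistorted[OF assms(9,6,8)] by blast
  have qi: "\<exists>\<mu>\<ge>1. \<exists>c\<ge>0. qi_embedding \<mu> c (UNIV :: int set) dist (carrier G) (word_dist G S) (\<lambda>n. g [^] n)"
  proof -
    define L where "L = real (H.S.len g)"
    define A' where "A' = max 1 A"
    define B' where "B' = max 0 B"
    \<comment> \<open>One constant for both inequalities: \<open>L\<close> serves the upper one, and
      \<open>A' * \<kappa>\<close>, undistortion for \<open>Y\<close> combined with the comparison
      of metrics, the lower one.\<close>
    define \<mu> where "\<mu> = 1 + L + A' * \<kappa>"
    have up: "real (H.S.len (g [^] k)) \<le> L * \<bar>real_of_int k\<bar>" for k :: int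
    proof -
      have nat: "real (H.S.len (g [^] n)) \<le> L * real n" for n :: nat
      proof (induction n)
        case (Suc n)
        have "H.S.len (g [^] n \<otimes> g) \<le> H.S.len (g [^] n) + H.S.len g"
          using assms(5) by (intro H.S.len_mult) auto
        then show ?case using Suc by (simp add: L_def algebra_simps)
      qed simp
      show ?thesis
      proof (cases k)
        case (nonneg m)
        then show ?thesis using nat[of m] by (simp add: int_pow_int)
      next
        case (neg m)
        then have "g [^] k = inv (g [^] Suc m)" using int_pow_neg_int[OF assms(5), of "Suc m"] by (simp only:)
        then have "H.S.len (g [^] k) = H.S.len (g [^] Suc m)" using assms(5) by simp
        then show ?thesis using nat[of "Suc m"] neg by (simp add: add.commute)
      qed
    qed
    have lo: "\<bar>real_of_int k\<bar> \<le> A' * \<kappa> * real (H.S.len (g [^] k)) + B'" for k :: int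
    proof -
      have "real (H.Y.len (g [^] k)) \<le> \<kappa> * real (H.S.len (g [^] k))"
        using \<kappa>(2)[of "\<one>" "g [^] k"] assms(5) by (simp add: word_dist_def)
      then have "A' * real (H.Y.len (g [^] k)) \<le> A' * (\<kappa> * real (H.S.len (g [^] k)))"
        by (simp add: A'_def mult_left_mono)
      moreover have "A * real (H.Y.len (g [^] k)) \<le> A' * real (H.Y.len (g [^] k))"
        by (simp add: A'_def mult_right_mono)
      ultimately show ?thesis using AB[of k] by (simp add: B'_def)
    qed
    have A'1: "A' \<ge> 1" "B' \<ge> 0" "L \<ge> 0" by (simp_all add: A'_def B'_def L_def)
    then have Ak: "A' * \<kappa> \<ge> 1" using \<kappa>(1) mult_mono[of 1 A' 1 \<kappa>] by simp
    have \<mu>: "\<mu> \<ge> 1" "L \<le> \<mu>" "A' * \<kappa> \<le> \<mu>" using A'1 Ak by (simp_all add: \<mu>_def)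
    have "qi_embedding \<mu> B' (UNIV :: int set) dist (carrier G) (word_dist G S) (\<lambda>n. g [^] n)"
      unfolding qi_embedding_def
    proof (intro conjI ballI)
      show "range (\<lambda>n::int. g [^] n) \<subseteq> carrier G" using assms(5) by auto
      fix s t :: int
      let ?l = "real (H.S.len (g [^] (t - s)))"
      have dst: "dist s t = \<bar>real_of_int (t - s)\<bar>" by (simp add: dist_of_int[symmetric] dist_real_def abs_minus_commute)
      have "\<bar>real_of_int (t - s)\<bar> \<le> \<mu> * ?l + B'"
        using lo[of "t - s"] mult_right_mono[OF \<mu>(3), of ?l] by simp
      \<comment> \<open>The additive constant is enlarged so that division by \<open>\<mu>\<close>
        returns \<open>B'\<close>.\<close>
      also have "\<dots> \<le> \<mu> * ?l + \<mu> * B'" using mult_right_mono[OF \<mu>(1) A'1(2)] by simp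
      finally have "\<bar>real_of_int (t - s)\<bar> / \<mu> \<le> ?l + B'"
        using \<mu>(1) by (simp add: divide_le_eq algebra_simps)
      then show "dist s t / \<mu> - B' \<le> word_dist G S (g [^] s) (g [^] t)" by (simp add: dpow dst)
      have "?l \<le> \<mu> * \<bar>real_of_int (t - s)\<bar>"
        using up[of "t - s"] mult_right_mono[OF \<mu>(2), of "\<bar>real_of_int (t - s)\<bar>"] by simp
      then show "word_dist G S (g [^] s) (g [^] t) \<le> \<mu> * dist s t + B'" using A'1 by (simp add: dpow dst)
    qed
    then show ?thesis using \<mu>(1) A'1(2) by blast
  qed
  have sub: "generate G {g} \<subseteq> E" using generate_subgroup_incl[OF _ assms(7), of "{g}"] assms(9) by simp
  obtain F where F: "finite F" "F \<subseteq> E" "\<And>x. x \<in> E \<Longrightarrow> \<exists>k::int. \<exists>f\<in>F. x = g [^] k \<otimes> f"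
    using virtually_cyclic_transversal[OF assms(7,8,9,6)] by blast
  \<comment> \<open>By left invariance the distance from \<open>g [^] k\<close> to
    \<open>g [^] k \<otimes> f\<close> is the length of \<open>f\<close>; so \<open>E\<close> stays
    within \<open>D\<close> of the cyclic subgroup.\<close>
  define D where "D = (\<Sum>f\<in>F. real (H.S.len f))"
  have near: "\<exists>y\<in>generate G {g}. H.dS h y \<le> D" if hE: "h \<in> E" for h
  proof -
    obtain k :: int and f where f: "f \<in> F" "h = g [^] k \<otimes> f" using F(3)[OF hE] by blast
    have fc: "f \<in> carrier G" using f(1) F(2) by auto
    have "H.dS (g [^] k) h = real (H.S.len f)"
      using f(2) fc assms(5) by (simp add: word_dist_def m_assoc[symmetric])
    also have "\<dots> \<le> D" unfolding D_def by (rule member_le_sum[OF f(1) _ F(1)]) simp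
    finally have "H.dS h (g [^] k) \<le> D"
      using H.S.wdist_commute[of h "g [^] k"] hE assms(5) by simp
    then show ?thesis using cyc by blast
  qed
  have "\<exists>C. \<forall>a b \<gamma>. quasi_geodesic \<mu> c (carrier G) (word_dist G S) a b \<gamma> \<and>
      \<gamma> a \<in> generate G {g} \<and> \<gamma> b \<in> generate G {g} \<longrightarrow>
      \<gamma> ` {a..b} \<subseteq> closed_nbhd G S C (generate G {g})" if \<mu>: "\<mu> \<ge> 1" and c: "c \<ge> 0" for \<mu> c
  proof -
    obtain C where C: "\<And>a b \<gamma> t. quasi_geodesic \<mu> c (carrier G) H.dS a b \<gamma> \<Longrightarrow> \<gamma> a \<in> E \<Longrightarrow> \<gamma> b \<in> E \<Longrightarrow>
        t \<in> {a..b} \<Longrightarrow> \<exists>h\<in>E. H.dS (\<gamma> t) h \<le> C"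
      using H.quasi_geodesics_near_subgroup[OF \<mu> c] by blast
    show ?thesis
    proof (intro exI[of _ "C + D"] allI impI subsetI)
      fix a b \<gamma> x
      assume *: "quasi_geodesic \<mu> c (carrier G) (word_dist G S) a b \<gamma> \<and>
        \<gamma> a \<in> generate G {g} \<and> \<gamma> b \<in> generate G {g}" and "x \<in> \<gamma> ` {a..b}"
      then obtain t where t: "t \<in> {a..b}" "x = \<gamma> t" by blast
      have xc: "x \<in> carrier G"
        using * t by (auto simp: quasi_geodesic_def qi_embedding_def)
      obtain h where h: "h \<in> E" "H.dS x h \<le> C" using C[of a b \<gamma> t] * t sub by blast
      obtain y where y: "y \<in> generate G {g}" "H.dS h y \<le> D" using near[OF h(1)] by blast
      have "H.dS x y \<le> C + D"
        using H.S.wdist_triangle[of x h y] xc h y sub by force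
      then show "x \<in> closed_nbhd G S (C + D) (generate G {g})"
        unfolding closed_nbhd_def using xc y(1) by blast
    qed
  qed
  then show ?thesis unfolding morse_def using assms(5) qi by blast
qed

end
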